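(* Let $r\ge3$ and assume that for each $p\in D$, $f_p\in C^r(\mathbb R)$ and $f_p'(t)\ge0$ for all $t\in\mathbb R$. Let $K_\gamma\subset\mathbb R_+^E$ and $K_\varphi\subset\mathbb R^{\partial D}$ be compact, and set $K:=K_\gamma\times K_\varphi$. Let $m:=|\partial D|$. For $\varepsilon>0$ define $$\mathcal P_\varepsilon:=\bigl\{P=[v_1,\dots,v_m]\in\mathbb R^{m\times m}:\ \|v_i\|=1,\ i=1,\dots,m,\ |\det P|\ge\varepsilon\bigr\}.$$ Then there exists $t_0>0$, depending only on $K_\gamma$, $K_\varphi$ and $\varepsilon$, such that for every $P=[v_1,\dots,v_m]\in\mathcal P_\varepsilon$ and every $t\in(0,t_0]$ the following holds: if two pairs $(\gamma,\varphi),(\gamma',\varphi')\in K$ satisfy $$\varphi=\varphi',\qquad F_\gamma(\varphi)=F_{\gamma'}(\varphi'),\qquad F_\gamma(\varphi+tv_i)=F_{\gamma'}(\varphi'+tv_i),\quad i=1,\dots,m,$$ then $\gamma=\gamma'$.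
   Context: Square lattice. Fix an integer $n\ge1$. Let $D=\{(i,j): i,j=1,\dots,n\}$ (interior nodes), $\partial D=\{(0,j),(n+1,j),(i,0),(i,n+1): i,j=1,\dots,n\}$ (boundary nodes), $\overline D=D\cup\partial D$. The edge set $E$ consists of the unordered pairs $\{p,q\}$ with $p=(i,j)\in D$, $q=(i',j')\in\overline D$, $|i-i'|+|j-j'|=1$. For $p\in\overline D$, $N(p)=\{q\in\overline D:\{p,q\}\in E\}$. For a finite set $S$, $\mathbb R^S$ is the space of real functions on $S$; $\mathbb R_+=(0,\infty)$. A conductivity is $\gamma\in\mathbb R_+^E$, with $\gamma_{pq}=\gamma_{qp}$ its value on $\{p,q\}$. Direct problem. The lattice (i.e. $n$) and the family $f=(f_p)_{p\in D}$ of functions $\mathbb R\to\mathbb R$ are fixed. Given $\varphi\in\mathbb R^{\partial D}$, the semilinear Dirichlet problem is: find $u\in\mathbb R^{\overline D}$ with $\sum_{q\in N(p)}\gamma_{pq}(u_q-u_p)=f_p(u_p)$ for all $p\in D$ and $u_p=\varphi_p$ for all $p\in\partial D$. If each $f_p$ is continuous and non-decreasing there is a unique solution $u_{\gamma,\varphi}$. The nonlinear Dirichlet-to-Neumann map $F_\gamma:\mathbb R^{\partial D}\to\mathbb R^{\partial D}$ is $(F_\gamma(\varphi))_p=\sum_{q\in N(p)}\gamma_{pq}(u_p-u_q)$, $p\in\partial D$, with $u=u_{\gamma,\varphi}$. $\|\cdot\|$ is the Euclidean norm. $\mathbb R^{\partial D}$ is identified with $\mathbb R^m$ by a fixed ordering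 of $\partial D$, so that the columns $v_i$ of $P$ are elements of $\mathbb R^{\partial D}$. *)

theory Defs
  imports "HOL-Analysis.Analysis" "Jordan_Normal_Form.Determinant"
begin

(* HOL-Analysis and Jordan_Normal_Form both define vectors, matrices and det. The latter is
   imported last, so det, mat, vec, col and $ refer to its matrices and vectors, whose dimension
   is a natural number. *)
unbundle no vec_syntax

type_synonym node = "int \<times> int"

definition lattice_interior :: "nat \<Rightarrow> node set" where
  "lattice_interior n = {1..int n} \<times> {1..int n}"

(* The four corners (0, 0), (0, n + 1), (n + 1, 0), (n + 1, n + 1) are not nodes. *)
definition lattice_boundary :: "nat \<Rightarrow> node set" where
  "lattice_boundary n =
     {0, int n + 1} \<times> {1..int n} \<union> {1..int n} \<times> {0, int n + 1}"

definition lattice_nodes :: "nat \<Rightarrow> node set" where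
  "lattice_nodes n = lattice_interior n \<union> lattice_boundary n"

definition lattice_edges :: "nat \<Rightarrow> node set set" where
  "lattice_edges n =
     {{p, q} | p q. p \<in> lattice_interior n \<and> q \<in> lattice_nodes n \<and>
                    \<bar>fst p - fst q\<bar> + \<bar>snd p - snd q\<bar> = 1}"

definition neighbours :: "nat \<Rightarrow> node \<Rightarrow> node set" where
  "neighbours n p = {q \<in> lattice_nodes n. {p, q} \<in> lattice_edges n}"

(* For a finite set S, the space of real functions on S is the set of extensional functions
   S \<rightarrow>\<^sub>E UNIV, with its Euclidean topology, i.e. the product topology. *)
abbreviation fun_space :: "'a set \<Rightarrow> ('a \<Rightarrow> real) topology" where
  "fun_space S \<equiv> product_topology (\<lambda>_. euclideanreal) S"

definition conductivities :: "nat \<Rightarrow> (node set \<Rightarrow> real) set" where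
  "conductivities n = (lattice_edges n \<rightarrow>\<^sub>E {0<..})"

definition dirichlet_solution ::
  "nat \<Rightarrow> (node \<Rightarrow> real \<Rightarrow> real) \<Rightarrow> (node set \<Rightarrow> real) \<Rightarrow> (node \<Rightarrow> real) \<Rightarrow> (node \<Rightarrow> real) \<Rightarrow> bool" where
  "dirichlet_solution n f \<gamma> \<phi> u \<longleftrightarrow>
     u \<in> (lattice_nodes n \<rightarrow>\<^sub>E UNIV) \<and>
     (\<forall>p\<in>lattice_interior n. (\<Sum>q\<in>neighbours n p. \<gamma> {p, q} * (u q - u p)) = f p (u p)) \<and>
     (\<forall>p\<in>lattice_boundary n. u p = \<phi> p)"

(* The solution exists and is unique when every f p (p an interior node) is continuous and
   non-decreasing and \<gamma> is a conductivity; otherwise the value may be unspecified. *)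
definition the_solution ::
  "nat \<Rightarrow> (node \<Rightarrow> real \<Rightarrow> real) \<Rightarrow> (node set \<Rightarrow> real) \<Rightarrow> (node \<Rightarrow> real) \<Rightarrow> node \<Rightarrow> real" where
  "the_solution n f \<gamma> \<phi> = (THE u. dirichlet_solution n f \<gamma> \<phi> u)"

definition dirichlet_to_neumann ::
  "nat \<Rightarrow> (node \<Rightarrow> real \<Rightarrow> real) \<Rightarrow> (node set \<Rightarrow> real) \<Rightarrow> (node \<Rightarrow> real) \<Rightarrow> node \<Rightarrow> real" where
  "dirichlet_to_neumann n f \<gamma> \<phi> =
     (let u = the_solution n f \<gamma> \<phi>
      in (\<lambda>p\<in>lattice_boundary n. (\<Sum>q\<in>neighbours n p. \<gamma> {p, q} * (u p - u q))))"

definition C_times :: "nat \<Rightarrow> (real \<Rightarrow> real) \<Rightarrow> bool" where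
  "C_times r g \<longleftrightarrow>
     (\<forall>k<r. \<forall>x. (deriv ^^ k) g field_differentiable at x) \<and>
     continuous_on UNIV ((deriv ^^ r) g)"

definition unit_column_matrices :: "nat \<Rightarrow> real \<Rightarrow> real mat set" where
  "unit_column_matrices m \<epsilon> =
     {P \<in> carrier_mat m m. (\<forall>i<m. L2_set (\<lambda>j. col P i $ j) {..<m} = 1) \<and> \<bar>det P\<bar> \<ge> \<epsilon>}"

(* A vector of dimension m as a function on S, along an ordering \<sigma> 0, ..., \<sigma> (m - 1) of S. *)
definition vec_to_fun :: "(nat \<Rightarrow> 'a) \<Rightarrow> 'a set \<Rightarrow> real vec \<Rightarrow> 'a \<Rightarrow> real" where
  "vec_to_fun \<sigma> S v = (\<lambda>p\<in>S. v $ (inv_into {..<dim_vec v} \<sigma> p))"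

(* The boundary datum \<phi> + t v. *)
definition perturb :: "nat \<Rightarrow> (node \<Rightarrow> real) \<Rightarrow> real \<Rightarrow> (node \<Rightarrow> real) \<Rightarrow> node \<Rightarrow> real" where
  "perturb n \<phi> t v = (\<lambda>p\<in>lattice_boundary n. \<phi> p + t * v p)"

end

theory Submission
  imports Defs "HOL-Library.Landau_Symbols"
begin

text \<open>Suppose the claim fails. Then there are sequences \<open>t\<^sub>k \<rightarrow> 0\<close>, \<open>P\<^sub>k\<close>, \<open>\<phi>\<^sub>k\<close> and \<open>\<gamma>\<^sub>k \<noteq> \<gamma>'\<^sub>k\<close> with the same
  data; let \<open>\<delta>\<^sub>k = \<Sum>e. \<bar>\<gamma>\<^sub>k e - \<gamma>'\<^sub>k e\<bar>\<close>. It suffices that every edge difference is \<open>o(\<delta>\<^sub>k)\<close>, since then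
  \<open>\<delta>\<^sub>k = o(\<delta>\<^sub>k)\<close>. The maximum principle bounds all differences of solutions by \<open>O(\<delta>\<^sub>k)\<close>, and as the
  \<open>f p\<close> are \<open>C\<^sup>3\<close>, the difference quotients \<open>(u\<^bsub>\<phi> + t v\<^esub> - u\<^bsub>\<phi>\<^esub>) / t\<close> satisfy the linearized equation
  \<open>\<Sum>q. \<gamma>\<^bsub>pq\<^esub> (w\<^sub>q - w\<^sub>p) = f'\<^sub>p(u\<^sub>p) w\<^sub>p\<close> with residuals that differ by \<open>O(t\<^sub>k \<delta>\<^sub>k)\<close> between \<open>\<gamma>\<^sub>k\<close> and \<open>\<gamma>'\<^sub>k\<close>.
  Because \<open>P\<^sub>k\<close> is uniformly invertible, any boundary values may be prescribed for \<open>w\<close>.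

  The edges are recovered layer by layer from a corner. Choose \<open>w\<close> close to a solution that vanishes for
  \<open>i + j > s\<close> and is nonzero on the diagonal \<open>i + j = s\<close>. If the edges with \<open>i + j \<le> s\<close> are known up to
  \<open>o(\<delta>)\<close>, then \<open>u\<close> (hence the potential \<open>f'\<^sub>p(u\<^sub>p)\<close>) and \<open>w\<close> are known up to \<open>o(\<delta>)\<close> there; \<open>w\<close> is also known
  for \<open>i + j > s\<close> by continuation from the opposite side. The equations at the diagonals \<open>s\<close> and \<open>s + 1\<close>
  then determine alternately the two edges at each node between these diagonals. Two opposite corners
  exhaust the lattice. The linearized map alone would determine \<open>\<gamma>\<close> only up to a gauge in the inner
  nodes: that the potential is a known function of \<open>u\<close> is essential.\<close>

section \<open>The five-point operator on the lattice\<close>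

text \<open>Given on all of Z x Z and without \<open>n\<close>: at an interior node all four
  neighbours are nodes, and only there is it identified with the sum over \<open>neighbours\<close>.
  It is linear in the conductivity too, so it may be applied to differences of conductivities, of
  either sign.\<close>

fun lap :: "(node set \<Rightarrow> real) \<Rightarrow> (node \<Rightarrow> real) \<Rightarrow> node \<Rightarrow> real" where
  "lap \<gamma> u (i, j) =
     \<gamma> {(i, j), (i + 1, j)} * (u (i + 1, j) - u (i, j)) +
     \<gamma> {(i, j), (i - 1, j)} * (u (i - 1, j) - u (i, j)) +
     \<gamma> {(i, j), (i, j + 1)} * (u (i, j + 1) - u (i, j)) +
     \<gamma> {(i, j), (i, j - 1)} * (u (i, j - 1) - u (i, j))"

lemma interior_iff: "(i, j) \<in> lattice_interior n \<longleftrightarrow> 1 \<le> i \<and> i \<le> int n \<and> 1 \<le> j \<and> j \<le> int n"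
  by (auto simp: lattice_interior_def)

lemma boundary_iff:
  "(i, j) \<in> lattice_boundary n \<longleftrightarrow>
     ((i = 0 \<or> i = int n + 1) \<and> 1 \<le> j \<and> j \<le> int n) \<or>
     ((j = 0 \<or> j = int n + 1) \<and> 1 \<le> i \<and> i \<le> int n)"
  by (auto simp: lattice_boundary_def)

lemma nodes_iff: "p \<in> lattice_nodes n \<longleftrightarrow> p \<in> lattice_interior n \<or> p \<in> lattice_boundary n"
  by (auto simp: lattice_nodes_def)

lemma interior_boundary_disjoint: "p \<in> lattice_interior n \<Longrightarrow> p \<notin> lattice_boundary n"
  by (cases p) (auto simp: interior_iff boundary_iff)

lemma finite_nodes: "finite (lattice_nodes n)"
  by (auto simp: lattice_nodes_def lattice_interior_def lattice_boundary_def)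

lemma finite_boundary: "finite (lattice_boundary n)"
  by (auto simp: lattice_boundary_def)

lemma finite_interior: "finite (lattice_interior n)"
  by (auto simp: lattice_interior_def)

lemma finite_edges: "finite (lattice_edges n)"
proof (rule finite_subset)
  show "lattice_edges n \<subseteq> Pow (lattice_nodes n)"
    by (auto simp: lattice_edges_def lattice_nodes_def)
qed (simp add: finite_nodes)

lemma edges_iff:
  "{(i, j), (i', j')} \<in> lattice_edges n \<longleftrightarrow>
     ((i, j) \<in> lattice_interior n \<and> (i', j') \<in> lattice_nodes n \<or>
      (i', j') \<in> lattice_interior n \<and> (i, j) \<in> lattice_nodes n) \<and>
     \<bar>i - i'\<bar> + \<bar>j - j'\<bar> = 1"
  unfolding lattice_edges_def
  by (auto simp: doubleton_eq_iff abs_minus_commute) (metis abs_minus_commute)+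

lemma int_unit_step:
  fixes a b :: int
  assumes "\<bar>a\<bar> + \<bar>b\<bar> = 1"
  shows "(a = 1 \<and> b = 0) \<or> (a = -1 \<and> b = 0) \<or> (a = 0 \<and> b = 1) \<or> (a = 0 \<and> b = -1)"
  using assms by presburger

lemma edge_cases:
  assumes "e \<in> lattice_edges n"
  obtains (horizontal) i j where "e = {(i, j), (i + 1, j)}" "e \<in> lattice_edges n"
  | (vertical) i j where "e = {(i, j), (i, j + 1)}" "e \<in> lattice_edges n"
proof -
  obtain i j i' j' where e: "e = {(i, j), (i', j')}" "\<bar>i - i'\<bar> + \<bar>j - j'\<bar> = 1"
    using assms unfolding lattice_edges_def by force
  consider "i' = i + 1" "j' = j" | "i = i' + 1" "j' = j" | "i = i'" "j' = j + 1" | "i = i'" "j = j' + 1"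
    using int_unit_step[OF e(2)] by force
  then show thesis
  proof cases
    case 1
    then show ?thesis using that(1)[of i j] e assms by simp
  next
    case 2
    then show ?thesis using that(1)[of i' j] e assms by (simp add: insert_commute)
  next
    case 3
    then show ?thesis using that(2)[of i j] e assms by simp
  next
    case 4
    then show ?thesis using that(2)[of i j'] e assms by (simp add: insert_commute)
  qed
qed

lemma interior_edges:
  assumes "(i, j) \<in> lattice_interior n"
  shows "{(i, j), (i + 1, j)} \<in> lattice_edges n" "{(i, j), (i - 1, j)} \<in> lattice_edges n"
    "{(i, j), (i, j + 1)} \<in> lattice_edges n" "{(i, j), (i, j - 1)} \<in> lattice_edges n"
  using assms by (auto simp: edges_iff nodes_iff interior_iff boundary_iff)

lemma interior_neighbour_nodes:
  assumes "(i, j) \<in> lattice_interior n"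
  shows "(i, j) \<in> lattice_nodes n" "(i + 1, j) \<in> lattice_nodes n" "(i - 1, j) \<in> lattice_nodes n"
    "(i, j + 1) \<in> lattice_nodes n" "(i, j - 1) \<in> lattice_nodes n"
  using assms by (auto simp: nodes_iff interior_iff boundary_iff)

lemma neighbours_interior:
  assumes "(i, j) \<in> lattice_interior n"
  shows "neighbours n (i, j) = {(i + 1, j), (i - 1, j), (i, j + 1), (i, j - 1)}"
proof
  show "neighbours n (i, j) \<subseteq> {(i + 1, j), (i - 1, j), (i, j + 1), (i, j - 1)}"
  proof
    fix q assume q: "q \<in> neighbours n (i, j)"
    obtain i' j' where q': "q = (i', j')" by force
    have "\<bar>i - i'\<bar> + \<bar>j - j'\<bar> = 1"
      using q unfolding neighbours_def q' by (auto simp: edges_iff)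
    then show "q \<in> {(i + 1, j), (i - 1, j), (i, j + 1), (i, j - 1)}"
      using int_unit_step[of "i - i'" "j - j'"] unfolding q' by auto
  qed
  show "{(i + 1, j), (i - 1, j), (i, j + 1), (i, j - 1)} \<subseteq> neighbours n (i, j)"
    using interior_edges[OF assms] interior_neighbour_nodes[OF assms] by (auto simp: neighbours_def)
qed

lemma sum_neighbours_interior:
  assumes "p \<in> lattice_interior n"
  shows "(\<Sum>q\<in>neighbours n p. \<gamma> {p, q} * (u q - u p)) = lap \<gamma> u p"
proof -
  obtain i j where p: "p = (i, j)" by force
  show ?thesis using assms unfolding p by (simp add: neighbours_interior algebra_simps)
qed

text \<open>As the four corners are left out, a boundary node has a single neighbour. Each value of
  the Dirichlet-to-Neumann map is therefore the current through one edge.\<close>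

lemma neighbours_boundary:
  assumes "p \<in> lattice_boundary n" "q \<in> lattice_interior n" "{p, q} \<in> lattice_edges n"
  shows "neighbours n p = {q}"
proof -
  obtain i j k l where p: "p = (i, j)" and q: "q = (k, l)" by force
  have pn: "p \<notin> lattice_interior n"
    using assms(1) interior_boundary_disjoint by blast
  have st: "\<bar>i - k\<bar> + \<bar>j - l\<bar> = 1"
    using assms(3) unfolding p q by (simp add: edges_iff)
  have "r = q" if r: "r \<in> neighbours n p" for r
  proof -
    obtain i' j' where r': "r = (i', j')" by force
    have "r \<in> lattice_interior n" "\<bar>i - i'\<bar> + \<bar>j - j'\<bar> = 1"
      using r pn unfolding neighbours_def p r' by (auto simp: edges_iff)
    then show ?thesis
      using assms(1,2) int_unit_step[of "i - i'" "j - j'"] int_unit_step[OF st]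
      unfolding p q r' interior_iff boundary_iff by auto
  qed
  moreover have "q \<in> neighbours n p"
    using assms by (simp add: neighbours_def nodes_iff)
  ultimately show ?thesis by blast
qed

lemma dirichlet_solution_iff:
  "dirichlet_solution n f \<gamma> \<phi> u \<longleftrightarrow>
     u \<in> (lattice_nodes n \<rightarrow>\<^sub>E UNIV) \<and> (\<forall>p\<in>lattice_interior n. lap \<gamma> u p = f p (u p)) \<and>
     (\<forall>p\<in>lattice_boundary n. u p = \<phi> p)"
  unfolding dirichlet_solution_def by (simp add: sum_neighbours_interior)

lemma lap_diff: "lap \<gamma> (\<lambda>p. u p - v p) p = lap \<gamma> u p - lap \<gamma> v p"
  by (cases p) (simp add: algebra_simps)

lemma lap_cmult: "lap \<gamma> (\<lambda>p. c * u p) p = c * lap \<gamma> u p"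
  by (cases p) (simp add: algebra_simps)

lemma lap_uminus: "lap \<gamma> (\<lambda>p. - u p) p = - lap \<gamma> u p"
  by (cases p) (simp add: algebra_simps)

lemma lap_sum: "lap \<gamma> (\<lambda>p. \<Sum>i\<in>I. c i * u i p) p = (\<Sum>i\<in>I. c i * lap \<gamma> (u i) p)"
proof (induction I rule: infinite_finite_induct)
  case (insert x F)
  then show ?case by (cases p) (simp add: algebra_simps)
qed (cases p; simp)+

lemma lap_conductivity_diff: "lap (\<lambda>e. \<gamma> e - \<gamma>' e) u p = lap \<gamma> u p - lap \<gamma>' u p"
  by (cases p) (simp add: algebra_simps)

text \<open>The factor 8 is four edges times two for a difference of values.\<close>

lemma lap_abs_le:
  assumes "p \<in> lattice_interior n"
    and "\<And>e. e \<in> lattice_edges n \<Longrightarrow> \<bar>\<gamma> e\<bar> \<le> A"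
    and "\<And>q. q \<in> lattice_nodes n \<Longrightarrow> \<bar>u q\<bar> \<le> M"
  shows "\<bar>lap \<gamma> u p\<bar> \<le> 8 * A * M"
proof -
  obtain i j where p: "p = (i, j)" by force
  have term_le: "\<bar>\<gamma> e * (u q - u p)\<bar> \<le> A * (2 * M)" if "e \<in> lattice_edges n" "q \<in> lattice_nodes n" for e q
  proof -
    have "p \<in> lattice_nodes n" using assms(1) by (simp add: nodes_iff)
    then have "\<bar>u q - u p\<bar> \<le> 2 * M" using assms(3)[of p] assms(3)[OF that(2)] by linarith
    then show ?thesis unfolding abs_mult
      using assms(2)[OF that(1)] by (intro mult_mono) auto
  qed
  have ij: "(i, j) \<in> lattice_interior n" using assms(1) p by simp
  show ?thesis
    using term_le[OF interior_edges(1)[OF ij] interior_neighbour_nodes(2)[OF ij]]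
      term_le[OF interior_edges(2)[OF ij] interior_neighbour_nodes(3)[OF ij]]
      term_le[OF interior_edges(3)[OF ij] interior_neighbour_nodes(4)[OF ij]]
      term_le[OF interior_edges(4)[OF ij] interior_neighbour_nodes(5)[OF ij]]
    unfolding p lap.simps by linarith
qed

declare lap.simps [simp del]

section \<open>Maximum principle and solvability\<close>

definition uniformly_elliptic :: "nat \<Rightarrow> real \<Rightarrow> real \<Rightarrow> (node set \<Rightarrow> real) \<Rightarrow> bool" where
  "uniformly_elliptic n a A \<gamma> \<longleftrightarrow>
     0 < a \<and> a \<le> A \<and> (\<forall>e\<in>lattice_edges n. a \<le> \<gamma> e \<and> \<gamma> e \<le> A)"

lemma uniformly_ellipticD:
  assumes "uniformly_elliptic n a A \<gamma>"
  shows "0 < a" "a \<le> A" "e \<in> lattice_edges n \<Longrightarrow> a \<le> \<gamma> e \<and> \<gamma> e \<le> A"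
  using assms by (auto simp: uniformly_elliptic_def)

text \<open>With \<open>\<rho> = A / a + 1\<close>, the barrier
  \<open>\<rho> ^ (n + 1) - \<rho> ^ i\<close> lies between 0 and \<open>\<rho> ^ (n + 1)\<close> on
  the lattice and its \<open>lap\<close> is at most \<open>- A\<close>. The quotient bounds the
  Green operator in the sup norm, uniformly over all conductivities between \<open>a\<close> and
  \<open>A\<close>.\<close>

definition green_bound :: "nat \<Rightarrow> real \<Rightarrow> real \<Rightarrow> real" where
  "green_bound n a A = (A / a + 1) ^ (n + 1) / A"

lemma lap_nonpos_at_maximum:
  assumes "p \<in> lattice_interior n" "\<And>e. e \<in> lattice_edges n \<Longrightarrow> 0 \<le> \<gamma> e"
    and "\<And>q. q \<in> lattice_nodes n \<Longrightarrow> v q \<le> v p"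
  shows "lap \<gamma> v p \<le> 0"
proof -
  obtain i j where p: "p = (i, j)" by force
  have ij: "(i, j) \<in> lattice_interior n" using assms(1) p by simp
  have "\<gamma> e * (v q - v p) \<le> 0" if "e \<in> lattice_edges n" "q \<in> lattice_nodes n" for e q
    using assms(2)[OF that(1)] assms(3)[OF that(2)] by (simp add: mult_le_0_iff)
  from this[OF interior_edges(1)[OF ij] interior_neighbour_nodes(2)[OF ij]]
    this[OF interior_edges(2)[OF ij] interior_neighbour_nodes(3)[OF ij]]
    this[OF interior_edges(3)[OF ij] interior_neighbour_nodes(4)[OF ij]]
    this[OF interior_edges(4)[OF ij] interior_neighbour_nodes(5)[OF ij]]
  show ?thesis unfolding p lap.simps by linarith
qed

text \<open>The function depends on \<open>i\<close> only, so \<open>lap\<close> equals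
  \<open>- \<rho> ^ (i - 1) * (\<rho> - 1) * (\<rho> * r - l)\<close> with \<open>r\<close> and
  \<open>l\<close> the conductivities to the right and to the left. Here
  \<open>\<rho> * r - l\<close> is at least \<open>\<rho> * a - A = a\<close>, and
  \<open>(\<rho> - 1) * a = A\<close>.\<close>

lemma barrier_lap:
  assumes ell: "uniformly_elliptic n a A \<gamma>" and p: "p \<in> lattice_interior n"
  shows "lap \<gamma> (\<lambda>(i, j). c - (A / a + 1) ^ nat i) p \<le> - A"
proof -
  note a = uniformly_ellipticD(1,2)[OF ell] and \<gamma> = uniformly_ellipticD(3)[OF ell]
  obtain i j where ij: "p = (i, j)" by force
  have int: "(i, j) \<in> lattice_interior n" using p ij by simp
  define m where "m = nat (i - 1)"
  have i: "i = int m + 1" using int by (simp add: interior_iff m_def)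
  define \<rho> where "\<rho> = A / a + 1"
  have \<rho>: "\<rho> \<ge> 1" using a by (simp add: \<rho>_def)
  have nats: "nat i = m + 1" "nat (i + 1) = m + 2" "nat (i - 1) = m" using i by auto
  let ?r = "\<gamma> {(i, j), (i + 1, j)}" and ?l = "\<gamma> {(i, j), (i - 1, j)}"
  have "A = (\<rho> - 1) * (\<rho> * a - A)"
    using a by (simp add: \<rho>_def field_simps)
  also have "\<dots> \<le> (\<rho> - 1) * (\<rho> * ?r - ?l)"
    using \<gamma>[OF interior_edges(1)[OF int]] \<gamma>[OF interior_edges(2)[OF int]] \<rho>
    by (intro mult_left_mono diff_mono) auto
  also have "\<dots> \<le> \<rho> ^ m * ((\<rho> - 1) * (\<rho> * ?r - ?l))"
  proof -
    have "0 \<le> (\<rho> - 1) * (\<rho> * ?r - ?l)"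
      using calculation a by linarith
    then show ?thesis using mult_right_mono[OF one_le_power[OF \<rho>, of m]] by force
  qed
  finally have "A \<le> \<rho> ^ m * ((\<rho> - 1) * (\<rho> * ?r - ?l))" .
  then show ?thesis
    unfolding ij lap.simps split nats \<rho>_def[symmetric] by (simp add: algebra_simps)
qed

text \<open>Subtracting a multiple of the barrier, with a slack \<open>e\<close>, makes
  \<open>lap\<close> strictly positive wherever \<open>w\<close> is positive inside, which excludes
  an interior maximum above \<open>B\<close>; then \<open>e\<close> tends to 0. The inequality is
  asked for only where \<open>w\<close> is positive, so that terms \<open>c * w\<close> with
  \<open>c \<ge> 0\<close> and monotone nonlinearities have the right sign there.\<close>

lemma maximum_principle:
  assumes ell: "uniformly_elliptic n a A \<gamma>"
    and R: "0 \<le> R" and B: "0 \<le> B"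
    and sub: "\<And>p. p \<in> lattice_interior n \<Longrightarrow> 0 < w p \<Longrightarrow> - R \<le> lap \<gamma> w p"
    and bdry: "\<And>p. p \<in> lattice_boundary n \<Longrightarrow> w p \<le> B"
    and p: "p \<in> lattice_nodes n"
  shows "w p \<le> B + green_bound n a A * R"
proof -
  note a = uniformly_ellipticD(1,2)[OF ell] and \<gamma> = uniformly_ellipticD(3)[OF ell]
  define \<rho> where "\<rho> = A / a + 1"
  have \<rho>: "\<rho> \<ge> 1" using a by (simp add: \<rho>_def)
  define \<beta> where "\<beta> = (\<lambda>(i::int, j::int). \<rho> ^ (n + 1) - \<rho> ^ nat i)"
  have \<beta>_nonneg: "0 \<le> \<beta> q" if "q \<in> lattice_nodes n" for q
  proof -
    obtain i j where q: "q = (i, j)" by force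
    have "nat i \<le> n + 1" using that unfolding q nodes_iff interior_iff boundary_iff by auto
    from power_increasing[OF this \<rho>] show ?thesis by (simp add: q \<beta>_def)
  qed
  have \<beta>_le: "\<beta> q \<le> \<rho> ^ (n + 1)" for q
    using \<rho> by (cases q) (simp add: \<beta>_def)
  have step: "w p \<le> B + (R + e) * (\<rho> ^ (n + 1) / A)" if e: "0 < e" for e
  proof -
    define v where "v = (\<lambda>q. w q - (R + e) / A * \<beta> q)"
    obtain p' where p': "p' \<in> lattice_nodes n" and max: "\<And>q. q \<in> lattice_nodes n \<Longrightarrow> v q \<le> v p'"
    proof -
      have "Max (v ` lattice_nodes n) \<in> v ` lattice_nodes n"
        using p finite_nodes by (intro Max_in) auto
      then obtain p' where "p' \<in> lattice_nodes n" "v p' = Max (v ` lattice_nodes n)" by force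
      moreover have "v q \<le> Max (v ` lattice_nodes n)" if "q \<in> lattice_nodes n" for q
        using that finite_nodes by (intro Max_ge) auto
      ultimately show thesis using that by metis
    qed
    have v_le_w: "v p' \<le> w p'"
      using \<beta>_nonneg[OF p'] R e a by (simp add: v_def)
    have "v p' \<le> B"
    proof (rule ccontr)
      assume "\<not> v p' \<le> B"
      then have w: "w p' > B" using v_le_w by linarith
      then have int: "p' \<in> lattice_interior n" using p' bdry nodes_iff by fastforce
      have "lap \<gamma> v p' = lap \<gamma> w p' - (R + e) / A * lap \<gamma> \<beta> p'"
        unfolding v_def lap_diff lap_cmult ..
      moreover have "lap \<gamma> \<beta> p' \<le> - A"
        using barrier_lap[OF ell int] unfolding \<beta>_def \<rho>_def by blast
      then have "(R + e) / A * lap \<gamma> \<beta> p' \<le> (R + e) / A * (- A)"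
        using R e a by (intro mult_left_mono) auto
      moreover have "- R \<le> lap \<gamma> w p'" using sub[OF int] w B by simp
      ultimately have "lap \<gamma> v p' > 0" using e a by simp
      moreover have "lap \<gamma> v p' \<le> 0"
      proof (rule lap_nonpos_at_maximum[OF int])
        show "0 \<le> \<gamma> e" if "e \<in> lattice_edges n" for e using \<gamma>[OF that] a by linarith
      qed (rule max)
      ultimately show False by simp
    qed
    then have "w p \<le> B + (R + e) / A * \<beta> p"
      using max[OF p] by (simp add: v_def)
    also have "(R + e) / A * \<beta> p \<le> (R + e) / A * \<rho> ^ (n + 1)"
      using \<beta>_le R e a by (intro mult_left_mono) auto
    finally show ?thesis by (simp add: field_simps)
  qed
  have G: "0 < \<rho> ^ (n + 1) / A" using \<rho> a by auto
  have "w p \<le> B + R * (\<rho> ^ (n + 1) / A)"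
  proof (rule field_le_epsilon)
    fix e :: real assume "0 < e"
    define g where "g = \<rho> ^ (n + 1) / A"
    have "0 < g" using G by (simp add: g_def)
    then have "0 < e / g" using \<open>0 < e\<close> by simp
    from step[OF this] have "w p \<le> B + (R + e / g) * g" by (simp only: g_def)
    also have "(R + e / g) * g = R * g + e" using \<open>0 < g\<close> by (simp add: field_simps)
    finally show "w p \<le> B + R * (\<rho> ^ (n + 1) / A) + e" by (simp add: g_def)
  qed
  then show ?thesis by (simp add: green_bound_def \<rho>_def mult.commute)
qed

lemma green_bound_nonneg: "0 < a \<Longrightarrow> a \<le> A \<Longrightarrow> 0 \<le> green_bound n a A"
  by (simp add: green_bound_def)

text \<open>The maximum principle is applied to \<open>w\<close> and to \<open>- w\<close>. The
  coefficient \<open>c\<close> may vary from node to node and remain implicit, so it can come from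
  the mean value theorem; this covers differences of solutions of the nonlinear problem.\<close>

lemma stability_bound:
  assumes ell: "uniformly_elliptic n a A \<gamma>"
    and R: "0 \<le> R" and B: "0 \<le> B"
    and eq: "\<And>p. p \<in> lattice_interior n \<Longrightarrow> \<exists>c\<ge>0. \<bar>lap \<gamma> w p - c * w p\<bar> \<le> R"
    and bdry: "\<And>p. p \<in> lattice_boundary n \<Longrightarrow> \<bar>w p\<bar> \<le> B"
    and p: "p \<in> lattice_nodes n"
  shows "\<bar>w p\<bar> \<le> B + green_bound n a A * R"
proof -
  note a = uniformly_ellipticD(1,2)[OF ell] and \<gamma> = uniformly_ellipticD(3)[OF ell]
  have "w p \<le> B + green_bound n a A * R"
  proof (rule maximum_principle[OF ell R B _ _ p])
    fix p assume "p \<in> lattice_interior n" "0 < w p"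
    with eq[of p] obtain c where c: "c \<ge> 0" "\<bar>lap \<gamma> w p - c * w p\<bar> \<le> R" by blast
    have "0 \<le> c * w p" using c \<open>0 < w p\<close> by simp
    then show "- R \<le> lap \<gamma> w p" using c(2) by linarith
  qed (use bdry abs_le_D1 in blast)+
  moreover have "- w p \<le> B + green_bound n a A * R"
  proof (rule maximum_principle[OF ell R B _ _ p, where w = "\<lambda>q. - w q"])
    fix p assume "p \<in> lattice_interior n" "0 < - w p"
    with eq[of p] obtain c where c: "c \<ge> 0" "\<bar>lap \<gamma> w p - c * w p\<bar> \<le> R" by blast
    have "c * w p \<le> 0" using c \<open>0 < - w p\<close> by (simp add: mult_le_0_iff)
    then show "- R \<le> lap \<gamma> (\<lambda>q. - w q) p" using c(2) unfolding lap_uminus by linarith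
  qed (use bdry abs_le_D2 in blast)+
  ultimately show ?thesis by linarith
qed


section \<open>Existence and uniqueness for the semilinear Dirichlet problem\<close>

lemma continuous_at_eps_delta_neg:
  fixes g :: "real \<Rightarrow> real"
  assumes "isCont g x" "g x < 0"
  shows "\<exists>d>0. \<forall>s. \<bar>s - x\<bar> < d \<longrightarrow> g s < 0"
proof -
  obtain d where d: "d > 0" "\<And>s. dist s x < d \<Longrightarrow> dist (g s) (g x) < - g x"
    using assms(1)[unfolded continuous_at_eps_delta, rule_format, of "- g x"] assms(2) by auto
  have "g s < 0" if "\<bar>s - x\<bar> < d" for s
  proof -
    have "\<bar>g s - g x\<bar> < - g x" using d(2)[of s] that by (simp add: dist_real_def)
    then show ?thesis by linarith
  qed
  then show ?thesis using d(1) by blast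
qed

text \<open>The neighbours enter with nonnegative weights, and at the centre, whose weight is
  negative, the two functions agree.\<close>

lemma lap_mono:
  assumes p: "p \<in> lattice_interior n" and \<gamma>: "\<And>e. e \<in> lattice_edges n \<Longrightarrow> 0 \<le> \<gamma> e"
    and le: "\<And>q. q \<in> lattice_nodes n \<Longrightarrow> u q \<le> v q" and eq: "u p = v p"
  shows "lap \<gamma> u p \<le> lap \<gamma> v p"
proof -
  obtain i j where ij: "p = (i, j)" by force
  have int: "(i, j) \<in> lattice_interior n" using p ij by simp
  show ?thesis
    unfolding ij lap.simps eq[unfolded ij]
    by (intro add_mono mult_left_mono diff_mono order_refl \<gamma> le interior_edges[OF int]
        interior_neighbour_nodes[OF int])
qed

lemma lap_cong:
  assumes p: "p \<in> lattice_interior n" and eq: "\<And>q. q \<in> lattice_nodes n \<Longrightarrow> u q = v q"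
  shows "lap \<gamma> u p = lap \<gamma> v p"
proof -
  obtain i j where ij: "p = (i, j)" by force
  have int: "(i, j) \<in> lattice_interior n" using p ij by simp
  show ?thesis
    unfolding ij lap.simps by (simp only: eq interior_neighbour_nodes[OF int])
qed

lemma continuous_lap_fun_upd: "continuous_on UNIV (\<lambda>s. lap \<gamma> (u(p := s)) p)"
proof -
  obtain i j where p: "p = (i, j)" by force
  show ?thesis unfolding p lap.simps by (simp, intro continuous_intros)
qed

text \<open>Perron's method: the pointwise supremum of all subsolutions is a solution.\<close>

lemma dirichlet_solution_exists:
  assumes ell: "uniformly_elliptic n a A \<gamma>"
    and cont: "\<And>p. p \<in> lattice_interior n \<Longrightarrow> continuous_on UNIV (f p)"
    and mono: "\<And>p. p \<in> lattice_interior n \<Longrightarrow> mono (f p)"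
  shows "\<exists>u. dirichlet_solution n f \<gamma> \<phi> u"
proof -
  note a = uniformly_ellipticD(1,2)[OF ell] and \<gamma> = uniformly_ellipticD(3)[OF ell]
  have \<gamma>0: "0 \<le> \<gamma> e" if "e \<in> lattice_edges n" for e using \<gamma>[OF that] a by linarith
  obtain B where B: "0 \<le> B" "\<And>p. p \<in> lattice_boundary n \<Longrightarrow> \<bar>\<phi> p\<bar> \<le> B"
  proof
    show "0 \<le> (\<Sum>p\<in>lattice_boundary n. \<bar>\<phi> p\<bar>)" by (simp add: sum_nonneg)
  qed (rule member_le_sum; simp add: finite_boundary)
  obtain R where R: "0 \<le> R" "\<And>p. p \<in> lattice_interior n \<Longrightarrow> \<bar>f p 0\<bar> \<le> R"
  proof
    show "0 \<le> (\<Sum>p\<in>lattice_interior n. \<bar>f p 0\<bar>)" by (simp add: sum_nonneg)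
  qed (rule member_le_sum; simp add: finite_interior)
  define S where "S = {u. (\<forall>p\<in>lattice_interior n. f p (u p) \<le> lap \<gamma> u p) \<and> (\<forall>p\<in>lattice_boundary n. u p = \<phi> p)}"
  have S_bound: "u p \<le> B + green_bound n a A * R" if u: "u \<in> S" and p: "p \<in> lattice_nodes n" for u p
  proof (rule maximum_principle[OF ell R(1) B(1) _ _ p])
    fix p assume p: "p \<in> lattice_interior n" "0 < u p"
    have "- R \<le> f p 0" using R(2)[OF p(1)] by linarith
    also have "\<dots> \<le> f p (u p)" using p(2) by (intro monoD[OF mono[OF p(1)]]) simp
    also have "\<dots> \<le> lap \<gamma> u p" using u p by (simp add: S_def)
    finally show "- R \<le> lap \<gamma> u p" .
  next
    fix p assume "p \<in> lattice_boundary n"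
    then show "u p \<le> B" using B(2)[of p] u by (simp add: S_def)
  qed
  \<comment> \<open>A subsolution to start from: \<open>R / A\<close> times the barrier has
    \<open>lap\<close> at most \<open>- R\<close>, so its negative has \<open>lap\<close> at least
    \<open>R\<close>, hence at least \<open>f p 0\<close>. The shift by \<open>- B\<close> puts it
    below the boundary values, and restoring \<open>\<phi>\<close> on the boundary can only increase
    \<open>lap\<close> inside.\<close>
  define \<beta> where "\<beta> = (\<lambda>(i::int, j::int). (A / a + 1) ^ (n + 1) - (A / a + 1) ^ nat i)"
  define u\<^sub>0 where "u\<^sub>0 = (\<lambda>p. - R / A * \<beta> p - B)"
  have \<beta>_nonneg: "0 \<le> \<beta> q" if "q \<in> lattice_nodes n" for q
  proof -
    obtain i j where q: "q = (i, j)" by force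
    have "nat i \<le> n + 1" using that unfolding q nodes_iff interior_iff boundary_iff by auto
    moreover have "1 \<le> A / a + 1" using a by simp
    ultimately have "(A / a + 1) ^ nat i \<le> (A / a + 1) ^ (n + 1)" by (rule power_increasing)
    then show ?thesis by (simp add: q \<beta>_def)
  qed
  have u\<^sub>0_le: "u\<^sub>0 q \<le> - B" if "q \<in> lattice_nodes n" for q
    using \<beta>_nonneg[OF that] R a by (simp add: u\<^sub>0_def)
  have "(\<lambda>p. if p \<in> lattice_boundary n then \<phi> p else u\<^sub>0 p) \<in> S" (is "?u \<in> S")
    unfolding S_def
  proof (intro CollectI conjI ballI)
    fix p assume p: "p \<in> lattice_interior n"
    have up: "?u p = u\<^sub>0 p" using interior_boundary_disjoint[OF p] by simp
    have "f p (u\<^sub>0 p) \<le> f p 0"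
      using u\<^sub>0_le[of p] p B(1) by (intro monoD[OF mono[OF p]]) (auto simp: nodes_iff)
    also have "\<dots> \<le> - R / A * (- A)" using R(2)[OF p] a by auto
    also have "\<dots> \<le> - R / A * lap \<gamma> \<beta> p"
      using barrier_lap[OF ell p] R a unfolding \<beta>_def by (intro mult_left_mono_neg) auto
    also have "\<dots> = lap \<gamma> u\<^sub>0 p"
      unfolding u\<^sub>0_def lap_diff lap_cmult by (cases p) (simp add: lap.simps)
    also have "\<dots> \<le> lap \<gamma> ?u p"
    proof (rule lap_mono[OF p])
      show "0 \<le> \<gamma> e" if "e \<in> lattice_edges n" for e using that by (rule \<gamma>0)
    next
      show "u\<^sub>0 q \<le> ?u q" if "q \<in> lattice_nodes n" for q
        using u\<^sub>0_le[OF that] B(2)[of q] by auto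
    qed (simp_all add: up)
    finally show "f p (?u p) \<le> lap \<gamma> ?u p" by (simp only: up)
  qed simp
  then have S_ne: "S \<noteq> {}" by blast
  define us where "us p = (SUP u\<in>S. u p)" for p
  have bdd: "bdd_above ((\<lambda>u. u p) ` S)" if "p \<in> lattice_nodes n" for p
    using S_bound that by (intro bdd_aboveI2) blast
  have us_upper: "u p \<le> us p" if "u \<in> S" "p \<in> lattice_nodes n" for u p
    unfolding us_def by (rule cSUP_upper[OF that(1) bdd[OF that(2)]])
  have us_boundary: "us p = \<phi> p" if "p \<in> lattice_boundary n" for p
  proof -
    have "(\<lambda>u. u p) ` S = {\<phi> p}" using that S_ne by (auto simp: S_def)
    then show ?thesis by (simp add: us_def)
  qed
  have cont': "continuous_on UNIV (\<lambda>s. lap \<gamma> (us(p := s)) p - f p s)" if "p \<in> lattice_interior n" for p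
    using cont[OF that] continuous_lap_fun_upd by (intro continuous_on_diff) auto
  \<comment> \<open>Only the value at \<open>p\<close> is varied, the others stay at the supremum. A
    failure persists for values near \<open>us p\<close>, and some member of \<open>S\<close> takes
    such a value; but raising the other values of this member to \<open>us\<close> keeps the
    inequality at \<open>p\<close>.\<close>
  have us_sub: "f p (us p) \<le> lap \<gamma> us p" if p: "p \<in> lattice_interior n" for p
  proof (rule ccontr)
    assume no: "\<not> ?thesis"
    have pn: "p \<in> lattice_nodes n" using p by (simp add: nodes_iff)
    let ?g = "\<lambda>s. lap \<gamma> (us(p := s)) p - f p s"
    have "isCont ?g (us p)" using cont'[OF p] by (simp add: continuous_on_eq_continuous_at)
    moreover have "?g (us p) < 0" using no by simp
    ultimately obtain d where d: "d > 0" "\<And>s. \<bar>s - us p\<bar> < d \<Longrightarrow> ?g s < 0"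
      using continuous_at_eps_delta_neg[of "us p" ?g] by blast
    have "us p - d < (SUP u\<in>S. u p)" using d by (simp add: us_def)
    then obtain u where u: "u \<in> S" "us p - d < u p"
      using less_cSUP_iff[OF S_ne bdd[OF pn]] by blast
    have "f p (u p) \<le> lap \<gamma> u p" using u p by (simp add: S_def)
    also have "\<dots> \<le> lap \<gamma> (us(p := u p)) p"
      using us_upper[OF u(1)] by (intro lap_mono[OF p]) (auto intro: \<gamma>0)
    finally have "?g (u p) \<ge> 0" by simp
    moreover have "\<bar>u p - us p\<bar> < d" using u(2) us_upper[OF u(1) pn] by linarith
    ultimately show False using d(2)[of "u p"] by linarith
  qed
  have us_super: "lap \<gamma> us p \<le> f p (us p)" if p: "p \<in> lattice_interior n" for p
  proof (rule ccontr)
    assume no: "\<not> ?thesis"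
    have pn: "p \<in> lattice_nodes n" using p by (simp add: nodes_iff)
    let ?g = "\<lambda>s. f p s - lap \<gamma> (us(p := s)) p"
    have "isCont (\<lambda>s. - (lap \<gamma> (us(p := s)) p - f p s)) (us p)"
      using cont'[OF p] by (intro continuous_minus) (simp add: continuous_on_eq_continuous_at)
    then have "isCont ?g (us p)" by simp
    moreover have "?g (us p) < 0" using no by simp
    ultimately obtain d where d: "d > 0" "\<And>s. \<bar>s - us p\<bar> < d \<Longrightarrow> ?g s < 0"
      using continuous_at_eps_delta_neg[of "us p" ?g] by blast
    \<comment> \<open>Where \<open>lap\<close> strictly exceeds \<open>f p\<close>, the value can be
      raised a little without leaving \<open>S\<close>, since \<open>lap\<close> at the other nodes
      does not decrease. This contradicts the choice of \<open>us\<close> as the supremum.\<close>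
    let ?s = "us p + d / 2"
    have "us(p := ?s) \<in> S" unfolding S_def
    proof (intro CollectI conjI ballI)
      fix r assume r: "r \<in> lattice_interior n"
      show "f r ((us(p := ?s)) r) \<le> lap \<gamma> (us(p := ?s)) r"
      proof (cases "r = p")
        case True
        then show ?thesis using d(2)[of ?s] d(1) by simp
      next
        case False
        have "lap \<gamma> us r \<le> lap \<gamma> (us(p := ?s)) r"
          using False d(1) by (intro lap_mono[OF r]) (auto intro: \<gamma>0)
        then show ?thesis using us_sub[OF r] False by simp
      qed
    next
      fix r assume "r \<in> lattice_boundary n"
      then show "(us(p := ?s)) r = \<phi> r"
        using interior_boundary_disjoint[OF p] us_boundary by auto
    qed
    from us_upper[OF this pn] show False using d(1) by simp
  qed
  have "dirichlet_solution n f \<gamma> \<phi> (restrict us (lattice_nodes n))"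
    unfolding dirichlet_solution_iff
  proof (intro conjI ballI)
    fix p assume p: "p \<in> lattice_interior n"
    have "lap \<gamma> (restrict us (lattice_nodes n)) p = lap \<gamma> us p"
      by (rule lap_cong[OF p]) simp
    then show "lap \<gamma> (restrict us (lattice_nodes n)) p = f p (restrict us (lattice_nodes n) p)"
      using us_sub[OF p] us_super[OF p] p by (simp add: nodes_iff)
  qed (simp_all add: us_boundary nodes_iff)
  then show ?thesis by (intro exI)
qed

lemma dirichlet_solution_unique:
  assumes ell: "uniformly_elliptic n a A \<gamma>"
    and mono: "\<And>p. p \<in> lattice_interior n \<Longrightarrow> mono (f p)"
    and u: "dirichlet_solution n f \<gamma> \<phi> u" and v: "dirichlet_solution n f \<gamma> \<phi> v"
  shows "u = v"
proof -
  note a = uniformly_ellipticD(1,2)[OF ell] and \<gamma> = uniformly_ellipticD(3)[OF ell]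
  have le: "u p \<le> v p" if u: "dirichlet_solution n f \<gamma> \<phi> u" and v: "dirichlet_solution n f \<gamma> \<phi> v"
    and p: "p \<in> lattice_nodes n" for u v p
  proof -
    have "u p - v p \<le> 0 + green_bound n a A * 0"
    proof (rule maximum_principle[OF ell _ _ _ _ p])
      fix p assume p: "p \<in> lattice_interior n" "0 < u p - v p"
      then have "f p (v p) \<le> f p (u p)" by (intro monoD[OF mono[OF p(1)]]) simp
      then show "- 0 \<le> lap \<gamma> (\<lambda>p. u p - v p) p"
        using u v p unfolding dirichlet_solution_iff lap_diff by simp
    qed (use u v in \<open>auto simp: dirichlet_solution_iff\<close>)
    then show ?thesis by simp
  qed
  have "u p = v p" for p
  proof (cases "p \<in> lattice_nodes n")
    case True
    then show ?thesis using le[OF u v] le[OF v u] by (simp add: order_antisym)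
  next
    case False
    then show ?thesis using u v unfolding dirichlet_solution_iff by (metis PiE_arb)
  qed
  then show ?thesis ..
qed

section \<open>Special solutions supported near a corner\<close>

lemma smallo_mult_bounded:
  fixes f g \<delta> :: "nat \<Rightarrow> real"
  assumes "f \<in> o(\<delta>)" "g \<in> O(\<lambda>_. 1)"
  shows "(\<lambda>k. f k * g k) \<in> o(\<delta>)" "(\<lambda>k. g k * f k) \<in> o(\<delta>)"
  using landau_o.small_big_mult[OF assms] landau_o.big_small_mult[OF assms(2,1)] by simp_all

lemma bigo_mult_vanishing:
  fixes f g \<delta> :: "nat \<Rightarrow> real"
  assumes "f \<in> O(\<delta>)" "g \<in> o(\<lambda>_. 1)"
  shows "(\<lambda>k. f k * g k) \<in> o(\<delta>)"
  using landau_o.big_small_mult[OF assms] by simp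

lemma bounded_mult:
  fixes f g :: "nat \<Rightarrow> real"
  assumes "f \<in> O(\<lambda>_. 1)" "g \<in> O(\<lambda>_. 1)"
  shows "(\<lambda>k. f k * g k) \<in> O(\<lambda>_. 1)"
  using landau_o.big_mult[OF assms] by simp

lemma smallo_cancel_bounded_inverse:
  fixes f g \<delta> :: "nat \<Rightarrow> real"
  assumes "(\<lambda>k. f k * g k) \<in> o(\<delta>)" "(\<lambda>k. inverse (g k)) \<in> O(\<lambda>_. 1)" "\<And>k. g k \<noteq> 0"
  shows "f \<in> o(\<delta>)"
  using smallo_mult_bounded(1)[OF assms(1,2)] assms(3) by (simp add: mult.assoc)

lemma bigo_one_if_abs_le: "\<forall>k. \<bar>f k\<bar> \<le> C \<Longrightarrow> f \<in> O(\<lambda>_::nat. 1::real)"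
  by (rule bigoI[of _ C]) auto

text \<open>A solution of \<open>lap \<gamma> W = q W\<close> supported on \<open>i + j \<le> s\<close>, computed column by column from the
  right: the equation at \<open>(i, j)\<close> determines \<open>W (i - 1, j)\<close>, and the values at the boundary nodes
  \<open>(i, 0)\<close> are free. The column \<open>i\<close> is stored under the index \<open>s + 1 - i\<close>.\<close>

fun corner_column ::
  "(node set \<Rightarrow> real) \<Rightarrow> (node \<Rightarrow> real) \<Rightarrow> nat \<Rightarrow> int \<Rightarrow> nat \<Rightarrow> int \<Rightarrow> real" where
  "corner_column \<gamma> q n s 0 j = 0"
| "corner_column \<gamma> q n s (Suc 0) j = (if j = 0 then 1 else 0)"
| "corner_column \<gamma> q n s (Suc (Suc c)) j =
     (if 1 \<le> j \<and> j \<le> int n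
      then let i = s - int c; x = corner_column \<gamma> q n s (Suc c) j in
        x + (q (i, j) * x
             - \<gamma> {(i, j), (i + 1, j)} * (corner_column \<gamma> q n s c j - x)
             - \<gamma> {(i, j), (i, j + 1)} * (corner_column \<gamma> q n s (Suc c) (j + 1) - x)
             - \<gamma> {(i, j), (i, j - 1)} * (corner_column \<gamma> q n s (Suc c) (j - 1) - x))
            / \<gamma> {(i, j), (i - 1, j)}
      else 0)"

text \<open>Truncation by \<open>nat\<close> gives all columns with \<open>i > s\<close> the index
  0, the zero column.\<close>

definition corner_solution ::
  "(node set \<Rightarrow> real) \<Rightarrow> (node \<Rightarrow> real) \<Rightarrow> nat \<Rightarrow> int \<Rightarrow> node \<Rightarrow> real" where
  "corner_solution \<gamma> q n s = (\<lambda>(i, j). corner_column \<gamma> q n s (nat (s + 1 - i)) j)"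

text \<open>With \<open>c = s + 1 - i\<close> the condition says \<open>i + j > s\<close>. A column
  depends on the one to its right only through the rows \<open>j - 1\<close>, \<open>j\<close>,
  \<open>j + 1\<close>, so the support grows by at most one row per column.\<close>

lemma corner_column_eq_0: "int c \<le> j \<Longrightarrow> corner_column \<gamma> q n s c j = 0"
  by (induction \<gamma> q n s c j rule: corner_column.induct) (simp_all add: Let_def)

lemma corner_solution_eq_0: "s < i + j \<Longrightarrow> corner_solution \<gamma> q n s (i, j) = 0"
  unfolding corner_solution_def split by (cases "i \<le> s + 1") (auto intro!: corner_column_eq_0)

lemma lap_corner_solution:
  assumes "(i, j) \<in> lattice_interior n" "\<gamma> {(i, j), (i - 1, j)} \<noteq> 0"
  shows "lap \<gamma> (corner_solution \<gamma> q n s) (i, j) = q (i, j) * corner_solution \<gamma> q n s (i, j)"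
proof (cases "i \<le> s")
  case True
  define c where "c = nat (s - i)"
  have i: "i = s - int c" using True by (simp add: c_def)
  have cols: "nat (s + 1 - (i - 1)) = Suc (Suc c)" "nat (s + 1 - i) = Suc c" "nat (s + 1 - (i + 1)) = c"
    using True by (auto simp: c_def)
  have j: "1 \<le> j" "j \<le> int n" using assms by (auto simp: interior_iff)
  show ?thesis
    unfolding lap.simps corner_solution_def split cols corner_column.simps(3) Let_def
    using assms(2) j by (simp add: i[symmetric] field_simps)
next
  case False
  \<comment> \<open>Since \<open>j \<ge> 1\<close>, even the left neighbour satisfies
    \<open>i - 1 + j > s\<close>.\<close>
  then have "s < i + j" "s < i + 1 + j" "s < i - 1 + j" "s < i + (j + 1)" "s < i + (j - 1)"
    using assms(1) by (auto simp: interior_iff)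
  then show ?thesis by (simp add: lap.simps corner_solution_eq_0)
qed

lemma elliptic_sequence_bounded:
  fixes \<gamma> :: "nat \<Rightarrow> node set \<Rightarrow> real"
  assumes "\<forall>k. uniformly_elliptic n a A (\<gamma> k)" "e \<in> lattice_edges n"
  shows "(\<lambda>k. \<gamma> k e) \<in> O(\<lambda>_. 1)" "(\<lambda>k. inverse (\<gamma> k e)) \<in> O(\<lambda>_. 1)" "\<gamma> k e \<noteq> 0"
proof -
  note a = uniformly_ellipticD(1)[OF spec[OF assms(1)]]
  have ge: "a \<le> \<gamma> k e" "\<gamma> k e \<le> A" for k
    using uniformly_ellipticD(3)[OF spec[OF assms(1)] assms(2)] by auto
  have "\<bar>\<gamma> k e\<bar> \<le> A" for k using ge[of k] a by simp
  then have "\<forall>k. \<bar>\<gamma> k e\<bar> \<le> A" ..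
  then show "(\<lambda>k. \<gamma> k e) \<in> O(\<lambda>_. 1)" by (rule bigo_one_if_abs_le)
  have "\<bar>inverse (\<gamma> k e)\<bar> \<le> inverse a" for k
    using ge[of k] a by (simp add: le_imp_inverse_le)
  then have "\<forall>k. \<bar>inverse (\<gamma> k e)\<bar> \<le> inverse a" ..
  then show "(\<lambda>k. inverse (\<gamma> k e)) \<in> O(\<lambda>_. 1)" by (rule bigo_one_if_abs_le)
  show "\<gamma> k e \<noteq> 0" using ge[of k] a by simp
qed

text \<open>The bounds on \<open>s\<close> and \<open>c\<close> keep the column where the equation
  is used between 1 and \<open>n\<close>. The recursion thus reads \<open>q\<close>, and divides by
  conductivities, at interior nodes only, where both are controlled.\<close>

lemma corner_column_bounded:
  fixes \<gamma> :: "nat \<Rightarrow> node set \<Rightarrow> real"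
  assumes ell: "\<forall>k. uniformly_elliptic n a A (\<gamma> k)"
    and q: "\<And>p. p \<in> lattice_interior n \<Longrightarrow> (\<lambda>k. q k p) \<in> O(\<lambda>_. 1)"
    and s: "s \<le> int n" and c: "int c \<le> s + 1"
  shows "(\<lambda>k. corner_column (\<gamma> k) (q k) n s c j) \<in> O(\<lambda>_. 1)"
  using c
proof (induction c arbitrary: j rule: less_induct)
  case (less c)
  consider "c = 0" | "c = Suc 0" | b where "c = Suc (Suc b)" by (metis not0_implies_Suc)
  then show ?case
  proof cases
    case 3
    show ?thesis
    proof (cases "1 \<le> j \<and> j \<le> int n")
      case True
      define i where "i = s - int b"
      have int: "(i, j) \<in> lattice_interior n"
        using less.prems s True 3 by (auto simp: interior_iff i_def)
      have b: "(\<lambda>k. corner_column (\<gamma> k) (q k) n s b j') \<in> O(\<lambda>_. 1)"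
        "(\<lambda>k. corner_column (\<gamma> k) (q k) n s (Suc b) j') \<in> O(\<lambda>_. 1)" for j'
        using less.IH[of b] less.IH[of "Suc b"] less.prems unfolding 3 by auto
      note e = elliptic_sequence_bounded[OF ell interior_edges(1)[OF int]]
        elliptic_sequence_bounded[OF ell interior_edges(2)[OF int]]
        elliptic_sequence_bounded[OF ell interior_edges(3)[OF int]]
        elliptic_sequence_bounded[OF ell interior_edges(4)[OF int]]
      show ?thesis
        unfolding 3 corner_column.simps(3) Let_def i_def[symmetric] if_P[OF True] divide_inverse
        by (intro sum_in_bigo bounded_mult e b q int)
    next
      case False
      show ?thesis unfolding 3 corner_column.simps(3) if_not_P[OF False] by simp
    qed
  qed simp_all
qed

text \<open>At a node with \<open>i + j = s + 1\<close> the solution vanishes at the node, to its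
  right and above it, so the equation there links only the left and the lower neighbour, both on the
  diagonal \<open>s\<close>. The diagonal values start with 1 at \<open>(s, 0)\<close> and are
  multiplied by minus the ratio of the lower to the left conductivity, which is bounded away from
  0.\<close>

lemma corner_column_diagonal:
  fixes \<gamma> :: "nat \<Rightarrow> node set \<Rightarrow> real"
  assumes ell: "\<forall>k. uniformly_elliptic n a A (\<gamma> k)" and s: "s \<le> int n" and c: "int c \<le> s"
  shows "(\<lambda>k. inverse (corner_column (\<gamma> k) (q k) n s (Suc c) (int c))) \<in> O(\<lambda>_. 1) \<and>
         (\<forall>k. corner_column (\<gamma> k) (q k) n s (Suc c) (int c) \<noteq> 0)"
  using c
proof (induction c)
  case (Suc c)
  define i where "i = s - int c"
  have int: "(i, int c + 1) \<in> lattice_interior n"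
    using Suc.prems s by (auto simp: interior_iff i_def)
  note left = elliptic_sequence_bounded[OF ell interior_edges(2)[OF int]]
  note down = elliptic_sequence_bounded[OF ell interior_edges(4)[OF int]]
  have eq: "corner_column (\<gamma> k) (q k) n s (Suc (Suc c)) (int (Suc c)) =
      - \<gamma> k {(i, int c + 1), (i, int c + 1 - 1)} * corner_column (\<gamma> k) (q k) n s (Suc c) (int c)
        * inverse (\<gamma> k {(i, int c + 1), (i - 1, int c + 1)})" for k
    using Suc.prems s
    by (simp add: corner_column_eq_0 i_def[symmetric] divide_inverse algebra_simps)
  have IH: "(\<lambda>k. inverse (corner_column (\<gamma> k) (q k) n s (Suc c) (int c))) \<in> O(\<lambda>_. 1)"
    "corner_column (\<gamma> k) (q k) n s (Suc c) (int c) \<noteq> 0" for k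
    using Suc by auto
  show ?case
    unfolding eq
    using IH(2) left(3) down(3) bounded_mult[OF bounded_mult[OF left(1) IH(1)] down(2)]
    by (simp add: inverse_mult_distrib mult_ac)
qed simp

section \<open>Layer stripping\<close>

text \<open>The equation at \<open>(i, j)\<close> is solved for the right neighbour; ellipticity
  permits the division.\<close>

lemma small_right:
  fixes g :: "nat \<Rightarrow> node set \<Rightarrow> real" and d :: "nat \<Rightarrow> node \<Rightarrow> real" and c \<delta> :: "nat \<Rightarrow> real"
  assumes ell: "\<forall>k. uniformly_elliptic n a A (g k)" and int: "(i, j) \<in> lattice_interior n"
    and c: "c \<in> O(\<lambda>_. 1)" and res: "(\<lambda>k. lap (g k) (d k) (i, j) - c k * d k (i, j)) \<in> o(\<delta>)"
    and d: "(\<lambda>k. d k (i, j)) \<in> o(\<delta>)" "(\<lambda>k. d k (i - 1, j)) \<in> o(\<delta>)"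
      "(\<lambda>k. d k (i, j + 1)) \<in> o(\<delta>)" "(\<lambda>k. d k (i, j - 1)) \<in> o(\<delta>)"
  shows "(\<lambda>k. d k (i + 1, j)) \<in> o(\<delta>)"
proof -
  note e1 = elliptic_sequence_bounded[OF ell interior_edges(1)[OF int]]
  note e2 = elliptic_sequence_bounded[OF ell interior_edges(2)[OF int]]
  note e3 = elliptic_sequence_bounded[OF ell interior_edges(3)[OF int]]
  note e4 = elliptic_sequence_bounded[OF ell interior_edges(4)[OF int]]
  have eq: "d k (i + 1, j) = d k (i, j) + inverse (g k {(i, j), (i + 1, j)}) *
     ((lap (g k) (d k) (i, j) - c k * d k (i, j)) + c k * d k (i, j)
       - g k {(i, j), (i - 1, j)} * (d k (i - 1, j) - d k (i, j))
       - g k {(i, j), (i, j + 1)} * (d k (i, j + 1) - d k (i, j))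
       - g k {(i, j), (i, j - 1)} * (d k (i, j - 1) - d k (i, j)))" for k
    using e1(3)[of k] by (simp add: lap.simps field_simps)
  show ?thesis
    by (subst eq, intro sum_in_smallo smallo_mult_bounded(2) c res d e1 e2 e3 e4)
qed

lemma small_left:
  fixes g :: "nat \<Rightarrow> node set \<Rightarrow> real" and d :: "nat \<Rightarrow> node \<Rightarrow> real" and c \<delta> :: "nat \<Rightarrow> real"
  assumes ell: "\<forall>k. uniformly_elliptic n a A (g k)" and int: "(i, j) \<in> lattice_interior n"
    and c: "c \<in> O(\<lambda>_. 1)" and res: "(\<lambda>k. lap (g k) (d k) (i, j) - c k * d k (i, j)) \<in> o(\<delta>)"
    and d: "(\<lambda>k. d k (i, j)) \<in> o(\<delta>)" "(\<lambda>k. d k (i + 1, j)) \<in> o(\<delta>)"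
      "(\<lambda>k. d k (i, j + 1)) \<in> o(\<delta>)" "(\<lambda>k. d k (i, j - 1)) \<in> o(\<delta>)"
  shows "(\<lambda>k. d k (i - 1, j)) \<in> o(\<delta>)"
proof -
  note e1 = elliptic_sequence_bounded[OF ell interior_edges(1)[OF int]]
  note e2 = elliptic_sequence_bounded[OF ell interior_edges(2)[OF int]]
  note e3 = elliptic_sequence_bounded[OF ell interior_edges(3)[OF int]]
  note e4 = elliptic_sequence_bounded[OF ell interior_edges(4)[OF int]]
  have eq: "d k (i - 1, j) = d k (i, j) + inverse (g k {(i, j), (i - 1, j)}) *
     ((lap (g k) (d k) (i, j) - c k * d k (i, j)) + c k * d k (i, j)
       - g k {(i, j), (i + 1, j)} * (d k (i + 1, j) - d k (i, j))
       - g k {(i, j), (i, j + 1)} * (d k (i, j + 1) - d k (i, j))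
       - g k {(i, j), (i, j - 1)} * (d k (i, j - 1) - d k (i, j)))" for k
    using e2(3)[of k] by (simp add: lap.simps field_simps)
  show ?thesis
    by (subst eq, intro sum_in_smallo smallo_mult_bounded(2) c res d e1 e2 e3 e4)
qed

text \<open>Discrete Cauchy continuation by columns: the equation at \<open>(i - 1, j)\<close> gives
  the value at \<open>(i, j)\<close>, and its other nodes lie in earlier columns and still in the
  triangle \<open>i + j \<le> s\<close>. The first interior column has to be supplied, later from
  the flux through the boundary.\<close>

lemma continuation_from_left:
  fixes g :: "nat \<Rightarrow> node set \<Rightarrow> real" and d :: "nat \<Rightarrow> node \<Rightarrow> real" and \<delta> :: "nat \<Rightarrow> real"
  assumes ell: "\<forall>k. uniformly_elliptic n a A (g k)" and s: "s \<le> int n + 1"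
    and boundary: "\<And>k p. p \<in> lattice_boundary n \<Longrightarrow> d k p = 0"
    and first: "\<And>j. 1 \<le> j \<Longrightarrow> 1 + j \<le> s \<Longrightarrow> (\<lambda>k. d k (1, j)) \<in> o(\<delta>)"
    and res: "\<And>i j. (i, j) \<in> lattice_interior n \<Longrightarrow> i + j + 1 \<le> s \<Longrightarrow>
      \<exists>c. c \<in> O(\<lambda>_. 1) \<and> (\<lambda>k. lap (g k) (d k) (i, j) - c k * d k (i, j)) \<in> o(\<delta>)"
    and node: "(i, j) \<in> lattice_nodes n" "i + j \<le> s"
  shows "(\<lambda>k. d k (i, j)) \<in> o(\<delta>)"
proof -
  have "\<forall>i j. i \<le> int m \<longrightarrow> (i, j) \<in> lattice_nodes n \<longrightarrow> i + j \<le> s \<longrightarrow> (\<lambda>k. d k (i, j)) \<in> o(\<delta>)" for m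
  proof (induction m)
    case 0
    have "(i, j) \<in> lattice_boundary n" if "i \<le> 0" "(i, j) \<in> lattice_nodes n" for i j
      using that by (auto simp: nodes_iff interior_iff)
    then show ?case by (auto simp: boundary)
  next
    case (Suc m)
    show ?case
    proof (intro allI impI)
      fix i j assume i: "i \<le> int (Suc m)" and ij: "(i, j) \<in> lattice_nodes n" "i + j \<le> s"
      consider "i \<le> int m" | "(i, j) \<in> lattice_boundary n"
        | "i = int m + 1" "(i, j) \<in> lattice_interior n"
      proof -
        have "i \<le> int m \<or> i = int m + 1" using i by linarith
        then show thesis using that ij(1) nodes_iff by blast
      qed
      then show "(\<lambda>k. d k (i, j)) \<in> o(\<delta>)"
      proof cases
        case 3
        show ?thesis
        proof (cases m)
          case 0
          then show ?thesis using first[of j] 3 ij by (simp add: interior_iff)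
        next
          case (Suc l)
          have int: "(i - 1, j) \<in> lattice_interior n"
            using 3 Suc by (auto simp: interior_iff)
          obtain c where c: "c \<in> O(\<lambda>_. 1)"
            "(\<lambda>k. lap (g k) (d k) (i - 1, j) - c k * d k (i - 1, j)) \<in> o(\<delta>)"
            using res[OF int] ij by auto
          have "(\<lambda>k. d k (i', j')) \<in> o(\<delta>)"
            if "i' < i" "(i', j') \<in> lattice_nodes n" "i' + j' \<le> s" for i' j'
            using Suc.IH that 3 by auto
          then have "(\<lambda>k. d k (i - 1 + 1, j)) \<in> o(\<delta>)"
            using interior_neighbour_nodes[OF int] ij
            by (intro small_right[OF ell int c]) auto
          then show ?thesis by simp
        qed
      qed (use Suc.IH ij boundary in auto)
    qed
  qed
  from this[of "nat i"] show ?thesis using node by simp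
qed

text \<open>The mirror image on \<open>i + j \<ge> s\<close>: the equation at
  \<open>(i + 1, j)\<close> gives the value at \<open>(i, j)\<close>.\<close>

lemma continuation_from_right:
  fixes g :: "nat \<Rightarrow> node set \<Rightarrow> real" and d :: "nat \<Rightarrow> node \<Rightarrow> real" and \<delta> :: "nat \<Rightarrow> real"
  assumes ell: "\<forall>k. uniformly_elliptic n a A (g k)"
    and boundary: "\<And>k p. p \<in> lattice_boundary n \<Longrightarrow> d k p = 0"
    and last: "\<And>j. 1 \<le> j \<Longrightarrow> j \<le> int n \<Longrightarrow> s \<le> int n + j \<Longrightarrow> (\<lambda>k. d k (int n, j)) \<in> o(\<delta>)"
    and res: "\<And>i j. (i, j) \<in> lattice_interior n \<Longrightarrow> s \<le> i + j - 1 \<Longrightarrow>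
      \<exists>c. c \<in> O(\<lambda>_. 1) \<and> (\<lambda>k. lap (g k) (d k) (i, j) - c k * d k (i, j)) \<in> o(\<delta>)"
    and node: "(i, j) \<in> lattice_nodes n" "s \<le> i + j"
  shows "(\<lambda>k. d k (i, j)) \<in> o(\<delta>)"
proof -
  have "\<forall>i j. int n + 1 - int m \<le> i \<longrightarrow> (i, j) \<in> lattice_nodes n \<longrightarrow> s \<le> i + j \<longrightarrow> (\<lambda>k. d k (i, j)) \<in> o(\<delta>)" for m
  proof (induction m)
    case 0
    have "(i, j) \<in> lattice_boundary n" if "int n + 1 - int 0 \<le> i" "(i, j) \<in> lattice_nodes n" for i j
      using that by (auto simp: nodes_iff interior_iff)
    then show ?case by (auto simp: boundary)
  next
    case (Suc m)
    show ?case
    proof (intro allI impI)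
      fix i j assume i: "int n + 1 - int (Suc m) \<le> i" and ij: "(i, j) \<in> lattice_nodes n" "s \<le> i + j"
      consider "int n + 1 - int m \<le> i" | "(i, j) \<in> lattice_boundary n"
        | "i = int n - int m" "(i, j) \<in> lattice_interior n"
      proof -
        have "int n + 1 - int m \<le> i \<or> i = int n - int m" using i by linarith
        then show thesis using that ij(1) nodes_iff by blast
      qed
      then show "(\<lambda>k. d k (i, j)) \<in> o(\<delta>)"
      proof cases
        case 3
        show ?thesis
        proof (cases m)
          case 0
          then show ?thesis using last[of j] 3 ij by (simp add: interior_iff)
        next
          case (Suc l)
          have int: "(i + 1, j) \<in> lattice_interior n"
            using 3 Suc by (auto simp: interior_iff)
          obtain c where c: "c \<in> O(\<lambda>_. 1)"
            "(\<lambda>k. lap (g k) (d k) (i + 1, j) - c k * d k (i + 1, j)) \<in> o(\<delta>)"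
            using res[OF int] ij by auto
          have "(\<lambda>k. d k (i', j')) \<in> o(\<delta>)"
            if "i < i'" "(i', j') \<in> lattice_nodes n" "s \<le> i' + j'" for i' j'
            using Suc.IH that 3 by auto
          then have "(\<lambda>k. d k (i + 1 - 1, j)) \<in> o(\<delta>)"
            using interior_neighbour_nodes[OF int] ij
            by (intro small_left[OF ell int c]) auto
          then show ?thesis by simp
        qed
      qed (use Suc.IH ij boundary in auto)
    qed
  qed
  from this[of "nat (int n + 1 - i)"] show ?thesis using node by simp
qed

text \<open>Equality of Dirichlet and Neumann data, the latter edge by edge because a boundary node
  has one neighbour. Phrased for functions instead of the nonlinear map, it passes to difference
  quotients and their linear combinations.\<close>

definition same_cauchy ::
  "nat \<Rightarrow> (node set \<Rightarrow> real) \<Rightarrow> (node set \<Rightarrow> real) \<Rightarrow> (node \<Rightarrow> real) \<Rightarrow> (node \<Rightarrow> real) \<Rightarrow> bool" where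
  "same_cauchy n \<gamma> \<gamma>' w w' \<longleftrightarrow>
     (\<forall>p\<in>lattice_boundary n. w p = w' p \<and>
        (\<forall>x\<in>lattice_interior n. {p, x} \<in> lattice_edges n \<longrightarrow>
           \<gamma> {p, x} * (w p - w x) = \<gamma>' {p, x} * (w' p - w' x)))"

text \<open>A known boundary edge determines the solution next to the boundary; conversely,
  agreement of the solutions there determines the edge, provided that \<open>w\<close> jumps across
  it.\<close>

lemma flux_difference:
  assumes "same_cauchy n \<gamma> \<gamma>' w w'"
    and "p \<in> lattice_boundary n" "x \<in> lattice_interior n" "{p, x} \<in> lattice_edges n"
  shows "(\<gamma> {p, x} - \<gamma>' {p, x}) * (w p - w x) = \<gamma>' {p, x} * (w x - w' x)"
proof -
  have "w p = w' p" "\<gamma> {p, x} * (w p - w x) = \<gamma>' {p, x} * (w' p - w' x)"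
    using assms by (auto simp: same_cauchy_def)
  then show ?thesis by (simp add: algebra_simps)
qed

text \<open>The data of two sequences of conductivities, abstracted from the nonlinear problem. The rate
  \<open>\<delta>\<close> is the size of \<open>\<gamma> - \<gamma>'\<close>, and the last assumption says that each solution \<open>W\<close> of the linearized
  equation is approximated by difference quotients \<open>w\<close> whose counterparts \<open>w'\<close> for \<open>\<gamma>'\<close> have the same
  Cauchy data and satisfy the same linearized equation up to \<open>o(\<delta>)\<close>.\<close>

locale conductivity_pair =
  fixes n :: nat and a A :: real and \<gamma> \<gamma>' :: "nat \<Rightarrow> node set \<Rightarrow> real"
    and u u' q q' :: "nat \<Rightarrow> node \<Rightarrow> real" and \<delta> :: "nat \<Rightarrow> real"
  assumes ell: "\<forall>k. uniformly_elliptic n a A (\<gamma> k)" and ell': "\<forall>k. uniformly_elliptic n a A (\<gamma>' k)"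
    and contrast: "e \<in> lattice_edges n \<Longrightarrow> (\<lambda>k. \<gamma> k e - \<gamma>' k e) \<in> O(\<delta>)"
    and u_bounded: "p \<in> lattice_nodes n \<Longrightarrow> (\<lambda>k. u k p) \<in> O(\<lambda>_. 1)"
    and q_bounded: "p \<in> lattice_interior n \<Longrightarrow> (\<lambda>k. q k p) \<in> O(\<lambda>_. 1)"
    and q'_bounded: "p \<in> lattice_interior n \<Longrightarrow> (\<lambda>k. q' k p) \<in> O(\<lambda>_. 1)"
    and u_diff: "p \<in> lattice_interior n \<Longrightarrow> (\<lambda>k. u k p - u' k p) \<in> O(\<delta>)"
    and q_diff: "p \<in> lattice_interior n \<Longrightarrow> (\<lambda>k. q k p - q' k p) \<in> O(\<lambda>k. u k p - u' k p)"
    and nonlinear: "p \<in> lattice_interior n \<Longrightarrow> \<exists>c. c \<in> O(\<lambda>_. 1) \<and>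
      (\<forall>k. lap (\<gamma> k) (u k) p - lap (\<gamma>' k) (u' k) p = c k * (u k p - u' k p))"
    and cauchy: "same_cauchy n (\<gamma> k) (\<gamma>' k) (u k) (u' k)"
    and linearization: "\<lbrakk>\<forall>p\<in>lattice_nodes n. (\<lambda>k. W k p) \<in> O(\<lambda>_. 1);
        \<forall>k. \<forall>p\<in>lattice_interior n. lap (\<gamma> k) (W k) p = q k p * W k p\<rbrakk> \<Longrightarrow>
      \<exists>w w'. (\<forall>k. same_cauchy n (\<gamma> k) (\<gamma>' k) (w k) (w' k)) \<and>
        (\<forall>p\<in>lattice_nodes n. (\<lambda>k. w k p - W k p) \<in> o(\<lambda>_. 1)) \<and>
        (\<forall>p\<in>lattice_interior n. (\<lambda>k. (lap (\<gamma> k) (w k) p - q k p * w k p) -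
            (lap (\<gamma>' k) (w' k) p - q' k p * w' k p)) \<in> o(\<delta>))"
begin

abbreviation "h k e \<equiv> \<gamma> k e - \<gamma>' k e"

text \<open>The statement of the induction over diagonals. Every edge joins consecutive diagonals,
  so the step from \<open>s\<close> to \<open>s + 1\<close> adds exactly the edges between these
  two.\<close>

definition known :: "int \<Rightarrow> bool" where
  "known s \<longleftrightarrow> (\<forall>i j i' j'. {(i, j), (i', j')} \<in> lattice_edges n \<longrightarrow> i + j \<le> s \<longrightarrow> i' + j' \<le> s \<longrightarrow>
     (\<lambda>k. h k {(i, j), (i', j')}) \<in> o(\<delta>))"

lemma knownD:
  "known s \<Longrightarrow> {(i, j), (i', j')} \<in> lattice_edges n \<Longrightarrow> i + j \<le> s \<Longrightarrow> i' + j' \<le> s \<Longrightarrow>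
     (\<lambda>k. h k {(i, j), (i', j')}) \<in> o(\<delta>)"
  by (simp add: known_def)

text \<open>Here all four edges at the node are known and \<open>w\<close> is merely bounded; in the
  next lemma the edges are merely \<open>O(\<delta>)\<close> and \<open>w\<close> tends to
  0.\<close>

lemma lap_known_small:
  assumes "known s" "(i, j) \<in> lattice_interior n" "i + j + 1 \<le> s"
    and w: "\<And>p. p \<in> lattice_nodes n \<Longrightarrow> (\<lambda>k. w k p) \<in> O(\<lambda>_. 1)"
  shows "(\<lambda>k. lap (h k) (w k) (i, j)) \<in> o(\<delta>)"
  unfolding lap.simps using assms(3)
  by (intro sum_in_smallo smallo_mult_bounded(1) sum_in_bigo w knownD[OF assms(1)]
      interior_edges[OF assms(2)] interior_neighbour_nodes[OF assms(2)]) auto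

lemma lap_vanishing_small:
  assumes "(i, j) \<in> lattice_interior n"
    and "(\<lambda>k. w k (i, j)) \<in> o(\<lambda>_. 1)" "(\<lambda>k. w k (i + 1, j)) \<in> o(\<lambda>_. 1)" "(\<lambda>k. w k (i - 1, j)) \<in> o(\<lambda>_. 1)"
      "(\<lambda>k. w k (i, j + 1)) \<in> o(\<lambda>_. 1)" "(\<lambda>k. w k (i, j - 1)) \<in> o(\<lambda>_. 1)"
  shows "(\<lambda>k. lap (h k) (w k) (i, j)) \<in> o(\<delta>)"
  unfolding lap.simps
  by (intro sum_in_smallo bigo_mult_vanishing contrast assms interior_edges[OF assms(1)])

lemma flux_small:
  assumes cauchy: "\<And>k. same_cauchy n (\<gamma> k) (\<gamma>' k) (w k) (w' k)"
    and p: "p \<in> lattice_boundary n" "x \<in> lattice_interior n" "{p, x} \<in> lattice_edges n"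
    and small: "(\<lambda>k. h k {p, x} * (w k p - w k x)) \<in> o(\<delta>)"
  shows "(\<lambda>k. w k x - w' k x) \<in> o(\<delta>)"
proof -
  note e = elliptic_sequence_bounded[OF ell' p(3)]
  have "(\<lambda>k. (w k x - w' k x) * \<gamma>' k {p, x}) \<in> o(\<delta>)"
    using small unfolding flux_difference[OF cauchy p] by (simp only: mult.commute)
  then show ?thesis by (rule smallo_cancel_bounded_inverse[OF _ e(2,3)])
qed

text \<open>Turns a pair of equations into one for \<open>w - w'\<close> with the single operator
  \<open>lap (\<gamma>' k)\<close> and the source \<open>lap (h k) w\<close>.\<close>

lemma lap_pair_difference:
  "lap (\<gamma> k) w p - lap (\<gamma>' k) w' p = lap (h k) w p + lap (\<gamma>' k) (\<lambda>p. w p - w' p) p"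
  by (simp add: lap_conductivity_diff lap_diff)

lemma cauchy_boundary:
  "same_cauchy n g g' w w' \<Longrightarrow> p \<in> lattice_boundary n \<Longrightarrow> w p - w' p = 0"
  by (simp add: same_cauchy_def)

text \<open>In the equation for \<open>u - u'\<close> the nonlinearity contributes a bounded
  coefficient and the known edges a source of size \<open>o(\<delta>)\<close>. By
  \<open>q_diff\<close> the potentials then agree to the same order, which the linearized equation
  alone would not give.\<close>

lemma u_diff_small:
  assumes known: "known s" and s: "s \<le> int n + 1" and ij: "(i, j) \<in> lattice_nodes n" "i + j \<le> s"
  shows "(\<lambda>k. u k (i, j) - u' k (i, j)) \<in> o(\<delta>)"
proof (rule continuation_from_left[where d = "\<lambda>k p. u k p - u' k p", OF ell' s _ _ _ ij])
  fix j :: int assume j: "1 \<le> j" "1 + j \<le> s"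
  have p: "(0, j) \<in> lattice_boundary n" "(1, j) \<in> lattice_interior n" "{(0, j), (1, j)} \<in> lattice_edges n"
    using j s by (auto simp: boundary_iff interior_iff edges_iff nodes_iff)
  show "(\<lambda>k. u k (1, j) - u' k (1, j)) \<in> o(\<delta>)"
    using p j
    by (intro flux_small[OF cauchy p] smallo_mult_bounded(1) knownD[OF known] sum_in_bigo u_bounded)
      (auto simp: nodes_iff)
next
  fix i j assume int: "(i, j) \<in> lattice_interior n" and le: "i + j + 1 \<le> s"
  obtain c where c: "c \<in> O(\<lambda>_. 1)"
    "\<And>k. lap (\<gamma> k) (u k) (i, j) - lap (\<gamma>' k) (u' k) (i, j) = c k * (u k (i, j) - u' k (i, j))"
    using nonlinear[OF int] by blast
  have "lap (\<gamma>' k) (\<lambda>p. u k p - u' k p) (i, j) - c k * (u k (i, j) - u' k (i, j)) = - lap (h k) (u k) (i, j)" for k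
    unfolding c(2)[symmetric] lap_pair_difference by simp
  moreover have "(\<lambda>k. - lap (h k) (u k) (i, j)) \<in> o(\<delta>)"
    using lap_known_small[OF known int le, of u] u_bounded by simp
  ultimately show "\<exists>c. c \<in> O(\<lambda>_. 1) \<and>
      (\<lambda>k. lap (\<gamma>' k) (\<lambda>p. u k p - u' k p) (i, j) - c k * (u k (i, j) - u' k (i, j))) \<in> o(\<delta>)"
    using c(1) by auto
qed (rule cauchy_boundary[OF cauchy])

lemma corner_solution_bounded:
  assumes "s \<le> int n" "p \<in> lattice_nodes n"
  shows "(\<lambda>k. corner_solution (\<gamma> k) (q k) n s p) \<in> O(\<lambda>_. 1)"
proof -
  obtain i j where p: "p = (i, j)" by force
  show ?thesis
  proof (cases "s < i + j")
    case False
    have "0 \<le> i" "0 \<le> j" using assms(2) unfolding p by (auto simp: nodes_iff interior_iff boundary_iff)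
    then have "int (nat (s + 1 - i)) \<le> s + 1" using False by simp
    then show ?thesis
      unfolding p corner_solution_def split by (intro corner_column_bounded[OF ell q_bounded assms(1)])
  qed (simp add: p corner_solution_eq_0)
qed

lemma corner_solution_diagonal:
  assumes "s \<le> int n" "i + j = s" "0 \<le> i" "0 \<le> j"
  shows "(\<lambda>k. inverse (corner_solution (\<gamma> k) (q k) n s (i, j))) \<in> O(\<lambda>_. 1)"
    "corner_solution (\<gamma> k) (q k) n s (i, j) \<noteq> 0"
proof -
  have "nat (s + 1 - i) = Suc (nat j)" "int (nat j) = j" "int (nat j) \<le> s" using assms by auto
  then show "(\<lambda>k. inverse (corner_solution (\<gamma> k) (q k) n s (i, j))) \<in> O(\<lambda>_. 1)"
    "corner_solution (\<gamma> k) (q k) n s (i, j) \<noteq> 0"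
    using corner_column_diagonal[OF ell assms(1), of "nat j" q] unfolding corner_solution_def split
    by simp_all
qed

text \<open>The function \<open>w\<close> approximates the corner solution. For
  \<open>i + j \<le> s\<close> the edges and the potential are known, so \<open>w - w'\<close> is
  continued from the left; for \<open>i + j > s\<close> they are unknown but multiplied by the
  vanishing \<open>w\<close>, so it is continued from the right. Hence \<open>w - w'\<close> is
  small everywhere, and the equation yields \<open>lap (h k) (w k)\<close>, a linear relation among
  the unknown edges.\<close>

lemma corner_pair:
  assumes s: "1 \<le> s" "s \<le> int n" and known: "known s"
  obtains w w' where
    "\<forall>k. same_cauchy n (\<gamma> k) (\<gamma>' k) (w k) (w' k)"
    "\<And>i j. (i, j) \<in> lattice_nodes n \<Longrightarrow> (\<lambda>k. w k (i, j) - w' k (i, j)) \<in> o(\<delta>)"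
    "\<And>i j. (i, j) \<in> lattice_nodes n \<Longrightarrow> (\<lambda>k. w k (i, j)) \<in> O(\<lambda>_. 1)"
    "\<And>i j. (i, j) \<in> lattice_nodes n \<Longrightarrow> s < i + j \<Longrightarrow> (\<lambda>k. w k (i, j)) \<in> o(\<lambda>_. 1)"
    "\<And>p f. p \<in> lattice_nodes n \<Longrightarrow> f \<in> O(\<delta>) \<Longrightarrow> (\<lambda>k. f k * w k p) \<in> o(\<delta>) \<Longrightarrow>
       (\<lambda>k. f k * corner_solution (\<gamma> k) (q k) n s p) \<in> o(\<delta>)"
    "\<And>i j. (i, j) \<in> lattice_interior n \<Longrightarrow> i + j \<le> s + 1 \<Longrightarrow> (\<lambda>k. lap (h k) (w k) (i, j)) \<in> o(\<delta>)"
proof -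
  define W where "W k = corner_solution (\<gamma> k) (q k) n s" for k
  have W_bounded: "(\<lambda>k. W k p) \<in> O(\<lambda>_. 1)" if "p \<in> lattice_nodes n" for p
    unfolding W_def by (rule corner_solution_bounded[OF s(2) that])
  have W_eq: "lap (\<gamma> k) (W k) p = q k p * W k p" if "p \<in> lattice_interior n" for k p
  proof -
    obtain i j where p: "p = (i, j)" by force
    have int: "(i, j) \<in> lattice_interior n" using that p by simp
    show ?thesis unfolding W_def p
      using elliptic_sequence_bounded(3)[OF ell interior_edges(2)[OF int]] by (intro lap_corner_solution int)
  qed
  have b1: "\<forall>p\<in>lattice_nodes n. (\<lambda>k. W k p) \<in> O(\<lambda>_. 1)" using W_bounded by blast
  have b2: "\<forall>k. \<forall>p\<in>lattice_interior n. lap (\<gamma> k) (W k) p = q k p * W k p" using W_eq by blast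
  obtain w w' where L: "(\<forall>k. same_cauchy n (\<gamma> k) (\<gamma>' k) (w k) (w' k)) \<and>
      (\<forall>p\<in>lattice_nodes n. (\<lambda>k. w k p - W k p) \<in> o(\<lambda>_. 1)) \<and>
      (\<forall>p\<in>lattice_interior n. (\<lambda>k. (lap (\<gamma> k) (w k) p - q k p * w k p) -
          (lap (\<gamma>' k) (w' k) p - q' k p * w' k p)) \<in> o(\<delta>))"
    using linearization[OF b1 b2] by (elim exE) (rule that)
  note cauchy_w = conjunct1[OF L] and wW = bspec[OF conjunct1[OF conjunct2[OF L]]]
    and res = bspec[OF conjunct2[OF conjunct2[OF L]]]
  define d where "d k p = w k p - w' k p" for k p
  have w_bounded: "(\<lambda>k. w k p) \<in> O(\<lambda>_. 1)" if "p \<in> lattice_nodes n" for p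
    using sum_in_bigo(1)[OF landau_o.small_imp_big[OF wW[OF that]] W_bounded[OF that]] by simp
  have w_vanish: "(\<lambda>k. w k (i, j)) \<in> o(\<lambda>_. 1)" if "(i, j) \<in> lattice_nodes n" "s < i + j" for i j
    using wW[OF that(1)] that(2) by (simp add: W_def corner_solution_eq_0)
  \<comment> \<open>Only \<open>W\<close> is supported exactly and nonzero on the diagonal; for a
    factor \<open>O(\<delta>)\<close> the error \<open>w - W\<close> of size \<open>o(1)\<close> is
    harmless.\<close>
  have to_W: "(\<lambda>k. f k * W k p) \<in> o(\<delta>)"
    if "p \<in> lattice_nodes n" "f \<in> O(\<delta>)" "(\<lambda>k. f k * w k p) \<in> o(\<delta>)" for f p
  proof -
    have "(\<lambda>k. f k * w k p - f k * (w k p - W k p)) \<in> o(\<delta>)"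
      by (rule sum_in_smallo(2)[OF that(3) bigo_mult_vanishing[OF that(2) wW[OF that(1)]]])
    then show ?thesis by (simp add: algebra_simps)
  qed
  \<comment> \<open>The equation for \<open>d\<close> has three sources: the difference of the
    residuals, the contrast of the conductivities and the contrast of the potentials.\<close>
  have d_eq: "lap (\<gamma>' k) (d k) p - q' k p * d k p =
      ((lap (\<gamma> k) (w k) p - q k p * w k p) - (lap (\<gamma>' k) (w' k) p - q' k p * w' k p))
       - lap (h k) (w k) p + (q k p - q' k p) * w k p" for k p
    using lap_pair_difference[of k "w k" p "w' k"] unfolding d_def by (simp add: algebra_simps)
  have q_diff': "(\<lambda>k. q k p - q' k p) \<in> O(\<delta>)" if "p \<in> lattice_interior n" for p
    using landau_o.big.trans[OF q_diff[OF that] u_diff[OF that]] .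
  have d_boundary: "d k p = 0" if "p \<in> lattice_boundary n" for k p
    unfolding d_def using cauchy_boundary cauchy_w that by blast
  \<comment> \<open>The equations used are those with \<open>i + j \<ge> s + 2\<close>: there the
    node and its four neighbours all satisfy \<open>i + j > s\<close>, where \<open>w\<close>
    vanishes in the limit.\<close>
  have d_upper: "(\<lambda>k. d k (i, j)) \<in> o(\<delta>)" if "(i, j) \<in> lattice_nodes n" "s + 1 \<le> i + j" for i j
  proof (rule continuation_from_right[OF ell' d_boundary _ _ that])
    fix j :: int assume j: "1 \<le> j" "j \<le> int n" "s + 1 \<le> int n + j"
    have p: "(int n + 1, j) \<in> lattice_boundary n" "(int n, j) \<in> lattice_interior n"
      "{(int n + 1, j), (int n, j)} \<in> lattice_edges n"
      using j s by (auto simp: boundary_iff interior_iff edges_iff nodes_iff)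
    show "(\<lambda>k. d k (int n, j)) \<in> o(\<delta>)" unfolding d_def
      using p j s
      by (intro flux_small[OF _ p] bigo_mult_vanishing contrast sum_in_smallo w_vanish cauchy_w[rule_format])
        (auto simp: nodes_iff)
  next
    fix i j assume int: "(i, j) \<in> lattice_interior n" and le: "s + 1 \<le> i + j - 1"
    note nodes = interior_neighbour_nodes[OF int]
    have "(\<lambda>k. lap (\<gamma>' k) (d k) (i, j) - q' k (i, j) * d k (i, j)) \<in> o(\<delta>)"
    proof -
      have "(\<lambda>k. lap (h k) (w k) (i, j)) \<in> o(\<delta>)"
        using le by (intro lap_vanishing_small int w_vanish nodes) auto
      moreover have "(\<lambda>k. (q k (i, j) - q' k (i, j)) * w k (i, j)) \<in> o(\<delta>)"
        using le by (intro bigo_mult_vanishing q_diff' int w_vanish nodes) auto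
      ultimately show ?thesis
        unfolding d_eq by (intro sum_in_smallo(1)[OF sum_in_smallo(2)[OF res[OF int]]])
    qed
    then show "\<exists>c. c \<in> O(\<lambda>_. 1) \<and> (\<lambda>k. lap (\<gamma>' k) (d k) (i, j) - c k * d k (i, j)) \<in> o(\<delta>)"
      using q'_bounded[OF int] by blast
  qed
  have q_lower: "(\<lambda>k. q k (i, j) - q' k (i, j)) \<in> o(\<delta>)"
    if "(i, j) \<in> lattice_interior n" "i + j \<le> s" for i j
    using landau_o.big_small_trans[OF q_diff[OF that(1)] u_diff_small[OF known _ _ that(2)]] that s
    by (simp add: nodes_iff)
  \<comment> \<open>Below the diagonal \<open>w\<close> is not small; the sources are controlled by
    the known edges and by \<open>q_lower\<close>.\<close>
  have d_lower: "(\<lambda>k. d k (i, j)) \<in> o(\<delta>)" if "(i, j) \<in> lattice_nodes n" "i + j \<le> s" for i j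
  proof (rule continuation_from_left[OF ell' _ d_boundary _ _ that])
    fix j :: int assume j: "1 \<le> j" "1 + j \<le> s"
    have p: "(0, j) \<in> lattice_boundary n" "(1, j) \<in> lattice_interior n" "{(0, j), (1, j)} \<in> lattice_edges n"
      using j s by (auto simp: boundary_iff interior_iff edges_iff nodes_iff)
    have "(\<lambda>k. h k {(0, j), (1, j)}) \<in> o(\<delta>)"
      using j by (intro knownD[OF known p(3)]) auto
    moreover have "(\<lambda>k. w k (0, j) - w k (1, j)) \<in> O(\<lambda>_. 1)"
      using p by (intro sum_in_bigo w_bounded) (auto simp: nodes_iff)
    ultimately show "(\<lambda>k. d k (1, j)) \<in> o(\<delta>)" unfolding d_def
      by (intro flux_small[OF cauchy_w[rule_format] p] smallo_mult_bounded(1))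
  next
    fix i j assume int: "(i, j) \<in> lattice_interior n" and le: "i + j + 1 \<le> s"
    note nodes = interior_neighbour_nodes[OF int]
    have "(\<lambda>k. lap (\<gamma>' k) (d k) (i, j) - q' k (i, j) * d k (i, j)) \<in> o(\<delta>)"
    proof -
      have "(\<lambda>k. lap (h k) (w k) (i, j)) \<in> o(\<delta>)"
        by (rule lap_known_small[OF known int le w_bounded])
      moreover have "(\<lambda>k. (q k (i, j) - q' k (i, j)) * w k (i, j)) \<in> o(\<delta>)"
        using le by (intro smallo_mult_bounded(1) q_lower int w_bounded nodes) auto
      ultimately show ?thesis
        unfolding d_eq by (intro sum_in_smallo(1)[OF sum_in_smallo(2)[OF res[OF int]]])
    qed
    then show "\<exists>c. c \<in> O(\<lambda>_. 1) \<and> (\<lambda>k. lap (\<gamma>' k) (d k) (i, j) - c k * d k (i, j)) \<in> o(\<delta>)"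
      using q'_bounded[OF int] by blast
  qed (use s in simp)
  have d_small: "(\<lambda>k. d k (i, j)) \<in> o(\<delta>)" if "(i, j) \<in> lattice_nodes n" for i j
    using d_lower[OF that] d_upper[OF that] by linarith
  \<comment> \<open>With \<open>d\<close> small at all nodes the equation is read backwards, for its
    source. The term with \<open>q - q'\<close> is small by \<open>q_lower\<close> if
    \<open>i + j \<le> s\<close> and by the vanishing of \<open>w\<close> if
    \<open>i + j = s + 1\<close>.\<close>
  have current: "(\<lambda>k. lap (h k) (w k) (i, j)) \<in> o(\<delta>)"
    if int: "(i, j) \<in> lattice_interior n" and le: "i + j \<le> s + 1" for i j
  proof -
    note nodes = interior_neighbour_nodes[OF int]
    have qw: "(\<lambda>k. (q k (i, j) - q' k (i, j)) * w k (i, j)) \<in> o(\<delta>)"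
    proof (cases "i + j \<le> s")
      case True
      then show ?thesis by (intro smallo_mult_bounded(1) q_lower int w_bounded nodes)
    next
      case False
      then show ?thesis by (intro bigo_mult_vanishing q_diff' int w_vanish nodes) simp
    qed
    have lap: "(\<lambda>k. lap (\<gamma>' k) (d k) (i, j)) \<in> o(\<delta>)"
      unfolding lap.simps
      by (intro sum_in_smallo smallo_mult_bounded(2) d_small nodes elliptic_sequence_bounded(1)[OF ell']
          interior_edges[OF int])
    have "(\<lambda>k. ((lap (\<gamma> k) (w k) (i, j) - q k (i, j) * w k (i, j)) -
         (lap (\<gamma>' k) (w' k) (i, j) - q' k (i, j) * w' k (i, j)))
         + (q k (i, j) - q' k (i, j)) * w k (i, j)
         - (lap (\<gamma>' k) (d k) (i, j) - q' k (i, j) * d k (i, j))) \<in> o(\<delta>)"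
      by (intro sum_in_smallo(2)[OF sum_in_smallo(1)[OF res[OF int] qw]] sum_in_smallo(2)[OF lap]
          smallo_mult_bounded(2) d_small nodes q'_bounded int)
    then show ?thesis unfolding d_eq by simp
  qed
  show thesis
  proof (rule that[OF cauchy_w])
    show "(\<lambda>k. w k (i, j) - w' k (i, j)) \<in> o(\<delta>)" if "(i, j) \<in> lattice_nodes n" for i j
      using d_small[OF that] by (simp add: d_def)
    show "(\<lambda>k. f k * corner_solution (\<gamma> k) (q k) n s p) \<in> o(\<delta>)"
      if "p \<in> lattice_nodes n" "f \<in> O(\<delta>)" "(\<lambda>k. f k * w k p) \<in> o(\<delta>)" for p f
      using to_W[OF that] by (simp only: W_def)
  qed (rule w_bounded w_vanish current; assumption)+
qed

text \<open>The edges between the diagonals \<open>s\<close> and \<open>s + 1\<close> form a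
  staircase path from \<open>(s, 0)\<close> to \<open>(0, s)\<close>. The flux gives the first edge;
  along the path, the equation at each node gives the next edge from the previous one.\<close>

lemma known_step:
  assumes s: "1 \<le> s" "s \<le> int n" and known: "known s"
  shows "known (s + 1)"
proof -
  obtain w w' where cauchy_w: "\<forall>k. same_cauchy n (\<gamma> k) (\<gamma>' k) (w k) (w' k)"
    and d_small: "\<And>i j. (i, j) \<in> lattice_nodes n \<Longrightarrow> (\<lambda>k. w k (i, j) - w' k (i, j)) \<in> o(\<delta>)"
    and w_bounded: "\<And>i j. (i, j) \<in> lattice_nodes n \<Longrightarrow> (\<lambda>k. w k (i, j)) \<in> O(\<lambda>_. 1)"
    and w_vanish: "\<And>i j. (i, j) \<in> lattice_nodes n \<Longrightarrow> s < i + j \<Longrightarrow> (\<lambda>k. w k (i, j)) \<in> o(\<lambda>_. 1)"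
    and to_W: "\<And>p f. p \<in> lattice_nodes n \<Longrightarrow> f \<in> O(\<delta>) \<Longrightarrow> (\<lambda>k. f k * w k p) \<in> o(\<delta>) \<Longrightarrow>
       (\<lambda>k. f k * corner_solution (\<gamma> k) (q k) n s p) \<in> o(\<delta>)"
    and current: "\<And>i j. (i, j) \<in> lattice_interior n \<Longrightarrow> i + j \<le> s + 1 \<Longrightarrow> (\<lambda>k. lap (h k) (w k) (i, j)) \<in> o(\<delta>)"
    using corner_pair[OF s known] by blast
  \<comment> \<open>On the diagonal \<open>s\<close> the corner solution is bounded away from 0 and
    can be divided out.\<close>
  have cancel: "f \<in> o(\<delta>)"
    if "f \<in> O(\<delta>)" "(\<lambda>k. f k * w k (i, j)) \<in> o(\<delta>)" "(i, j) \<in> lattice_nodes n" "i + j = s" for f i j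
  proof -
    have "0 \<le> i" "0 \<le> j" using that(3) by (auto simp: nodes_iff interior_iff boundary_iff)
    note diag = corner_solution_diagonal[OF s(2) that(4) this]
    show ?thesis
      by (rule smallo_cancel_bounded_inverse[OF to_W[OF that(3,1,2)] diag])
  qed
  \<comment> \<open>At a node of the diagonal \<open>s + 1\<close>, \<open>w\<close> is negligible
    at the node, to its right and above. Only the lower and the left edge remain, and the lower one
    is known.\<close>
  have across: "(\<lambda>k. h k {(i, j), (i - 1, j)}) \<in> o(\<delta>)"
    if int: "(i, j) \<in> lattice_interior n" and sum: "i + j = s + 1"
      and down: "(\<lambda>k. h k {(i, j), (i, j - 1)}) \<in> o(\<delta>)" for i j
  proof -
    note nodes = interior_neighbour_nodes[OF int] and edges = interior_edges[OF int]
    have cur: "(\<lambda>k. lap (h k) (w k) (i, j)) \<in> o(\<delta>)" using sum by (intro current[OF int]) simp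
    have "(\<lambda>k. h k {(i, j), (i + 1, j)} * (w k (i + 1, j) - w k (i, j))) \<in> o(\<delta>)"
      "(\<lambda>k. h k {(i, j), (i, j + 1)} * (w k (i, j + 1) - w k (i, j))) \<in> o(\<delta>)"
      "(\<lambda>k. h k {(i, j), (i - 1, j)} * w k (i, j)) \<in> o(\<delta>)"
      using sum by (intro bigo_mult_vanishing sum_in_smallo contrast edges w_vanish nodes; simp)+
    moreover have "(\<lambda>k. h k {(i, j), (i, j - 1)} * (w k (i, j - 1) - w k (i, j))) \<in> o(\<delta>)"
      by (intro smallo_mult_bounded(1)[OF down] sum_in_bigo w_bounded nodes)
    ultimately have cur': "(\<lambda>k. lap (h k) (w k) (i, j)
        - h k {(i, j), (i + 1, j)} * (w k (i + 1, j) - w k (i, j))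
        - h k {(i, j), (i, j + 1)} * (w k (i, j + 1) - w k (i, j))
        - h k {(i, j), (i, j - 1)} * (w k (i, j - 1) - w k (i, j))
        + h k {(i, j), (i - 1, j)} * w k (i, j)) \<in> o(\<delta>)"
      by (intro sum_in_smallo(1)[OF sum_in_smallo(2)[OF sum_in_smallo(2)[OF sum_in_smallo(2)[OF cur]]]])
    have eq: "lap (h k) (w k) (i, j)
        - h k {(i, j), (i + 1, j)} * (w k (i + 1, j) - w k (i, j))
        - h k {(i, j), (i, j + 1)} * (w k (i, j + 1) - w k (i, j))
        - h k {(i, j), (i, j - 1)} * (w k (i, j - 1) - w k (i, j))
        + h k {(i, j), (i - 1, j)} * w k (i, j) = h k {(i, j), (i - 1, j)} * w k (i - 1, j)" for k
      unfolding lap.simps by (simp add: right_diff_distrib)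
    have "(\<lambda>k. h k {(i, j), (i - 1, j)} * w k (i - 1, j)) \<in> o(\<delta>)" using cur' unfolding eq .
    from cancel[OF contrast[OF edges(2)] this nodes(3)] show ?thesis using sum by simp
  qed
  \<comment> \<open>At a node of the diagonal \<open>s\<close> the left and lower edges are known by
    induction and the right one from the path. Above the node \<open>w\<close> is negligible, so the
    upper edge appears with the factor \<open>w k (i, j)\<close>, which is not.\<close>
  have turn: "(\<lambda>k. h k {(i, j), (i, j + 1)}) \<in> o(\<delta>)"
    if int: "(i, j) \<in> lattice_interior n" and sum: "i + j = s"
      and right: "(\<lambda>k. h k {(i, j), (i + 1, j)}) \<in> o(\<delta>)" for i j
  proof -
    note nodes = interior_neighbour_nodes[OF int] and edges = interior_edges[OF int]
    have cur: "(\<lambda>k. lap (h k) (w k) (i, j)) \<in> o(\<delta>)" using sum by (intro current[OF int]) simp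
    have left: "(\<lambda>k. h k {(i, j), (i - 1, j)}) \<in> o(\<delta>)" and down: "(\<lambda>k. h k {(i, j), (i, j - 1)}) \<in> o(\<delta>)"
      using sum by (intro knownD[OF known] edges; simp)+
    have "(\<lambda>k. h k {(i, j), (i, j + 1)} * w k (i, j + 1)) \<in> o(\<delta>)"
      using sum by (intro bigo_mult_vanishing contrast edges w_vanish nodes; simp)
    moreover have "(\<lambda>k. h k {(i, j), (i + 1, j)} * (w k (i + 1, j) - w k (i, j))) \<in> o(\<delta>)"
      "(\<lambda>k. h k {(i, j), (i - 1, j)} * (w k (i - 1, j) - w k (i, j))) \<in> o(\<delta>)"
      "(\<lambda>k. h k {(i, j), (i, j - 1)} * (w k (i, j - 1) - w k (i, j))) \<in> o(\<delta>)"
      by (intro smallo_mult_bounded(1)[OF right] smallo_mult_bounded(1)[OF left]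
          smallo_mult_bounded(1)[OF down] sum_in_bigo w_bounded nodes)+
    ultimately have cur': "(\<lambda>k. h k {(i, j), (i, j + 1)} * w k (i, j + 1)
        + h k {(i, j), (i + 1, j)} * (w k (i + 1, j) - w k (i, j))
        + h k {(i, j), (i - 1, j)} * (w k (i - 1, j) - w k (i, j))
        + h k {(i, j), (i, j - 1)} * (w k (i, j - 1) - w k (i, j))
        - lap (h k) (w k) (i, j)) \<in> o(\<delta>)"
      by (intro sum_in_smallo(2)[OF sum_in_smallo(1)[OF sum_in_smallo(1)[OF sum_in_smallo(1)]] cur])
    have eq: "h k {(i, j), (i, j + 1)} * w k (i, j + 1)
        + h k {(i, j), (i + 1, j)} * (w k (i + 1, j) - w k (i, j))
        + h k {(i, j), (i - 1, j)} * (w k (i - 1, j) - w k (i, j))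
        + h k {(i, j), (i, j - 1)} * (w k (i, j - 1) - w k (i, j))
        - lap (h k) (w k) (i, j) = h k {(i, j), (i, j + 1)} * w k (i, j)" for k
      unfolding lap.simps by (simp add: right_diff_distrib)
    have "(\<lambda>k. h k {(i, j), (i, j + 1)} * w k (i, j)) \<in> o(\<delta>)" using cur' unfolding eq .
    from cancel[OF contrast[OF edges(3)] this nodes(1) sum] show ?thesis .
  qed
  \<comment> \<open>In the flux identity \<open>w\<close> is negligible at \<open>(s, 1)\<close> but
    not at \<open>(s, 0)\<close>, so the agreement of \<open>w\<close> and \<open>w'\<close> at
    \<open>(s, 1)\<close> determines the edge.\<close>
  have start: "(\<lambda>k. h k {(s, 0), (s, 1)}) \<in> o(\<delta>)"
  proof -
    have p: "(s, 0) \<in> lattice_boundary n" "(s, 1) \<in> lattice_interior n" "{(s, 0), (s, 1)} \<in> lattice_edges n"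
      using s by (auto simp: boundary_iff interior_iff edges_iff nodes_iff)
    have nodes: "(s, 0) \<in> lattice_nodes n" "(s, 1) \<in> lattice_nodes n" using p by (auto simp: nodes_iff)
    have "(\<lambda>k. \<gamma>' k {(s, 0), (s, 1)} * (w k (s, 1) - w' k (s, 1)) + h k {(s, 0), (s, 1)} * w k (s, 1)) \<in> o(\<delta>)"
      using nodes
      by (intro sum_in_smallo(1) smallo_mult_bounded(2)[OF d_small elliptic_sequence_bounded(1)[OF ell' p(3)]]
          bigo_mult_vanishing[OF contrast[OF p(3)] w_vanish]) auto
    then have "(\<lambda>k. h k {(s, 0), (s, 1)} * w k (s, 0)) \<in> o(\<delta>)"
      unfolding flux_difference[OF cauchy_w[rule_format] p, symmetric] by (simp add: algebra_simps)
    from cancel[OF contrast[OF p(3)] this nodes(1)] show ?thesis by simp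
  qed
  \<comment> \<open>The index \<open>m\<close> counts the stairs: first the vertical edge above
    \<open>(s - m, m)\<close>, then the horizontal edge that leaves its upper end to the
    left.\<close>
  have chain: "int m < s \<Longrightarrow> (\<lambda>k. h k {(s - int m, int m), (s - int m, int m + 1)}) \<in> o(\<delta>) \<and>
      (\<lambda>k. h k {(s - int m - 1, int m + 1), (s - int m, int m + 1)}) \<in> o(\<delta>)" for m
  proof (induction m)
    case 0
    then show ?case using across[of s 1] start s by (auto simp: interior_iff insert_commute)
  next
    case (Suc m)
    have int: "(s - int (Suc m), int (Suc m)) \<in> lattice_interior n"
      "(s - int (Suc m), int (Suc m) + 1) \<in> lattice_interior n"
      using Suc.prems s by (auto simp: interior_iff)
    have "(\<lambda>k. h k {(s - int (Suc m), int (Suc m)), (s - int (Suc m) + 1, int (Suc m))}) \<in> o(\<delta>)"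
      using Suc by (simp add: algebra_simps)
    then have up: "(\<lambda>k. h k {(s - int (Suc m), int (Suc m)), (s - int (Suc m), int (Suc m) + 1)}) \<in> o(\<delta>)"
      by (intro turn int) auto
    then have "(\<lambda>k. h k {(s - int (Suc m), int (Suc m) + 1), (s - int (Suc m) - 1, int (Suc m) + 1)}) \<in> o(\<delta>)"
      by (intro across int) (auto simp: insert_commute)
    then show ?case using up by (simp add: insert_commute)
  qed
  \<comment> \<open>A horizontal edge in row \<open>j\<close> belongs to the stair
    \<open>j - 1\<close>, a vertical edge with lower end in row \<open>j\<close> to the stair
    \<open>j\<close>.\<close>
  have edge: "(\<lambda>k. h k {(i, j), (i + a, j + b)}) \<in> o(\<delta>)"
    if e: "{(i, j), (i + a, j + b)} \<in> lattice_edges n" and ab: "a = 1 \<and> b = 0 \<or> a = 0 \<and> b = 1"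
      and le: "i + j + a + b \<le> s + 1" for i j a b
  proof (cases "i + j + a + b \<le> s")
    case True
    then show ?thesis using ab by (intro knownD[OF known e]) auto
  next
    case False
    then have sum: "i + j = s" using le ab by auto
    show ?thesis using ab
    proof
      assume b: "a = 1 \<and> b = 0"
      then have "1 \<le> j" "0 \<le> i" using e by (auto simp: edges_iff nodes_iff interior_iff boundary_iff)
      then have "int (nat (j - 1)) < s" and eqs: "int (nat (j - 1)) = j - 1" "s - (j - 1) - 1 = i"
        "s - (j - 1) = i + 1" "j - 1 + 1 = j" using sum by auto
      from conjunct2[OF chain[OF this(1)]] show ?thesis
        by (simp only: eqs add_diff_cancel_right' conjunct1[OF b] conjunct2[OF b] add_0_right)
    next
      assume b: "a = 0 \<and> b = 1"
      then have "0 \<le> j" "1 \<le> i" using e by (auto simp: edges_iff nodes_iff interior_iff boundary_iff)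
      then have "int (nat j) < s" and eqs: "int (nat j) = j" "s - j = i" using sum by auto
      from conjunct1[OF chain[OF this(1)]] show ?thesis
        by (simp only: eqs conjunct1[OF b] conjunct2[OF b] add_0_right)
    qed
  qed
  show ?thesis unfolding known_def
  proof (intro allI impI)
    fix i j i' j'
    assume e: "{(i, j), (i', j')} \<in> lattice_edges n" and le: "i + j \<le> s + 1" "i' + j' \<le> s + 1"
    have "\<bar>i - i'\<bar> + \<bar>j - j'\<bar> = 1" using e by (simp add: edges_iff)
    from int_unit_step[OF this]
    consider "i' = i + 1" "j' = j" | "i = i' + 1" "j = j'" | "i' = i" "j' = j + 1" | "i = i'" "j = j' + 1"
      by force
    then show "(\<lambda>k. h k {(i, j), (i', j')}) \<in> o(\<delta>)"
    proof cases
      case 1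
      then show ?thesis using edge[of i j 1 0] e le by simp
    next
      case 2
      then show ?thesis using edge[of i' j' 1 0] e le by (simp add: insert_commute)
    next
      case 3
      then show ?thesis using edge[of i j 0 1] e le by simp
    next
      case 4
      then show ?thesis using edge[of i' j' 0 1] e le by (simp add: insert_commute)
    qed
  qed
qed

lemma lower_triangle:
  assumes "1 \<le> n"
  shows "known (int n + 1)"
proof -
  \<comment> \<open>Vacuous, since every edge has an interior end, where
    \<open>i + j \<ge> 2\<close>.\<close>
  have base: "known 1" unfolding known_def edges_iff
    by (auto simp: interior_iff nodes_iff boundary_iff)
  have "m \<le> n \<Longrightarrow> known (int m + 1)" for m
  proof (induction m)
    case 0
    then show ?case using base by simp
  next
    case (Suc m)
    then show ?case using known_step[of "int m + 1"] by simp
  qed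
  then show ?thesis by simp
qed

end

section \<open>Reflection to the opposite corner\<close>

definition reflect :: "nat \<Rightarrow> node \<Rightarrow> node" where
  "reflect n = (\<lambda>(i, j). (int n + 1 - i, int n + 1 - j))"

lemma reflect_reflect [simp]: "reflect n (reflect n p) = p"
  by (cases p) (simp add: reflect_def)

lemma reflect_interior [simp]: "reflect n p \<in> lattice_interior n \<longleftrightarrow> p \<in> lattice_interior n"
  by (cases p) (auto simp: reflect_def interior_iff)

lemma reflect_boundary [simp]: "reflect n p \<in> lattice_boundary n \<longleftrightarrow> p \<in> lattice_boundary n"
  by (cases p) (auto simp: reflect_def boundary_iff)

lemma reflect_nodes [simp]: "reflect n p \<in> lattice_nodes n \<longleftrightarrow> p \<in> lattice_nodes n"
  by (simp add: nodes_iff)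

lemma reflect_edges:
  assumes "e \<in> lattice_edges n"
  shows "reflect n ` e \<in> lattice_edges n"
proof -
  obtain i j i' j' where e: "e = {(i, j), (i', j')}"
    using assms by (cases rule: edge_cases) auto
  show ?thesis using assms reflect_interior[of n "(i, j)"] reflect_interior[of n "(i', j')"]
      reflect_nodes[of n "(i, j)"] reflect_nodes[of n "(i', j')"]
    unfolding e by (auto simp: edges_iff reflect_def)
qed

lemma lap_reflect: "lap (\<lambda>e. \<gamma> (reflect n ` e)) (\<lambda>p. u (reflect n p)) p = lap \<gamma> u (reflect n p)"
proof -
  obtain i j where p: "p = (i, j)" by force
  have "int n + 1 - (i + 1) = int n + 1 - i - 1" "int n + 1 - (i - 1) = int n + 1 - i + 1"
    "int n + 1 - (j + 1) = int n + 1 - j - 1" "int n + 1 - (j - 1) = int n + 1 - j + 1"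
    by auto
  then show ?thesis unfolding p reflect_def split lap.simps image_insert image_empty by (simp only:)
qed

lemma elliptic_reflect:
  "uniformly_elliptic n a A \<gamma> \<Longrightarrow> uniformly_elliptic n a A (\<lambda>e. \<gamma> (reflect n ` e))"
  by (simp add: uniformly_elliptic_def reflect_edges)

lemma same_cauchy_reflect:
  assumes "same_cauchy n \<gamma> \<gamma>' w w'"
  shows "same_cauchy n (\<lambda>e. \<gamma> (reflect n ` e)) (\<lambda>e. \<gamma>' (reflect n ` e))
           (\<lambda>p. w (reflect n p)) (\<lambda>p. w' (reflect n p))"
  unfolding same_cauchy_def
proof (intro ballI conjI impI)
  fix p assume p: "p \<in> lattice_boundary n"
  then show "w (reflect n p) = w' (reflect n p)" using assms by (simp add: same_cauchy_def)
  fix x assume x: "x \<in> lattice_interior n" "{p, x} \<in> lattice_edges n"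
  have "{reflect n p, reflect n x} \<in> lattice_edges n" using reflect_edges[OF x(2)] by simp
  moreover have "reflect n p \<in> lattice_boundary n" "reflect n x \<in> lattice_interior n"
    using p x by simp_all
  ultimately show "\<gamma> (reflect n ` {p, x}) * (w (reflect n p) - w (reflect n x)) =
      \<gamma>' (reflect n ` {p, x}) * (w' (reflect n p) - w' (reflect n x))"
    using assms unfolding same_cauchy_def image_insert image_empty by blast
qed

context conductivity_pair
begin

text \<open>The assumptions of the locale are invariant under the point reflection, which turns
  \<open>i + j \<le> n + 1\<close> into \<open>i + j \<ge> n + 1\<close>. Layer stripping from the
  corner \<open>(n + 1, n + 1)\<close> is thus the result already proved.\<close>

lemma reflected:
  "conductivity_pair n a A (\<lambda>k e. \<gamma> k (reflect n ` e)) (\<lambda>k e. \<gamma>' k (reflect n ` e))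
     (\<lambda>k p. u k (reflect n p)) (\<lambda>k p. u' k (reflect n p))
     (\<lambda>k p. q k (reflect n p)) (\<lambda>k p. q' k (reflect n p)) \<delta>"
proof
  fix W :: "nat \<Rightarrow> node \<Rightarrow> real"
  assume W: "\<forall>p\<in>lattice_nodes n. (\<lambda>k. W k p) \<in> O(\<lambda>_. 1)"
    and eq: "\<forall>k. \<forall>p\<in>lattice_interior n. lap (\<lambda>e. \<gamma> k (reflect n ` e)) (W k) p = q k (reflect n p) * W k p"
  have b1: "\<forall>p\<in>lattice_nodes n. (\<lambda>k. W k (reflect n p)) \<in> O(\<lambda>_. 1)"
    using W by simp
  have b2: "\<forall>k. \<forall>p\<in>lattice_interior n. lap (\<gamma> k) (\<lambda>p. W k (reflect n p)) p = q k p * W k (reflect n p)"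
  proof (intro allI ballI)
    fix k p assume p: "p \<in> lattice_interior n"
    have "lap (\<gamma> k) (\<lambda>p. W k (reflect n p)) p =
        lap (\<lambda>e. \<gamma> k (reflect n ` e)) (\<lambda>p. W k (reflect n (reflect n p))) (reflect n p)"
      using lap_reflect[of "\<gamma> k" n "\<lambda>p. W k (reflect n p)" "reflect n p"] by simp
    also have "\<dots> = q k p * W k (reflect n p)" using eq p by simp
    finally show "lap (\<gamma> k) (\<lambda>p. W k (reflect n p)) p = q k p * W k (reflect n p)" .
  qed
  obtain w w' where L: "(\<forall>k. same_cauchy n (\<gamma> k) (\<gamma>' k) (w k) (w' k)) \<and>
      (\<forall>p\<in>lattice_nodes n. (\<lambda>k. w k p - W k (reflect n p)) \<in> o(\<lambda>_. 1)) \<and>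
      (\<forall>p\<in>lattice_interior n. (\<lambda>k. (lap (\<gamma> k) (w k) p - q k p * w k p) -
          (lap (\<gamma>' k) (w' k) p - q' k p * w' k p)) \<in> o(\<delta>))"
    using linearization[OF b1 b2] by (elim exE) (rule that)
  show "\<exists>w w'. (\<forall>k. same_cauchy n (\<lambda>e. \<gamma> k (reflect n ` e)) (\<lambda>e. \<gamma>' k (reflect n ` e)) (w k) (w' k)) \<and>
      (\<forall>p\<in>lattice_nodes n. (\<lambda>k. w k p - W k p) \<in> o(\<lambda>_. 1)) \<and>
      (\<forall>p\<in>lattice_interior n. (\<lambda>k. (lap (\<lambda>e. \<gamma> k (reflect n ` e)) (w k) p - q k (reflect n p) * w k p) -
          (lap (\<lambda>e. \<gamma>' k (reflect n ` e)) (w' k) p - q' k (reflect n p) * w' k p)) \<in> o(\<delta>))"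
  proof (intro exI conjI allI ballI)
    show "same_cauchy n (\<lambda>e. \<gamma> k (reflect n ` e)) (\<lambda>e. \<gamma>' k (reflect n ` e))
        (\<lambda>p. w k (reflect n p)) (\<lambda>p. w' k (reflect n p))" for k
      using L by (intro same_cauchy_reflect) blast
    show "(\<lambda>k. w k (reflect n p) - W k p) \<in> o(\<lambda>_. 1)" if "p \<in> lattice_nodes n" for p
      using bspec[OF conjunct1[OF conjunct2[OF L]], of "reflect n p"] that by simp
    show "(\<lambda>k. (lap (\<lambda>e. \<gamma> k (reflect n ` e)) (\<lambda>p. w k (reflect n p)) p - q k (reflect n p) * w k (reflect n p)) -
        (lap (\<lambda>e. \<gamma>' k (reflect n ` e)) (\<lambda>p. w' k (reflect n p)) p - q' k (reflect n p) * w' k (reflect n p))) \<in> o(\<delta>)"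
      if "p \<in> lattice_interior n" for p
      unfolding lap_reflect using bspec[OF conjunct2[OF conjunct2[OF L]], of "reflect n p"] that by simp
  qed
next
  fix p assume "p \<in> lattice_interior n"
  then show "\<exists>c. c \<in> O(\<lambda>_. 1) \<and> (\<forall>k. lap (\<lambda>e. \<gamma> k (reflect n ` e)) (\<lambda>p. u k (reflect n p)) p -
      lap (\<lambda>e. \<gamma>' k (reflect n ` e)) (\<lambda>p. u' k (reflect n p)) p = c k * (u k (reflect n p) - u' k (reflect n p)))"
    unfolding lap_reflect by (intro nonlinear) simp
qed (use ell ell' contrast u_bounded q_bounded q'_bounded u_diff q_diff cauchy in
    \<open>simp_all add: elliptic_reflect reflect_edges same_cauchy_reflect\<close>)

lemma contrast_small:
  assumes n: "1 \<le> n" and e: "e \<in> lattice_edges n"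
  shows "(\<lambda>k. h k e) \<in> o(\<delta>)"
proof -
  interpret r: conductivity_pair n a A "\<lambda>k e. \<gamma> k (reflect n ` e)" "\<lambda>k e. \<gamma>' k (reflect n ` e)"
    "\<lambda>k p. u k (reflect n p)" "\<lambda>k p. u' k (reflect n p)"
    "\<lambda>k p. q k (reflect n p)" "\<lambda>k p. q' k (reflect n p)" \<delta>
    by (rule reflected)
  obtain i j i' j' where ij: "e = {(i, j), (i', j')}"
    using e by (cases rule: edge_cases) auto
  then have "\<bar>i - i'\<bar> + \<bar>j - j'\<bar> = 1" using e by (simp add: edges_iff)
  \<comment> \<open>The sums at the two ends differ by one, so they cannot lie strictly on opposite
    sides of the diagonal \<open>n + 1\<close>.\<close>
  then consider "i + j \<le> int n + 1" "i' + j' \<le> int n + 1" | "int n + 1 \<le> i + j" "int n + 1 \<le> i' + j'"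
    by linarith
  then show ?thesis
  proof cases
    case 1
    then show ?thesis using knownD[OF lower_triangle[OF n]] e unfolding ij by blast
  next
    case 2
    have "reflect n ` e = {(int n + 1 - i, int n + 1 - j), (int n + 1 - i', int n + 1 - j')}"
      by (simp add: ij reflect_def)
    moreover from this have "{(int n + 1 - i, int n + 1 - j), (int n + 1 - i', int n + 1 - j')} \<in> lattice_edges n"
      using reflect_edges[OF e] by simp
    ultimately have "(\<lambda>k. h k (reflect n ` (reflect n ` e))) \<in> o(\<delta>)"
      using r.knownD[OF r.lower_triangle[OF n]] 2 by simp
    then show ?thesis by (simp add: image_image)
  qed
qed

end

section \<open>Estimates for smooth nonlinearities\<close>

text \<open>One constant for all bounds on \<open>[-M, M]\<close>, and a Lipschitz bound for
  \<open>f''\<close> in place of a third derivative. The derivative \<open>f'\<close> is a parameter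
  because it is the potential of the linearized equation.\<close>

definition C3_bounded :: "(real \<Rightarrow> real) \<Rightarrow> (real \<Rightarrow> real) \<Rightarrow> real \<Rightarrow> real \<Rightarrow> bool" where
  "C3_bounded f f' M L \<longleftrightarrow> (\<forall>x. (f has_real_derivative f' x) (at x)) \<and>
     (\<forall>x. \<bar>x\<bar> \<le> M \<longrightarrow> \<bar>f' x\<bar> \<le> L) \<and>
     (\<exists>f''. (\<forall>x. (f' has_real_derivative f'' x) (at x)) \<and> (\<forall>x. \<bar>x\<bar> \<le> M \<longrightarrow> \<bar>f'' x\<bar> \<le> L) \<and>
        (\<forall>x y. \<bar>x\<bar> \<le> M \<longrightarrow> \<bar>y\<bar> \<le> M \<longrightarrow> \<bar>f'' x - f'' y\<bar> \<le> L * \<bar>x - y\<bar>))"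

lemma mvt_abs:
  fixes f f' :: "real \<Rightarrow> real"
  assumes "\<And>x. (f has_real_derivative f' x) (at x)"
  obtains \<xi> where "min x y \<le> \<xi>" "\<xi> \<le> max x y" "f x - f y = f' \<xi> * (x - y)"
proof -
  consider "x < y" | "x = y" | "y < x" by linarith
  then show thesis
  proof cases
    case 1
    obtain z where "x < z" "z < y" "f y - f x = (y - x) * f' z"
      using MVT2[OF 1, of f f'] assms by blast
    then show thesis using that[of z] 1 by (simp add: algebra_simps)
  next
    case 2
    then show thesis using that[of x] by simp
  next
    case 3
    obtain z where "y < z" "z < x" "f x - f y = (x - y) * f' z"
      using MVT2[OF 3, of f f'] assms by blast
    then show thesis using that[of z] 3 by (simp add: algebra_simps)
  qed
qed

lemma mvt_abs_le:
  fixes f f' :: "real \<Rightarrow> real"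
  assumes "\<And>x. (f has_real_derivative f' x) (at x)"
    and "\<And>\<xi>. min x y \<le> \<xi> \<Longrightarrow> \<xi> \<le> max x y \<Longrightarrow> \<bar>f' \<xi>\<bar> \<le> C"
  shows "\<bar>f x - f y\<bar> \<le> C * \<bar>x - y\<bar>"
proof -
  obtain \<xi> where \<xi>: "min x y \<le> \<xi>" "\<xi> \<le> max x y" "f x - f y = f' \<xi> * (x - y)"
    using mvt_abs[OF assms(1)] by blast
  show ?thesis unfolding \<xi>(3) abs_mult
    using assms(2)[OF \<xi>(1,2)] by (intro mult_right_mono) auto
qed

lemma shifted_derivative:
  fixes f f' :: "real \<Rightarrow> real"
  assumes "\<And>x. (f has_real_derivative f' x) (at x)"
  shows "((\<lambda>s. f (s + y)) has_real_derivative f' (s + y)) (at s)"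
  using assms by (rule DERIV_shift[THEN iffD1])

text \<open>The first three derivatives are bounded on a compact interval by continuity, and the
  bound on the third is a Lipschitz constant for the second.\<close>

lemma C_times_imp_C3_bounded:
  assumes f: "C_times r f" and r: "3 \<le> r"
  shows "\<exists>L. C3_bounded f (deriv f) M L"
proof -
  have D: "((deriv ^^ k) f has_real_derivative (deriv ^^ Suc k) f x) (at x)" if "k < r" for k x
  proof -
    have "(deriv ^^ k) f field_differentiable at x" using f that unfolding C_times_def by blast
    then have "((deriv ^^ k) f has_real_derivative deriv ((deriv ^^ k) f) x) (at x)"
      by (rule DERIV_deriv_iff_field_differentiable[THEN iffD2])
    then show ?thesis by simp
  qed
  have cont: "continuous_on S ((deriv ^^ k) f)" if "k \<le> r" for k S
  proof (cases "k = r")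
    case True
    then show ?thesis using f continuous_on_subset unfolding C_times_def by blast
  next
    case False
    then have "k < r" using that by simp
    show ?thesis
      by (rule DERIV_continuous_on) (rule has_field_derivative_at_within[OF D[OF \<open>k < r\<close>]])
  qed
  have bnd: "\<exists>B. \<forall>x. \<bar>x\<bar> \<le> M \<longrightarrow> \<bar>(deriv ^^ k) f x\<bar> \<le> B" if "k \<le> r" for k
  proof -
    have "compact ((deriv ^^ k) f ` {-M..M})"
      by (intro compact_continuous_image cont that) simp
    then obtain B where "\<forall>y\<in>(deriv ^^ k) f ` {-M..M}. norm y \<le> B"
      using compact_imp_bounded bounded_iff by blast
    then show ?thesis by (intro exI[of _ B]) (auto simp: abs_le_iff)
  qed
  obtain B1 B2 B3 where B: "\<And>x. \<bar>x\<bar> \<le> M \<Longrightarrow> \<bar>(deriv ^^ 1) f x\<bar> \<le> B1"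
    "\<And>x. \<bar>x\<bar> \<le> M \<Longrightarrow> \<bar>(deriv ^^ 2) f x\<bar> \<le> B2" "\<And>x. \<bar>x\<bar> \<le> M \<Longrightarrow> \<bar>(deriv ^^ 3) f x\<bar> \<le> B3"
    using bnd[of 1] bnd[of 2] bnd[of 3] r by auto
  define L where "L = max B1 (max B2 B3)"
  have B3L: "\<bar>(deriv ^^ Suc 2) f x\<bar> \<le> L" if "\<bar>x\<bar> \<le> M" for x
    using B(3)[OF that] unfolding L_def by (simp add: numeral_3_eq_3 eval_nat_numeral)
  have "\<bar>(deriv ^^ 2) f x - (deriv ^^ 2) f y\<bar> \<le> L * \<bar>x - y\<bar>" if "\<bar>x\<bar> \<le> M" "\<bar>y\<bar> \<le> M" for x y
    using D[of 2] r that by (intro mvt_abs_le[where f' = "(deriv ^^ Suc 2) f"] B3L) auto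
  moreover have "\<bar>(deriv ^^ 1) f x\<bar> \<le> L" "\<bar>(deriv ^^ 2) f x\<bar> \<le> L" if "\<bar>x\<bar> \<le> M" for x
    using B(1,2)[OF that] by (auto simp: L_def)
  moreover have "(f has_real_derivative (deriv ^^ 1) f x) (at x)"
    "((deriv ^^ 1) f has_real_derivative (deriv ^^ 2) f x) (at x)" for x
    using D[of 0 x] D[of 1 x] r by (simp_all add: numeral_2_eq_2)
  ultimately have "C3_bounded f ((deriv ^^ 1) f) M L"
    unfolding C3_bounded_def by (intro conjI exI[of _ "(deriv ^^ 2) f"]) blast+
  then show ?thesis by auto
qed

lemma C3_bounded_mono:
  assumes "C3_bounded f f' M L" "L \<le> L'"
  shows "C3_bounded f f' M L'"
proof -
  obtain f'' where f'': "\<forall>x. (f' has_real_derivative f'' x) (at x)" "\<forall>x. \<bar>x\<bar> \<le> M \<longrightarrow> \<bar>f'' x\<bar> \<le> L"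
    "\<forall>x y. \<bar>x\<bar> \<le> M \<longrightarrow> \<bar>y\<bar> \<le> M \<longrightarrow> \<bar>f'' x - f'' y\<bar> \<le> L * \<bar>x - y\<bar>"
    using assms(1) unfolding C3_bounded_def by blast
  have "\<bar>f'' x - f'' y\<bar> \<le> L' * \<bar>x - y\<bar>" if "\<bar>x\<bar> \<le> M" "\<bar>y\<bar> \<le> M" for x y
    using f''(3) that mult_right_mono[OF assms(2), of "\<bar>x - y\<bar>"] by (meson abs_ge_zero order_trans)
  then show ?thesis
    using assms f'' unfolding C3_bounded_def
    by (intro conjI exI[of _ f'']) (meson order_trans)+
qed

lemma C3_lipschitz_deriv:
  assumes "C3_bounded f f' M L" "\<bar>x\<bar> \<le> M" "\<bar>y\<bar> \<le> M"
  shows "\<bar>f' x - f' y\<bar> \<le> L * \<bar>x - y\<bar>"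
proof -
  obtain f'' where f'': "\<And>x. (f' has_real_derivative f'' x) (at x)" "\<And>x. \<bar>x\<bar> \<le> M \<Longrightarrow> \<bar>f'' x\<bar> \<le> L"
    using assms(1) unfolding C3_bounded_def by blast
  show ?thesis using assms(2,3) by (intro mvt_abs_le[OF f''(1)] f''(2)) auto
qed

text \<open>Supplies the nonnegative coefficient for \<open>stability_bound\<close>.\<close>

lemma C3_difference_quotient:
  assumes "C3_bounded f f' M L" "\<bar>x\<bar> \<le> M" "\<bar>y\<bar> \<le> M" "\<And>x. 0 \<le> f' x"
  shows "\<exists>c\<ge>0. c \<le> L \<and> f x - f y = c * (x - y)"
proof -
  have D: "\<And>x. (f has_real_derivative f' x) (at x)" and B: "\<And>x. \<bar>x\<bar> \<le> M \<Longrightarrow> \<bar>f' x\<bar> \<le> L"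
    using assms(1) unfolding C3_bounded_def by blast+
  obtain \<xi> where \<xi>: "min x y \<le> \<xi>" "\<xi> \<le> max x y" "f x - f y = f' \<xi> * (x - y)"
    using mvt_abs[OF D] by blast
  then have "\<bar>f' \<xi>\<bar> \<le> L" using assms(2,3) by (intro B) auto
  then show ?thesis using \<xi>(3) assms(4) by (intro exI[of _ "f' \<xi>"]) auto
qed

text \<open>The mean value theorem in the base point, for a fixed increment
  \<open>y\<close>.\<close>

lemma C3_increment_difference:
  assumes "C3_bounded f f' M L" "\<bar>x\<bar> \<le> M" "\<bar>x + y\<bar> \<le> M" "\<bar>x'\<bar> \<le> M" "\<bar>x' + y\<bar> \<le> M"
  shows "\<bar>(f (x + y) - f x) - (f (x' + y) - f x')\<bar> \<le> L * \<bar>y\<bar> * \<bar>x - x'\<bar>"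
proof -
  have D: "\<And>x. (f has_real_derivative f' x) (at x)"
    using assms(1) unfolding C3_bounded_def by blast
  have der: "((\<lambda>s. f (s + y) - f s) has_real_derivative f' (s + y) - f' s) (at s)" for s
    by (intro DERIV_diff shifted_derivative D)
  show ?thesis
  proof (rule mvt_abs_le[OF der])
    fix \<xi> assume "min x x' \<le> \<xi>" "\<xi> \<le> max x x'"
    then have "\<bar>f' (\<xi> + y) - f' \<xi>\<bar> \<le> L * \<bar>\<xi> + y - \<xi>\<bar>"
      using assms by (intro C3_lipschitz_deriv[OF assms(1)]) auto
    then show "\<bar>f' (\<xi> + y) - f' \<xi>\<bar> \<le> L * \<bar>y\<bar>" by simp
  qed
qed

text \<open>The Taylor remainder as a function of the base point has the derivative
  \<open>f' (s + y) - f' s - f'' s * y\<close>, which is quadratic in \<open>y\<close> because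
  \<open>f''\<close> is Lipschitz. Here the third order of smoothness enters.\<close>

lemma C3_remainder_base:
  assumes "C3_bounded f f' M L" "\<bar>x\<bar> \<le> M" "\<bar>x + y\<bar> \<le> M" "\<bar>x'\<bar> \<le> M" "\<bar>x' + y\<bar> \<le> M"
  shows "\<bar>(f (x + y) - f x - f' x * y) - (f (x' + y) - f x' - f' x' * y)\<bar> \<le> L * y\<^sup>2 * \<bar>x - x'\<bar>"
proof -
  obtain f'' where f'': "\<And>x. (f' has_real_derivative f'' x) (at x)"
    "\<And>x y. \<bar>x\<bar> \<le> M \<Longrightarrow> \<bar>y\<bar> \<le> M \<Longrightarrow> \<bar>f'' x - f'' y\<bar> \<le> L * \<bar>x - y\<bar>"
    and D: "\<And>x. (f has_real_derivative f' x) (at x)" and L: "0 \<le> L"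
  proof -
    have "0 \<le> L" using assms(1,2) unfolding C3_bounded_def by (meson abs_ge_zero order_trans)
    then show thesis using assms(1) that unfolding C3_bounded_def by metis
  qed
  have der: "((\<lambda>s. f (s + y) - f s - f' s * y) has_real_derivative f' (s + y) - f' s - f'' s * y) (at s)" for s
    by (intro DERIV_diff DERIV_cmult_right shifted_derivative D f''(1))
  show ?thesis
  proof (rule mvt_abs_le[OF der])
    fix s assume s: "min x x' \<le> s" "s \<le> max x x'"
    then have sM: "\<bar>s\<bar> \<le> M" "\<bar>s + y\<bar> \<le> M" using assms by auto
    obtain \<xi> where \<xi>: "min (s + y) s \<le> \<xi>" "\<xi> \<le> max (s + y) s" "f' (s + y) - f' s = f'' \<xi> * (s + y - s)"
      using mvt_abs[OF f''(1)] by blast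
    have "\<bar>f'' \<xi> - f'' s\<bar> \<le> L * \<bar>\<xi> - s\<bar>" using \<xi> sM by (intro f''(2)) auto
    also have "\<dots> \<le> L * \<bar>y\<bar>" using \<xi> L by (intro mult_left_mono) auto
    finally have "\<bar>f'' \<xi> - f'' s\<bar> * \<bar>y\<bar> \<le> L * \<bar>y\<bar> * \<bar>y\<bar>" by (rule mult_right_mono) simp
    moreover have "f' (s + y) - f' s - f'' s * y = (f'' \<xi> - f'' s) * y"
      unfolding \<xi>(3) by (simp add: algebra_simps)
    ultimately show "\<bar>f' (s + y) - f' s - f'' s * y\<bar> \<le> L * y\<^sup>2"
      by (simp add: abs_mult power2_eq_square mult.assoc)
  qed
qed

text \<open>The same remainder as a function of the increment; its derivative
  \<open>f' (x + s) - f' x\<close> is linear in \<open>s\<close>.\<close>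

lemma C3_remainder_increment:
  assumes "C3_bounded f f' M L" "\<bar>x\<bar> \<le> M" "\<bar>x + y\<bar> \<le> M" "\<bar>x + y'\<bar> \<le> M"
  shows "\<bar>(f (x + y) - f x - f' x * y) - (f (x + y') - f x - f' x * y')\<bar> \<le> L * (\<bar>y\<bar> + \<bar>y'\<bar>) * \<bar>y - y'\<bar>"
proof -
  have D: "\<And>x. (f has_real_derivative f' x) (at x)"
    using assms(1) unfolding C3_bounded_def by blast
  have L: "0 \<le> L" using assms(1,2) unfolding C3_bounded_def by (meson abs_ge_zero order_trans)
  have der: "((\<lambda>s. f (s + x) - f x - f' x * s) has_real_derivative f' (s + x) - f' x) (at s)" for s
    by (auto intro!: derivative_eq_intros shifted_derivative[OF D])
  show ?thesis unfolding add.commute[of x]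
  proof (rule mvt_abs_le[OF der])
    fix s assume s: "min y y' \<le> s" "s \<le> max y y'"
    have "\<bar>f' (x + s) - f' x\<bar> \<le> L * \<bar>x + s - x\<bar>"
      using s assms by (intro C3_lipschitz_deriv[OF assms(1)]) auto
    also have "\<dots> \<le> L * (\<bar>y\<bar> + \<bar>y'\<bar>)" using s L by (intro mult_left_mono) auto
    finally show "\<bar>f' (s + x) - f' x\<bar> \<le> L * (\<bar>y\<bar> + \<bar>y'\<bar>)" by (simp add: add.commute)
  qed
qed

section \<open>Difference quotients of solutions\<close>

text \<open>Two Dirichlet problems with the same Cauchy data for the boundary values \<open>\<phi>\<close> (solutions \<open>u\<close>,
  \<open>u'\<close>) and \<open>\<phi> + t v\<close> (solutions \<open>U\<close>, \<open>U'\<close>).\<close>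

locale perturbed_pair =
  fixes n :: nat and a A M L t \<delta> :: real and f f' :: "node \<Rightarrow> real \<Rightarrow> real"
    and \<gamma> \<gamma>' :: "node set \<Rightarrow> real" and u u' U U' :: "node \<Rightarrow> real" and v :: "node \<Rightarrow> real"
  assumes ell: "uniformly_elliptic n a A \<gamma>" and ell': "uniformly_elliptic n a A \<gamma>'"
    and contrast: "e \<in> lattice_edges n \<Longrightarrow> \<bar>\<gamma> e - \<gamma>' e\<bar> \<le> \<delta>" and \<delta>: "0 \<le> \<delta>"
    and f: "p \<in> lattice_interior n \<Longrightarrow> C3_bounded (f p) (f' p) (3 * M) L"
    and f'_nonneg: "p \<in> lattice_interior n \<Longrightarrow> 0 \<le> f' p x" and L: "0 \<le> L"
    and bounds: "p \<in> lattice_nodes n \<Longrightarrow> \<bar>u p\<bar> \<le> M" "p \<in> lattice_nodes n \<Longrightarrow> \<bar>u' p\<bar> \<le> M"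
      "p \<in> lattice_nodes n \<Longrightarrow> \<bar>U p\<bar> \<le> M" "p \<in> lattice_nodes n \<Longrightarrow> \<bar>U' p\<bar> \<le> M" and M: "0 \<le> M"
    and equations: "p \<in> lattice_interior n \<Longrightarrow> lap \<gamma> u p = f p (u p)"
      "p \<in> lattice_interior n \<Longrightarrow> lap \<gamma>' u' p = f p (u' p)"
      "p \<in> lattice_interior n \<Longrightarrow> lap \<gamma> U p = f p (U p)"
      "p \<in> lattice_interior n \<Longrightarrow> lap \<gamma>' U' p = f p (U' p)"
    and cauchy: "same_cauchy n \<gamma> \<gamma>' u u'" "same_cauchy n \<gamma> \<gamma>' U U'"
    and t: "0 < t"
    and perturbed: "p \<in> lattice_boundary n \<Longrightarrow> U p = u p + t * v p"
    and v: "p \<in> lattice_boundary n \<Longrightarrow> \<bar>v p\<bar> \<le> 1"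
begin

definition "w p = (U p - u p) / t"
definition "w' p = (U' p - u' p) / t"

abbreviation "G \<equiv> green_bound n a A"

lemma U_eq: "U p = u p + t * w p" "U' p = u' p + t * w' p"
  using t by (simp_all add: w_def w'_def)

lemma G_nonneg: "0 \<le> G"
  using uniformly_ellipticD(1,2)[OF ell] by (rule green_bound_nonneg)

lemma lap_w: "p \<in> lattice_interior n \<Longrightarrow> t * lap \<gamma> w p = f p (u p + t * w p) - f p (u p)"
  "p \<in> lattice_interior n \<Longrightarrow> t * lap \<gamma>' w' p = f p (u' p + t * w' p) - f p (u' p)"
proof -
  have "t * lap g (\<lambda>p. (V p - y p) / t) p = lap g V p - lap g y p" for g V y p
    unfolding divide_inverse mult.commute[of _ "inverse t"] lap_cmult lap_diff using t by simp
  from this[of \<gamma> U u] this[of \<gamma>' U' u']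
  show "p \<in> lattice_interior n \<Longrightarrow> t * lap \<gamma> w p = f p (u p + t * w p) - f p (u p)"
    "p \<in> lattice_interior n \<Longrightarrow> t * lap \<gamma>' w' p = f p (u' p + t * w' p) - f p (u' p)"
    unfolding U_eq[symmetric] using equations by (simp_all add: w_def[abs_def] w'_def[abs_def])
qed

lemma w_boundary: "p \<in> lattice_boundary n \<Longrightarrow> w p = v p" "p \<in> lattice_boundary n \<Longrightarrow> w' p = v p"
proof -
  assume p: "p \<in> lattice_boundary n"
  then have "U' p - u' p = U p - u p" using cauchy by (simp add: same_cauchy_def)
  then show "w p = v p" "w' p = v p" using t perturbed[OF p] by (simp_all add: w_def w'_def)
qed

lemma w_cauchy: "same_cauchy n \<gamma> \<gamma>' w w'"
  unfolding same_cauchy_def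
proof (intro ballI conjI impI)
  fix p assume p: "p \<in> lattice_boundary n"
  then show "w p = w' p" by (simp add: w_boundary)
  fix x assume x: "x \<in> lattice_interior n" "{p, x} \<in> lattice_edges n"
  have "\<gamma> {p, x} * (U p - U x) = \<gamma>' {p, x} * (U' p - U' x)"
    "\<gamma> {p, x} * (u p - u x) = \<gamma>' {p, x} * (u' p - u' x)"
    using cauchy p x by (auto simp: same_cauchy_def)
  then have "\<gamma> {p, x} * (U p - U x) - \<gamma> {p, x} * (u p - u x) =
      \<gamma>' {p, x} * (U' p - U' x) - \<gamma>' {p, x} * (u' p - u' x)" by simp
  moreover have "g * (U p - U x) - g * (u p - u x) = t * (g * (w p - w x))"
    "g * (U' p - U' x) - g * (u' p - u' x) = t * (g * (w' p - w' x))" for g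
    using t unfolding w_def w'_def by (simp_all add: field_simps)
  ultimately have "t * (\<gamma> {p, x} * (w p - w x)) = t * (\<gamma>' {p, x} * (w' p - w' x))"
    by (simp only:)
  then show "\<gamma> {p, x} * (w p - w x) = \<gamma>' {p, x} * (w' p - w' x)" using t by simp
qed

text \<open>The mixed value \<open>u p + t * w' p = u p + U' p - u' p\<close> is the reason for the
  radius \<open>3 * M\<close>.\<close>

lemma in_range:
  assumes "p \<in> lattice_nodes n"
  shows "\<bar>u p\<bar> \<le> 3 * M" "\<bar>u' p\<bar> \<le> 3 * M" "\<bar>u p + t * w p\<bar> \<le> 3 * M" "\<bar>u' p + t * w' p\<bar> \<le> 3 * M"
    "\<bar>u p + t * w' p\<bar> \<le> 3 * M"
proof -
  have "u p + t * w' p = u p + (U' p - u' p)" by (simp add: U_eq)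
  then show "\<bar>u p + t * w' p\<bar> \<le> 3 * M" using bounds[OF assms] by linarith
  show "\<bar>u p\<bar> \<le> 3 * M" "\<bar>u' p\<bar> \<le> 3 * M" "\<bar>u p + t * w p\<bar> \<le> 3 * M" "\<bar>u' p + t * w' p\<bar> \<le> 3 * M"
    unfolding U_eq[symmetric] using bounds[OF assms] M by linarith+
qed

text \<open>A difference quotient solves a homogeneous linear equation with a nonnegative
  coefficient, so it is bounded by its boundary values \<open>v\<close>.\<close>

lemma w_bound: assumes "p \<in> lattice_nodes n" shows "\<bar>w p\<bar> \<le> 1" "\<bar>w' p\<bar> \<le> 1"
proof -
  have "\<exists>c\<ge>0. \<bar>lap \<gamma> w p - c * w p\<bar> \<le> 0" "\<exists>c\<ge>0. \<bar>lap \<gamma>' w' p - c * w' p\<bar> \<le> 0"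
    if p: "p \<in> lattice_interior n" for p
  proof -
    have node: "p \<in> lattice_nodes n" using p by (simp add: nodes_iff)
    obtain c where c: "c \<ge> 0" "f p (u p + t * w p) - f p (u p) = c * (u p + t * w p - u p)"
      using C3_difference_quotient[OF f[OF p] in_range(3,1)[OF node] f'_nonneg[OF p]] by blast
    have "t * lap \<gamma> w p = t * (c * w p)" unfolding lap_w(1)[OF p] c(2) by simp
    then show "\<exists>c\<ge>0. \<bar>lap \<gamma> w p - c * w p\<bar> \<le> 0" using t c(1) by (intro exI[of _ c]) simp
    obtain c' where c': "c' \<ge> 0" "f p (u' p + t * w' p) - f p (u' p) = c' * (u' p + t * w' p - u' p)"
      using C3_difference_quotient[OF f[OF p] in_range(4,2)[OF node] f'_nonneg[OF p]] by blast
    have "t * lap \<gamma>' w' p = t * (c' * w' p)" unfolding lap_w(2)[OF p] c'(2) by simp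
    then show "\<exists>c\<ge>0. \<bar>lap \<gamma>' w' p - c * w' p\<bar> \<le> 0" using t c'(1) by (intro exI[of _ c']) simp
  qed
  from stability_bound[OF ell order_refl zero_le_one this(1) _ assms]
    stability_bound[OF ell' order_refl zero_le_one this(2) _ assms]
  show "\<bar>w p\<bar> \<le> 1" "\<bar>w' p\<bar> \<le> 1" using v by (simp_all add: w_boundary)
qed

lemma u_difference:
  assumes "p \<in> lattice_interior n"
  shows "\<exists>c\<ge>0. c \<le> L \<and> lap \<gamma> u p - lap \<gamma>' u' p = c * (u p - u' p)"
proof -
  have node: "p \<in> lattice_nodes n" using assms by (simp add: nodes_iff)
  show ?thesis
    unfolding equations(1,2)[OF assms]
    by (rule C3_difference_quotient[OF f[OF assms] in_range(1,2)[OF node] f'_nonneg[OF assms]])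
qed

text \<open>The difference vanishes on the boundary and solves an equation for
  \<open>\<gamma>'\<close> whose source is \<open>lap\<close> of \<open>u\<close> with the contrast
  as conductivity.\<close>

lemma u_stability:
  assumes "p \<in> lattice_nodes n"
  shows "\<bar>u p - u' p\<bar> \<le> 8 * G * M * \<delta>"
proof -
  have "\<bar>u p - u' p\<bar> \<le> 0 + G * (8 * \<delta> * M)"
  proof (rule stability_bound[OF ell' _ order_refl _ _ assms])
    show "0 \<le> 8 * \<delta> * M" using \<delta> M by simp
    fix p assume p: "p \<in> lattice_interior n"
    obtain c where c: "c \<ge> 0" "lap \<gamma> u p - lap \<gamma>' u' p = c * (u p - u' p)"
      using u_difference[OF p] by blast
    have "lap \<gamma>' (\<lambda>p. u p - u' p) p - c * (u p - u' p) = - lap (\<lambda>e. \<gamma> e - \<gamma>' e) u p"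
      unfolding c(2)[symmetric] lap_diff lap_conductivity_diff by simp
    moreover have "\<bar>lap (\<lambda>e. \<gamma> e - \<gamma>' e) u p\<bar> \<le> 8 * \<delta> * M"
      by (rule lap_abs_le[OF p contrast bounds(1)])
    ultimately show "\<exists>c\<ge>0. \<bar>lap \<gamma>' (\<lambda>p. u p - u' p) p - c * (u p - u' p)\<bar> \<le> 8 * \<delta> * M"
      using c(1) by auto
  next
    fix p assume "p \<in> lattice_boundary n"
    then show "\<bar>u p - u' p\<bar> \<le> 0" using cauchy(1) by (simp add: same_cauchy_def)
  qed
  then show ?thesis by (simp add: mult_ac)
qed

text \<open>The intermediate value \<open>u + t * w'\<close> separates a change of the increment,
  which gives the coefficient \<open>c\<close>, from a change of the base point, which gives the
  source \<open>E / t\<close>. The factor \<open>t\<close> in the bound for \<open>E\<close> cancels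
  the division.\<close>

lemma w_stability:
  assumes "p \<in> lattice_nodes n"
  shows "\<bar>w p - w' p\<bar> \<le> G * (L * (8 * G * M) + 8) * \<delta>"
proof -
  let ?R = "L * (8 * G * M * \<delta>) + 8 * \<delta> * 1"
  have "\<bar>w p - w' p\<bar> \<le> 0 + G * ?R"
  proof (rule stability_bound[OF ell' _ order_refl _ _ assms])
    show "0 \<le> ?R" using \<delta> M L G_nonneg by simp
    fix p assume p: "p \<in> lattice_interior n"
    have node: "p \<in> lattice_nodes n" using p by (simp add: nodes_iff)
    obtain c where c: "c \<ge> 0" "f p (u p + t * w p) - f p (u p + t * w' p) = c * (u p + t * w p - (u p + t * w' p))"
      using C3_difference_quotient[OF f[OF p] in_range(3,5)[OF node] f'_nonneg[OF p]] by blast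
    define E where "E = (f p (u p + t * w' p) - f p (u p)) - (f p (u' p + t * w' p) - f p (u' p))"
    have "\<bar>E\<bar> \<le> L * \<bar>t * w' p\<bar> * \<bar>u p - u' p\<bar>"
      unfolding E_def by (rule C3_increment_difference[OF f[OF p] in_range(1,5,2,4)[OF node]])
    also have "\<dots> \<le> L * t * (8 * G * M * \<delta>)"
      using u_stability[OF node] w_bound(2)[OF node] t L
      by (intro mult_mono) (auto simp: abs_mult mult_left_le)
    finally have E: "\<bar>E\<bar> \<le> t * (L * (8 * G * M * \<delta>))" by (simp add: mult_ac)
    have "t * (lap \<gamma>' (\<lambda>p. w p - w' p) p - c * (w p - w' p)) = E - t * lap (\<lambda>e. \<gamma> e - \<gamma>' e) w p"
      using c(2) lap_w[OF p] unfolding lap_diff lap_conductivity_diff E_def by (simp add: algebra_simps)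
    then have "lap \<gamma>' (\<lambda>p. w p - w' p) p - c * (w p - w' p) = E / t - lap (\<lambda>e. \<gamma> e - \<gamma>' e) w p"
      using t by (simp add: field_simps)
    moreover have "\<bar>E / t\<bar> \<le> L * (8 * G * M * \<delta>)" using E t by (simp add: field_simps)
    moreover have "\<bar>lap (\<lambda>e. \<gamma> e - \<gamma>' e) w p\<bar> \<le> 8 * \<delta> * 1"
      by (rule lap_abs_le[OF p contrast w_bound(1)])
    ultimately have "\<bar>lap \<gamma>' (\<lambda>p. w p - w' p) p - c * (w p - w' p)\<bar> \<le> ?R" by linarith
    then show "\<exists>c\<ge>0. \<bar>lap \<gamma>' (\<lambda>p. w p - w' p) p - c * (w p - w' p)\<bar> \<le> ?R"
      using c(1) by blast
  qed (simp add: w_boundary)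
  then show ?thesis by (simp add: algebra_simps)
qed

lemma residual:
  assumes p: "p \<in> lattice_interior n"
  shows "\<bar>lap \<gamma> w p - f' p (u p) * w p\<bar> \<le> L * t"
proof -
  have node: "p \<in> lattice_nodes n" using p by (simp add: nodes_iff)
  have R: "\<bar>(f p (u p + t * w p) - f p (u p) - f' p (u p) * (t * w p)) - (f p (u p + 0) - f p (u p) - f' p (u p) * 0)\<bar>
      \<le> L * (\<bar>t * w p\<bar> + \<bar>0\<bar>) * \<bar>t * w p - 0\<bar>"
    using in_range[OF node] by (intro C3_remainder_increment[OF f[OF p]]) auto
  have eq: "f p (u p + t * w p) - f p (u p) - f' p (u p) * (t * w p) = t * (lap \<gamma> w p - f' p (u p) * w p)"
    unfolding lap_w(1)[OF p, symmetric] by (simp add: algebra_simps)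
  have le: "L * (\<bar>t * w p\<bar> + \<bar>0\<bar>) * \<bar>t * w p - 0\<bar> \<le> L * t * t"
    using w_bound(1)[OF node] t L by (intro mult_mono) (auto simp: abs_mult mult_left_le)
  have "\<bar>t * (lap \<gamma> w p - f' p (u p) * w p)\<bar> \<le> L * t * t"
    using order_trans[OF R le] unfolding eq by (simp only: add_0_right diff_self mult_zero_right diff_zero)
  then have "t * \<bar>lap \<gamma> w p - f' p (u p) * w p\<bar> \<le> t * (L * t)"
    unfolding abs_mult using t by (simp only: abs_of_pos mult_ac)
  then show ?thesis using t by simp
qed

text \<open>Multiplied by \<open>t\<close>, the residuals are Taylor remainders. Passing from
  \<open>(u, t w)\<close> through \<open>(u, t w')\<close> to \<open>(u', t w')\<close> changes them
  by \<open>O(t\<^sup>2 \<delta>)\<close> each time, so after division a factor \<open>t\<close> is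
  left besides \<open>\<delta>\<close>.\<close>

lemma residual_difference:
  assumes p: "p \<in> lattice_interior n"
  shows "\<bar>(lap \<gamma> w p - f' p (u p) * w p) - (lap \<gamma>' w' p - f' p (u' p) * w' p)\<bar>
    \<le> L * (2 * (G * (L * (8 * G * M) + 8)) + 8 * G * M) * (t * \<delta>)"
proof -
  have node: "p \<in> lattice_nodes n" using p by (simp add: nodes_iff)
  define R where "R x y = f p (x + y) - f p x - f' p x * y" for x y
  let ?C = "G * (L * (8 * G * M) + 8)"
  have tw: "\<bar>t * w p\<bar> \<le> t" "\<bar>t * w' p\<bar> \<le> t"
    using w_bound[OF node] t by (simp_all add: abs_mult mult_left_le)
  have "\<bar>R (u p) (t * w p) - R (u p) (t * w' p)\<bar> \<le> L * (\<bar>t * w p\<bar> + \<bar>t * w' p\<bar>) * \<bar>t * w p - t * w' p\<bar>"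
    unfolding R_def by (rule C3_remainder_increment[OF f[OF p] in_range(1,3,5)[OF node]])
  also have "\<bar>t * w p - t * w' p\<bar> = t * \<bar>w p - w' p\<bar>"
    unfolding right_diff_distrib[symmetric] abs_mult using t by simp
  also have "L * (\<bar>t * w p\<bar> + \<bar>t * w' p\<bar>) * (t * \<bar>w p - w' p\<bar>) \<le> L * (t + t) * (t * (?C * \<delta>))"
    using tw w_stability[OF node] t L
    by (intro mult_mono mult_nonneg_nonneg add_mono order_refl) auto
  finally have 1: "\<bar>R (u p) (t * w p) - R (u p) (t * w' p)\<bar> \<le> L * (t + t) * (t * (?C * \<delta>))" .
  have "\<bar>R (u p) (t * w' p) - R (u' p) (t * w' p)\<bar> \<le> L * (t * w' p)\<^sup>2 * \<bar>u p - u' p\<bar>"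
    unfolding R_def by (rule C3_remainder_base[OF f[OF p] in_range(1,5,2,4)[OF node]])
  also have "\<dots> \<le> L * t\<^sup>2 * (8 * G * M * \<delta>)"
    using u_stability[OF node] tw(2) t L abs_le_square_iff[of "t * w' p" t]
    by (intro mult_mono mult_nonneg_nonneg order_refl) auto
  finally have 2: "\<bar>R (u p) (t * w' p) - R (u' p) (t * w' p)\<bar> \<le> L * t\<^sup>2 * (8 * G * M * \<delta>)" .
  have "t * ((lap \<gamma> w p - f' p (u p) * w p) - (lap \<gamma>' w' p - f' p (u' p) * w' p)) =
      R (u p) (t * w p) - R (u' p) (t * w' p)"
    unfolding R_def lap_w[OF p, symmetric] by (simp add: algebra_simps)
  then have "t * \<bar>(lap \<gamma> w p - f' p (u p) * w p) - (lap \<gamma>' w' p - f' p (u' p) * w' p)\<bar> =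
      \<bar>R (u p) (t * w p) - R (u' p) (t * w' p)\<bar>"
    using t by (metis abs_mult abs_of_pos)
  also have "\<dots> \<le> L * (t + t) * (t * (?C * \<delta>)) + L * t\<^sup>2 * (8 * G * M * \<delta>)"
    using 1 2 by linarith
  also have "\<dots> = t * (L * (2 * ?C + 8 * G * M) * (t * \<delta>))"
    by (simp add: power2_eq_square algebra_simps)
  finally show ?thesis using t by simp
qed

end

section \<open>Linearization along sequences of difference quotients\<close>

lemma bigoI_abs_le:
  fixes f g :: "nat \<Rightarrow> real"
  assumes "\<And>k. \<bar>f k\<bar> \<le> C * \<bar>g k\<bar>"
  shows "f \<in> O(g)"
  using assms by (intro bigoI[of _ C]) simp

text \<open>\<open>Q k\<close> is the inverse of the matrix of boundary vectors
  \<open>v k i\<close>. Its bound \<open>C\<close>, uniform in \<open>k\<close>, keeps the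
  combinations of difference quotients that interpolate a given \<open>W\<close> on the boundary
  bounded.\<close>

lemma perturbed_sequences:
  fixes t \<delta> :: "nat \<Rightarrow> real" and \<gamma> \<gamma>' :: "nat \<Rightarrow> node set \<Rightarrow> real" and u u' :: "nat \<Rightarrow> node \<Rightarrow> real"
    and U U' v :: "nat \<Rightarrow> nat \<Rightarrow> node \<Rightarrow> real" and Q :: "nat \<Rightarrow> nat \<Rightarrow> node \<Rightarrow> real"
  assumes pp: "\<And>k i. i < m \<Longrightarrow> perturbed_pair n a A M L (t k) (\<delta> k) f f' (\<gamma> k) (\<gamma>' k) (u k) (u' k) (U k i) (U' k i) (v k i)"
    and m: "0 < m" and t: "t \<longlonglongrightarrow> 0"
    and Q: "\<And>k i s. i < m \<Longrightarrow> s \<in> lattice_boundary n \<Longrightarrow> \<bar>Q k i s\<bar> \<le> C"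
    and dual: "\<And>k p s. p \<in> lattice_boundary n \<Longrightarrow> s \<in> lattice_boundary n \<Longrightarrow>
      (\<Sum>i<m. Q k i s * v k i p) = (if s = p then 1 else 0)"
  shows "conductivity_pair n a A \<gamma> \<gamma>' u u' (\<lambda>k p. f' p (u k p)) (\<lambda>k p. f' p (u' k p)) \<delta>"
proof -
  define G where "G = green_bound n a A"
  define q where "q k p = f' p (u k p)" for k p
  define q' where "q' k p = f' p (u' k p)" for k p
  define wi where "wi k i p = (U k i p - u k p) / t k" for k i p
  define wi' where "wi' k i p = (U' k i p - u' k p) / t k" for k i p
  define K where "K = L * (2 * (G * (L * (8 * G * M) + 8)) + 8 * G * M)"
  note pp0 = pp[OF m]
  have ell: "\<forall>k. uniformly_elliptic n a A (\<gamma> k)" "\<forall>k. uniformly_elliptic n a A (\<gamma>' k)"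
    using perturbed_pair.ell[OF pp0] perturbed_pair.ell'[OF pp0] by blast+
  have \<delta>: "0 \<le> \<delta> k" and t_pos: "0 < t k" and L: "0 \<le> L" and M: "0 \<le> M" for k
    using perturbed_pair.\<delta>[OF pp0] perturbed_pair.t[OF pp0] perturbed_pair.L[OF pp0] perturbed_pair.M[OF pp0] by blast+
  have range: "\<bar>u k p\<bar> \<le> 3 * M" "\<bar>u' k p\<bar> \<le> 3 * M" if "p \<in> lattice_nodes n" for k p
    using perturbed_pair.in_range(1,2)[OF pp0 that] by blast+
  have q_nonneg: "0 \<le> q k p" if "p \<in> lattice_interior n" for k p
    unfolding q_def by (rule perturbed_pair.f'_nonneg[OF pp0 that])
  have C3: "C3_bounded (f p) (f' p) (3 * M) L" if "p \<in> lattice_interior n" for p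
    using perturbed_pair.f[OF pp0 that] .
  have w_facts: "same_cauchy n (\<gamma> k) (\<gamma>' k) (wi k i) (wi' k i)"
    "p \<in> lattice_boundary n \<Longrightarrow> wi k i p = v k i p"
    "p \<in> lattice_interior n \<Longrightarrow> \<bar>lap (\<gamma> k) (wi k i) p - q k p * wi k i p\<bar> \<le> L * t k"
    "p \<in> lattice_interior n \<Longrightarrow> \<bar>(lap (\<gamma> k) (wi k i) p - q k p * wi k i p) -
        (lap (\<gamma>' k) (wi' k i) p - q' k p * wi' k i p)\<bar> \<le> K * (t k * \<delta> k)" if "i < m" for k i p
  proof -
    interpret r: perturbed_pair n a A M L "t k" "\<delta> k" f f' "\<gamma> k" "\<gamma>' k" "u k" "u' k" "U k i" "U' k i" "v k i"
      by (rule pp[OF that])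
    have eq: "r.w = wi k i" "r.w' = wi' k i"
      by (simp_all add: fun_eq_iff r.w_def r.w'_def wi_def wi'_def)
    show "same_cauchy n (\<gamma> k) (\<gamma>' k) (wi k i) (wi' k i)"
      "p \<in> lattice_boundary n \<Longrightarrow> wi k i p = v k i p"
      "p \<in> lattice_interior n \<Longrightarrow> \<bar>lap (\<gamma> k) (wi k i) p - q k p * wi k i p\<bar> \<le> L * t k"
      "p \<in> lattice_interior n \<Longrightarrow> \<bar>(lap (\<gamma> k) (wi k i) p - q k p * wi k i p) -
        (lap (\<gamma>' k) (wi' k i) p - q' k p * wi' k i p)\<bar> \<le> K * (t k * \<delta> k)"
      using r.w_cauchy r.w_boundary(1) r.residual r.residual_difference
      unfolding eq q_def q'_def K_def G_def by blast+
  qed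
  have t_small: "t \<in> o(\<lambda>_. 1)" using t by (intro smalloI_tendsto) auto
  show ?thesis
    unfolding q_def[symmetric, abs_def] q'_def[symmetric, abs_def]
  proof
    fix e assume e: "e \<in> lattice_edges n"
    show "(\<lambda>k. \<gamma> k e - \<gamma>' k e) \<in> O(\<delta>)"
      using perturbed_pair.contrast[OF pp0 e] \<delta> by (intro bigoI_abs_le[of _ 1]) simp
  next
    fix p assume "p \<in> lattice_nodes n"
    then show "(\<lambda>k. u k p) \<in> O(\<lambda>_. 1)" using range by (intro bigoI_abs_le[of _ "3 * M"]) simp
  next
    fix p assume p: "p \<in> lattice_interior n"
    have node: "p \<in> lattice_nodes n" using p by (simp add: nodes_iff)
    have "\<bar>f' p x\<bar> \<le> L" if "\<bar>x\<bar> \<le> 3 * M" for x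
      using C3[OF p] that unfolding C3_bounded_def by blast
    then show "(\<lambda>k. q k p) \<in> O(\<lambda>_. 1)" "(\<lambda>k. q' k p) \<in> O(\<lambda>_. 1)"
      using range[OF node] unfolding q_def q'_def by (intro bigoI_abs_le[of _ L]; simp)+
    show "(\<lambda>k. u k p - u' k p) \<in> O(\<delta>)"
      using perturbed_pair.u_stability[OF pp0 node] \<delta> by (intro bigoI_abs_le[of _ "8 * G * M"]) (simp add: G_def)
    show "(\<lambda>k. q k p - q' k p) \<in> O(\<lambda>k. u k p - u' k p)"
      unfolding q_def q'_def using C3_lipschitz_deriv[OF C3[OF p] range[OF node]]
      by (intro bigoI_abs_le[of _ L])
    have "\<forall>k. \<exists>c\<ge>0. c \<le> L \<and> lap (\<gamma> k) (u k) p - lap (\<gamma>' k) (u' k) p = c * (u k p - u' k p)"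
      using perturbed_pair.u_difference[OF pp0 p] by blast
    then obtain c where c: "\<And>k. 0 \<le> c k" "\<And>k. c k \<le> L"
      "\<And>k. lap (\<gamma> k) (u k) p - lap (\<gamma>' k) (u' k) p = c k * (u k p - u' k p)" by metis
    have "c \<in> O(\<lambda>_. 1)" using c(1,2) by (intro bigoI_abs_le[of _ L]) simp
    then show "\<exists>c. c \<in> O(\<lambda>_. 1) \<and>
        (\<forall>k. lap (\<gamma> k) (u k) p - lap (\<gamma>' k) (u' k) p = c k * (u k p - u' k p))"
      using c(3) by blast
  next
    fix k
    show "same_cauchy n (\<gamma> k) (\<gamma>' k) (u k) (u' k)" by (rule perturbed_pair.cauchy(1)[OF pp0])
  next
    fix W :: "nat \<Rightarrow> node \<Rightarrow> real"
    assume W: "\<forall>p\<in>lattice_nodes n. (\<lambda>k. W k p) \<in> O(\<lambda>_. 1)"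
      and eq: "\<forall>k. \<forall>p\<in>lattice_interior n. lap (\<gamma> k) (W k) p = q k p * W k p"
    \<comment> \<open>The coordinates of the boundary values of \<open>W\<close> in the basis
      \<open>v k i\<close>.\<close>
    define \<alpha> where "\<alpha> k i = (\<Sum>s\<in>lattice_boundary n. Q k i s * W k s)" for k i
    define w where "w k p = (\<Sum>i<m. \<alpha> k i * wi k i p)" for k p
    define w' where "w' k p = (\<Sum>i<m. \<alpha> k i * wi' k i p)" for k p
    have \<alpha>_bounded: "(\<lambda>k. \<alpha> k i) \<in> O(\<lambda>_. 1)" if "i < m" for i
      unfolding \<alpha>_def
    proof (intro big_sum_in_bigo bounded_mult)
      fix s assume s: "s \<in> lattice_boundary n"
      show "(\<lambda>k. Q k i s) \<in> O(\<lambda>_. 1)" using Q[OF that s] by (intro bigoI_abs_le[of _ C]) simp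
      show "(\<lambda>k. W k s) \<in> O(\<lambda>_. 1)" using W s by (simp add: nodes_iff)
    qed
    have lap_w: "lap (\<gamma> k) (w k) p - q k p * w k p = (\<Sum>i<m. \<alpha> k i * (lap (\<gamma> k) (wi k i) p - q k p * wi k i p))"
      "lap (\<gamma>' k) (w' k) p - q' k p * w' k p = (\<Sum>i<m. \<alpha> k i * (lap (\<gamma>' k) (wi' k i) p - q' k p * wi' k i p))" for k p
      unfolding w_def[abs_def] w'_def[abs_def] lap_sum
      by (simp_all add: sum_distrib_left sum_subtractf algebra_simps)
    have w_boundary: "w k p = W k p" if p: "p \<in> lattice_boundary n" for k p
    proof -
      have "w k p = (\<Sum>i<m. \<Sum>s\<in>lattice_boundary n. W k s * (Q k i s * v k i p))"
        unfolding w_def \<alpha>_def using w_facts(2)[OF _ p]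
        by (intro sum.cong refl) (simp add: sum_distrib_left sum_distrib_right mult_ac)
      also have "\<dots> = (\<Sum>s\<in>lattice_boundary n. W k s * (\<Sum>i<m. Q k i s * v k i p))"
        by (subst sum.swap) (simp add: sum_distrib_left)
      also have "\<dots> = (\<Sum>s\<in>lattice_boundary n. if s = p then W k s else 0)"
        using dual[OF p] by (intro sum.cong) auto
      finally show ?thesis using p finite_boundary by simp
    qed
    have cauchy_w: "same_cauchy n (\<gamma> k) (\<gamma>' k) (w k) (w' k)" for k
      unfolding same_cauchy_def
    proof (intro ballI conjI impI)
      fix p assume p: "p \<in> lattice_boundary n"
      show "w k p = w' k p" unfolding w_def w'_def
        using w_facts(1) p by (intro sum.cong) (auto simp: same_cauchy_def)
      fix x assume x: "x \<in> lattice_interior n" "{p, x} \<in> lattice_edges n"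
      have *: "g * ((\<Sum>i<m. \<alpha> k i * y i p) - (\<Sum>i<m. \<alpha> k i * y i x)) = (\<Sum>i<m. \<alpha> k i * (g * (y i p - y i x)))" for g y
        by (simp add: sum_distrib_left sum_subtractf[symmetric] algebra_simps)
      show "\<gamma> k {p, x} * (w k p - w k x) = \<gamma>' k {p, x} * (w' k p - w' k x)"
        unfolding w_def w'_def *
      proof (intro sum.cong refl)
        fix i assume "i \<in> {..<m}"
        then have "same_cauchy n (\<gamma> k) (\<gamma>' k) (wi k i) (wi' k i)" by (simp add: w_facts(1))
        then have "\<gamma> k {p, x} * (wi k i p - wi k i x) = \<gamma>' k {p, x} * (wi' k i p - wi' k i x)"
          unfolding same_cauchy_def using p x by blast
        then show "\<alpha> k i * (\<gamma> k {p, x} * (wi k i p - wi k i x)) = \<alpha> k i * (\<gamma>' k {p, x} * (wi' k i p - wi' k i x))"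
          by (simp only:)
      qed
    qed
    \<comment> \<open>\<open>w - W\<close> vanishes on the boundary, and as \<open>W\<close> solves
      the linearized equation exactly, its residual is that of \<open>w\<close>, of size
      \<open>O(t k)\<close>.\<close>
    have close: "\<bar>w k p - W k p\<bar> \<le> G * ((\<Sum>i<m. \<bar>\<alpha> k i\<bar>) * (L * t k))" if p: "p \<in> lattice_nodes n" for k p
    proof -
      have "\<bar>w k p - W k p\<bar> \<le> 0 + G * ((\<Sum>i<m. \<bar>\<alpha> k i\<bar>) * (L * t k))"
        unfolding G_def
      proof (rule stability_bound[OF spec[OF ell(1)] _ order_refl _ _ p])
        show "0 \<le> (\<Sum>i<m. \<bar>\<alpha> k i\<bar>) * (L * t k)" using L t_pos[of k] by (simp add: sum_nonneg)
        fix p assume p: "p \<in> lattice_interior n"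
        have "lap (\<gamma> k) (\<lambda>p. w k p - W k p) p - q k p * (w k p - W k p) = lap (\<gamma> k) (w k) p - q k p * w k p"
          using eq p unfolding lap_diff by (simp add: algebra_simps)
        also have "\<bar>\<dots>\<bar> \<le> (\<Sum>i<m. \<bar>\<alpha> k i * (lap (\<gamma> k) (wi k i) p - q k p * wi k i p)\<bar>)"
          unfolding lap_w(1) by (rule sum_abs)
        also have "\<dots> \<le> (\<Sum>i<m. \<bar>\<alpha> k i\<bar> * (L * t k))"
          using w_facts(3)[OF _ p] by (intro sum_mono) (auto simp: abs_mult intro!: mult_left_mono)
        finally show "\<exists>c\<ge>0. \<bar>lap (\<gamma> k) (\<lambda>p. w k p - W k p) p - c * (w k p - W k p)\<bar>
            \<le> (\<Sum>i<m. \<bar>\<alpha> k i\<bar>) * (L * t k)"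
          using q_nonneg[OF p] unfolding sum_distrib_right by blast
      qed (simp add: w_boundary)
      then show ?thesis by simp
    qed
    show "\<exists>w w'. (\<forall>k. same_cauchy n (\<gamma> k) (\<gamma>' k) (w k) (w' k)) \<and>
        (\<forall>p\<in>lattice_nodes n. (\<lambda>k. w k p - W k p) \<in> o(\<lambda>_. 1)) \<and>
        (\<forall>p\<in>lattice_interior n. (\<lambda>k. (lap (\<gamma> k) (w k) p - q k p * w k p) -
            (lap (\<gamma>' k) (w' k) p - q' k p * w' k p)) \<in> o(\<delta>))"
    proof (intro exI conjI allI ballI)
      show "same_cauchy n (\<gamma> k) (\<gamma>' k) (w k) (w' k)" for k by (rule cauchy_w)
    next
      fix p assume p: "p \<in> lattice_nodes n"
      have "(\<lambda>k. w k p - W k p) \<in> O(\<lambda>k. G * ((\<Sum>i<m. \<bar>\<alpha> k i\<bar>) * (L * t k)))"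
        using order_trans[OF close[OF p] abs_ge_self] by (intro bigoI_abs_le[of _ 1]) simp
      also have "(\<lambda>k. G * ((\<Sum>i<m. \<bar>\<alpha> k i\<bar>) * (L * t k))) \<in> o(\<lambda>_. 1)"
        using t_small \<alpha>_bounded
        by (intro smallo_mult_bounded(2) big_sum_in_bigo) (auto intro!: big_sum_in_bigo)
      finally show "(\<lambda>k. w k p - W k p) \<in> o(\<lambda>_. 1)" .
    next
      fix p assume p: "p \<in> lattice_interior n"
      have "(\<lambda>k. (lap (\<gamma> k) (wi k i) p - q k p * wi k i p) - (lap (\<gamma>' k) (wi' k i) p - q' k p * wi' k i p)) \<in> o(\<delta>)"
        if i: "i < m" for i
      proof -
        have "(\<lambda>k. (lap (\<gamma> k) (wi k i) p - q k p * wi k i p) - (lap (\<gamma>' k) (wi' k i) p - q' k p * wi' k i p))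
            \<in> O(\<lambda>k. t k * \<delta> k)"
          using w_facts(4)[OF i p] \<delta> less_imp_le[OF t_pos] by (intro bigoI_abs_le[of _ K]) (simp add: abs_mult)
        also have "(\<lambda>k. t k * \<delta> k) \<in> o(\<lambda>k. 1 * \<delta> k)"
          by (rule landau_o.small_big_mult[OF t_small]) simp
        finally show ?thesis by simp
      qed
      then have "(\<lambda>k. \<Sum>i<m. \<alpha> k i * ((lap (\<gamma> k) (wi k i) p - q k p * wi k i p) -
          (lap (\<gamma>' k) (wi' k i) p - q' k p * wi' k i p))) \<in> o(\<delta>)"
        using \<alpha>_bounded by (intro big_sum_in_smallo smallo_mult_bounded(2)) auto
      then show "(\<lambda>k. (lap (\<gamma> k) (w k) p - q k p * w k p) - (lap (\<gamma>' k) (w' k) p - q' k p * w' k p)) \<in> o(\<delta>)"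
        unfolding lap_w by (simp only: right_diff_distrib[of "\<alpha> _ _"] sum_subtractf)
    qed
  qed (rule ell)+
qed

section \<open>Compactness and uniform invertibility\<close>

text \<open>Leibniz formula: \<open>k!\<close> terms, each of absolute value at most 1.\<close>

lemma abs_det_le_fact:
  fixes A :: "real mat"
  assumes A: "A \<in> carrier_mat k k" and le: "\<And>i j. i < k \<Longrightarrow> j < k \<Longrightarrow> \<bar>A $$ (i, j)\<bar> \<le> 1"
  shows "\<bar>det A\<bar> \<le> fact k"
proof -
  have "\<bar>det A\<bar> \<le> (\<Sum>p | p permutes {0..<k}. \<bar>signof p * (\<Prod>i = 0..<k. A $$ (i, p i))\<bar>)"
    unfolding det_def'[OF A] by (rule sum_abs)
  also have "\<dots> \<le> (\<Sum>p | p permutes {0..<k}. 1)"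
  proof (rule sum_mono)
    fix p assume "p \<in> {p. p permutes {0..<k}}"
    then have p: "p permutes {0..<k}" by simp
    have "\<bar>\<Prod>i = 0..<k. A $$ (i, p i)\<bar> \<le> (\<Prod>i = 0..<k. 1)"
      unfolding abs_prod
    proof (rule prod_mono)
      fix i assume "i \<in> {0..<k}"
      then have "p i < k" using permutes_in_image[OF p, of i] by simp
      then show "0 \<le> \<bar>A $$ (i, p i)\<bar> \<and> \<bar>A $$ (i, p i)\<bar> \<le> 1" using le \<open>i \<in> {0..<k}\<close> by simp
    qed
    then show "\<bar>signof p * (\<Prod>i = 0..<k. A $$ (i, p i))\<bar> \<le> 1"
      by (simp add: abs_mult sign_def)
  qed
  also have "\<dots> = fact k" by (simp add: card_permutations[of _ k])
  finally show ?thesis .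
qed

text \<open>\<open>Q\<close> is the inverse as adjugate over determinant. Entries of unit columns
  are at most 1 in absolute value, hence so bounded are the cofactors by a factorial, and
  \<open>\<epsilon>\<close> bounds the denominator from below.\<close>

lemma unit_column_dual:
  assumes P: "P \<in> unit_column_matrices m \<epsilon>" and \<epsilon>: "0 < \<epsilon>"
  shows "\<exists>Q. (\<forall>i<m. \<forall>s<m. \<bar>Q i s\<bar> \<le> fact m / \<epsilon>) \<and>
    (\<forall>r<m. \<forall>s<m. (\<Sum>i<m. Q i s * P $$ (r, i)) = (if s = r then 1 else 0))"
proof -
  have carrier: "P \<in> carrier_mat m m" and det: "\<epsilon> \<le> \<bar>det P\<bar>"
    and norm: "\<And>i. i < m \<Longrightarrow> L2_set (\<lambda>j. col P i $ j) {..<m} = 1"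
    using P by (auto simp: unit_column_matrices_def)
  have entry: "\<bar>P $$ (r, i)\<bar> \<le> 1" if "r < m" "i < m" for r i
  proof -
    have "\<bar>col P i $ r\<bar> \<le> L2_set (\<lambda>j. \<bar>col P i $ j\<bar>) {..<m}"
      using that by (intro member_le_L2_set) auto
    also have "\<dots> = 1" using norm[OF that(2)] by (simp add: L2_set_def)
    finally show ?thesis using that carrier by simp
  qed
  let ?Q = "\<lambda>i s. adj_mat P $$ (i, s) / det P"
  have bound: "\<bar>?Q i s\<bar> \<le> fact m / \<epsilon>" if "i < m" "s < m" for i s
  proof -
    have md: "mat_delete P s i \<in> carrier_mat (m - 1) (m - 1)" using carrier by (auto simp: mat_delete_def)
    have "\<bar>det (mat_delete P s i)\<bar> \<le> fact (m - 1)"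
    proof (rule abs_det_le_fact[OF md])
      show "\<bar>mat_delete P s i $$ (k, l)\<bar> \<le> 1" if "k < m - 1" "l < m - 1" for k l
        using carrier that by (auto simp: mat_delete_def intro!: entry)
    qed
    also have "\<dots> \<le> fact m" by (rule fact_mono) simp
    finally have "\<bar>adj_mat P $$ (i, s)\<bar> \<le> fact m"
      using that carrier by (simp add: adj_mat_def cofactor_def abs_mult power_abs)
    then show ?thesis
      using det \<epsilon> by (simp add: frac_le)
  qed
  have dual: "(\<Sum>i<m. ?Q i s * P $$ (r, i)) = (if s = r then 1 else 0)" if "r < m" "s < m" for r s
  proof -
    have "(P * adj_mat P) $$ (r, s) = (\<Sum>i<m. P $$ (r, i) * adj_mat P $$ (i, s))"
      using carrier adj_mat(1)[OF carrier] that
      by (auto simp: scalar_prod_def lessThan_atLeast0 intro!: sum.cong)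
    moreover have "(P * adj_mat P) $$ (r, s) = (if s = r then det P else 0)"
      unfolding adj_mat(2)[OF carrier] using that by auto
    ultimately have "(\<Sum>i<m. P $$ (r, i) * adj_mat P $$ (i, s)) / det P = (if s = r then 1 else 0)"
      using det \<epsilon> by auto
    then show ?thesis by (simp add: sum_divide_distrib mult.commute)
  qed
  show ?thesis by (intro exI[of _ ?Q] conjI allI impI bound dual)
qed

lemma compact_coordinate:
  assumes "compactin (fun_space S) K" "x \<in> S"
  shows "compact ((\<lambda>g. g x) ` K)"
  using image_compactin[OF assms(1) continuous_map_product_projection[OF assms(2)]]
  unfolding compactin_euclidean_iff .

lemma finite_uniform_bound:
  fixes g :: "'a \<Rightarrow> 'b \<Rightarrow> real"
  assumes "finite S" "\<And>x. x \<in> S \<Longrightarrow> \<exists>C. \<forall>k\<in>K. \<bar>g k x\<bar> \<le> C"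
  shows "\<exists>C\<ge>0. \<forall>x\<in>S. \<forall>k\<in>K. \<bar>g k x\<bar> \<le> C"
  using assms
proof (induction S rule: finite_induct)
  case empty
  then show ?case by auto
next
  case (insert y S)
  obtain C where "0 \<le> C" "\<forall>x\<in>S. \<forall>k\<in>K. \<bar>g k x\<bar> \<le> C" using insert by auto
  moreover obtain D where "\<forall>k\<in>K. \<bar>g k y\<bar> \<le> D" using insert.prems[of y] by auto
  ultimately show ?case by (intro exI[of _ "max C D"]) (auto simp: le_max_iff_disj)
qed

lemma compact_fun_space_bounded:
  assumes "finite S" "compactin (fun_space S) K"
  shows "\<exists>C\<ge>0. \<forall>x\<in>S. \<forall>g\<in>K. \<bar>g x\<bar> \<le> C"
proof (rule finite_uniform_bound[OF assms(1)])
  fix x assume "x \<in> S"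
  then obtain C where "\<forall>y\<in>(\<lambda>g. g x) ` K. norm y \<le> C"
    using compact_imp_bounded[OF compact_coordinate[OF assms(2)]] bounded_iff by blast
  then show "\<exists>C. \<forall>g\<in>K. \<bar>g x\<bar> \<le> C" by auto
qed

lemma compact_conductivities_elliptic:
  assumes sub: "K \<subseteq> conductivities n" and cpt: "compactin (fun_space (lattice_edges n)) K"
  shows "\<exists>a A. 0 < a \<and> a \<le> A \<and> (\<forall>\<gamma>\<in>K. uniformly_elliptic n a A \<gamma>)"
proof -
  obtain A where A: "0 \<le> A" "\<And>e \<gamma>. e \<in> lattice_edges n \<Longrightarrow> \<gamma> \<in> K \<Longrightarrow> \<bar>\<gamma> e\<bar> \<le> A"
    using compact_fun_space_bounded[OF finite_edges cpt] by blast
  have pos: "0 < \<gamma> e" if "e \<in> lattice_edges n" "\<gamma> \<in> K" for e \<gamma>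
    using sub that by (auto simp: conductivities_def PiE_def)
  have "\<exists>C\<ge>0. \<forall>e\<in>lattice_edges n. \<forall>\<gamma>\<in>K. \<bar>inverse (\<gamma> e)\<bar> \<le> C"
  proof (rule finite_uniform_bound[OF finite_edges])
    fix e assume e: "e \<in> lattice_edges n"
    have "continuous_on ((\<lambda>g. g e) ` K) (inverse :: real \<Rightarrow> real)"
      using pos[OF e] by (intro continuous_on_inverse continuous_on_id) force
    from compact_imp_bounded[OF compact_continuous_image[OF this compact_coordinate[OF cpt e]]]
    obtain C where "\<forall>y\<in>inverse ` (\<lambda>g. g e) ` K. norm y \<le> C" using bounded_iff by blast
    then show "\<exists>C. \<forall>\<gamma>\<in>K. \<bar>inverse (\<gamma> e)\<bar> \<le> C" by auto
  qed
  then obtain C where C: "0 \<le> C" "\<And>e \<gamma>. e \<in> lattice_edges n \<Longrightarrow> \<gamma> \<in> K \<Longrightarrow> \<bar>inverse (\<gamma> e)\<bar> \<le> C" by blast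
  \<comment> \<open>Adding 1 keeps \<open>a\<close> positive when \<open>C = 0\<close>;
    \<open>max a A\<close> below ensures \<open>a \<le> A\<close> even when \<open>K\<close> is
    empty.\<close>
  define a where "a = inverse (C + 1)"
  have a: "0 < a" using C(1) by (simp add: a_def)
  have "uniformly_elliptic n a (max a A) \<gamma>" if \<gamma>: "\<gamma> \<in> K" for \<gamma>
    unfolding uniformly_elliptic_def
  proof (intro conjI ballI a)
    fix e assume e: "e \<in> lattice_edges n"
    have "inverse (\<gamma> e) \<le> C + 1" using abs_le_D1[OF C(2)[OF e \<gamma>]] by linarith
    then have "inverse (C + 1) \<le> inverse (inverse (\<gamma> e))"
      using pos[OF e \<gamma>] by (intro le_imp_inverse_le) auto
    then show "a \<le> \<gamma> e" by (simp add: a_def)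
    show "\<gamma> e \<le> max a A" using A(2)[OF e \<gamma>] by simp
  qed simp
  then show ?thesis using a by (intro exI[of _ a] exI[of _ "max a A"]) auto
qed

section \<open>Solutions, their bounds and their Cauchy data\<close>

lemma the_solution_dirichlet:
  assumes ell: "uniformly_elliptic n a A \<gamma>"
    and f: "\<And>p x. p \<in> lattice_interior n \<Longrightarrow> (f p has_real_derivative f' p x) (at x)"
    and f': "\<And>p x. p \<in> lattice_interior n \<Longrightarrow> 0 \<le> f' p x"
  shows "dirichlet_solution n f \<gamma> \<phi> (the_solution n f \<gamma> \<phi>)"
proof -
  have cont: "continuous_on UNIV (f p)" if "p \<in> lattice_interior n" for p
    by (rule DERIV_continuous_on) (rule has_field_derivative_at_within[OF f[OF that]])
  have mono: "mono (f p)" if "p \<in> lattice_interior n" for p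
  proof (rule monoI)
    fix x y :: real assume "x \<le> y"
    then show "f p x \<le> f p y"
    proof (rule DERIV_nonneg_imp_nondecreasing)
      show "\<exists>d. (f p has_real_derivative d) (at z) \<and> 0 \<le> d" for z
        using f[OF that] f'[OF that] by blast
    qed
  qed
  have "\<exists>u. dirichlet_solution n f \<gamma> \<phi> u"
    by (rule dirichlet_solution_exists[OF ell]; rule cont mono)
  then obtain u where u: "dirichlet_solution n f \<gamma> \<phi> u" by (elim exE)
  have "w = u" if "dirichlet_solution n f \<gamma> \<phi> w" for w
    by (rule dirichlet_solution_unique[OF ell _ that u]) (rule mono)
  with u show ?thesis unfolding the_solution_def by (rule theI)
qed

text \<open>By the mean value theorem \<open>f p (u p)\<close> is \<open>f p 0\<close> plus a
  nonnegative multiple of \<open>u p\<close>, so \<open>f p 0\<close> acts as a source.\<close>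

lemma dirichlet_solution_bound:
  assumes ell: "uniformly_elliptic n a A \<gamma>"
    and f: "\<And>p x. p \<in> lattice_interior n \<Longrightarrow> (f p has_real_derivative f' p x) (at x)"
    and f': "\<And>p x. p \<in> lattice_interior n \<Longrightarrow> 0 \<le> f' p x"
    and R: "0 \<le> R" "\<And>p. p \<in> lattice_interior n \<Longrightarrow> \<bar>f p 0\<bar> \<le> R"
    and B: "0 \<le> B" "\<And>p. p \<in> lattice_boundary n \<Longrightarrow> \<bar>\<phi> p\<bar> \<le> B"
    and u: "dirichlet_solution n f \<gamma> \<phi> u" and p: "p \<in> lattice_nodes n"
  shows "\<bar>u p\<bar> \<le> B + green_bound n a A * R"
proof (rule stability_bound[OF ell R(1) B(1) _ _ p])
  fix p assume p: "p \<in> lattice_interior n"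
  obtain \<xi> where "f p (u p) - f p 0 = f' p \<xi> * (u p - 0)"
    using mvt_abs[OF f[OF p]] by blast
  then have "lap \<gamma> u p - f' p \<xi> * u p = f p 0"
    using u p by (simp add: dirichlet_solution_iff)
  then show "\<exists>c\<ge>0. \<bar>lap \<gamma> u p - c * u p\<bar> \<le> R" using f'[OF p] R(2)[OF p] by (intro exI[of _ "f' p \<xi>"]) simp
next
  fix p assume "p \<in> lattice_boundary n"
  then show "\<bar>u p\<bar> \<le> B" using u B(2) by (simp add: dirichlet_solution_iff)
qed

lemma dirichlet_to_neumann_same_cauchy:
  assumes u: "dirichlet_solution n f \<gamma> \<phi> (the_solution n f \<gamma> \<phi>)"
    and u': "dirichlet_solution n f \<gamma>' \<phi> (the_solution n f \<gamma>' \<phi>)"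
    and eq: "dirichlet_to_neumann n f \<gamma> \<phi> = dirichlet_to_neumann n f \<gamma>' \<phi>"
  shows "same_cauchy n \<gamma> \<gamma>' (the_solution n f \<gamma> \<phi>) (the_solution n f \<gamma>' \<phi>)"
  unfolding same_cauchy_def
proof (intro ballI conjI impI)
  fix p assume p: "p \<in> lattice_boundary n"
  then show "the_solution n f \<gamma> \<phi> p = the_solution n f \<gamma>' \<phi> p"
    using u u' by (simp add: dirichlet_solution_iff)
  fix x assume x: "x \<in> lattice_interior n" "{p, x} \<in> lattice_edges n"
  show "\<gamma> {p, x} * (the_solution n f \<gamma> \<phi> p - the_solution n f \<gamma> \<phi> x) =
      \<gamma>' {p, x} * (the_solution n f \<gamma>' \<phi> p - the_solution n f \<gamma>' \<phi> x)"
    using fun_cong[OF eq, of p] p neighbours_boundary[OF p x]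
    by (simp add: dirichlet_to_neumann_def Let_def)
qed

lemma vec_to_fun_col:
  assumes \<sigma>: "bij_betw \<sigma> {..<m} S" and P: "P \<in> carrier_mat m m" and p: "p \<in> S" and i: "i < m"
  shows "vec_to_fun \<sigma> S (col P i) p = P $$ (inv_into {..<m} \<sigma> p, i)" "inv_into {..<m} \<sigma> p < m"
proof -
  have "inv_into {..<m} \<sigma> p \<in> {..<m}"
    using \<sigma> p by (intro inv_into_into) (simp add: bij_betw_def)
  then show "inv_into {..<m} \<sigma> p < m" by simp
  then show "vec_to_fun \<sigma> S (col P i) p = P $$ (inv_into {..<m} \<sigma> p, i)"
    using P p i by (simp add: vec_to_fun_def)
qed

lemma vec_to_fun_bound:
  assumes \<sigma>: "bij_betw \<sigma> {..<m} S" and P: "P \<in> unit_column_matrices m \<epsilon>" and p: "p \<in> S" and i: "i < m"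
  shows "\<bar>vec_to_fun \<sigma> S (col P i) p\<bar> \<le> 1"
proof -
  have c: "P \<in> carrier_mat m m" and norm: "L2_set (\<lambda>j. col P i $ j) {..<m} = 1"
    using P i by (auto simp: unit_column_matrices_def)
  let ?r = "inv_into {..<m} \<sigma> p"
  have r: "?r < m" by (rule vec_to_fun_col(2)[OF \<sigma> c p i])
  have "\<bar>col P i $ ?r\<bar> \<le> L2_set (\<lambda>j. \<bar>col P i $ j\<bar>) {..<m}"
    using r by (intro member_le_L2_set) auto
  also have "\<dots> = 1" using norm by (simp add: L2_set_def)
  finally show ?thesis using r c i by (simp add: vec_to_fun_col(1)[OF \<sigma> c p i])
qed

section \<open>The contradiction along a sequence of counterexamples\<close>

theorem theorem6p2:
  fixes n m r :: nat
    and f :: "node \<Rightarrow> real \<Rightarrow> real"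
    and \<sigma> :: "nat \<Rightarrow> node"
    and K\<gamma> :: "(node set \<Rightarrow> real) set"
    and K\<phi> :: "(node \<Rightarrow> real) set"
    and \<epsilon> :: real
  assumes "n \<ge> 1"
    and "m = card (lattice_boundary n)"
    and "bij_betw \<sigma> {..<m} (lattice_boundary n)"
    and "r \<ge> 3"
    and "\<And>p. p \<in> lattice_interior n \<Longrightarrow> C_times r (f p)"
    and "\<And>p t. p \<in> lattice_interior n \<Longrightarrow> deriv (f p) t \<ge> 0"
    and "K\<gamma> \<subseteq> conductivities n"
    and "compactin (fun_space (lattice_edges n)) K\<gamma>"
    and "compactin (fun_space (lattice_boundary n)) K\<phi>"
    and "\<epsilon> > 0"
  shows "\<exists>t\<^sub>0>0. \<forall>P\<in>unit_column_matrices m \<epsilon>. \<forall>t\<in>{0<..t\<^sub>0}.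
           \<forall>(\<gamma>, \<phi>)\<in>K\<gamma> \<times> K\<phi>. \<forall>(\<gamma>', \<phi>')\<in>K\<gamma> \<times> K\<phi>.
             \<phi> = \<phi>' \<and>
             dirichlet_to_neumann n f \<gamma> \<phi> = dirichlet_to_neumann n f \<gamma>' \<phi>' \<and>
             (\<forall>i<m. dirichlet_to_neumann n f \<gamma> (perturb n \<phi> t (vec_to_fun \<sigma> (lattice_boundary n) (col P i)))
                  = dirichlet_to_neumann n f \<gamma>' (perturb n \<phi>' t (vec_to_fun \<sigma> (lattice_boundary n) (col P i))))
             \<longrightarrow> \<gamma> = \<gamma>'"
proof (rule ccontr)
  assume no: "\<not> ?thesis"
  define bad where "bad t\<^sub>0 P t \<gamma> \<phi> \<gamma>' \<longleftrightarrow> P \<in> unit_column_matrices m \<epsilon> \<and> 0 < t \<and> t \<le> t\<^sub>0 \<and>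
      \<gamma> \<in> K\<gamma> \<and> \<gamma>' \<in> K\<gamma> \<and> \<phi> \<in> K\<phi> \<and> \<gamma> \<noteq> \<gamma>' \<and>
      dirichlet_to_neumann n f \<gamma> \<phi> = dirichlet_to_neumann n f \<gamma>' \<phi> \<and>
      (\<forall>i<m. dirichlet_to_neumann n f \<gamma> (perturb n \<phi> t (vec_to_fun \<sigma> (lattice_boundary n) (col P i)))
           = dirichlet_to_neumann n f \<gamma>' (perturb n \<phi> t (vec_to_fun \<sigma> (lattice_boundary n) (col P i))))"
    for t\<^sub>0 P t \<gamma> \<phi> \<gamma>'
  have "\<exists>P t \<gamma> \<phi> \<gamma>'. bad t\<^sub>0 P t \<gamma> \<phi> \<gamma>'" if "0 < t\<^sub>0" for t\<^sub>0
  proof (rule ccontr)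
    assume none: "\<not> ?thesis"
    show False
    proof (rule notE[OF no], intro exI[of _ t\<^sub>0] conjI that ballI)
      fix P t x
      assume P: "P \<in> unit_column_matrices m \<epsilon>" and t: "t \<in> {0<..t\<^sub>0}" and x: "x \<in> K\<gamma> \<times> K\<phi>"
      have key: "\<gamma> = \<gamma>'" if "\<gamma> \<in> K\<gamma>" "\<gamma>' \<in> K\<gamma>" "\<phi> \<in> K\<phi>"
        "dirichlet_to_neumann n f \<gamma> \<phi> = dirichlet_to_neumann n f \<gamma>' \<phi>"
        "\<forall>i<m. dirichlet_to_neumann n f \<gamma> (perturb n \<phi> t (vec_to_fun \<sigma> (lattice_boundary n) (col P i)))
           = dirichlet_to_neumann n f \<gamma>' (perturb n \<phi> t (vec_to_fun \<sigma> (lattice_boundary n) (col P i)))"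
        for \<gamma> \<gamma>' \<phi>
      proof (rule ccontr)
        assume "\<gamma> \<noteq> \<gamma>'"
        then have "bad t\<^sub>0 P t \<gamma> \<phi> \<gamma>'"
          unfolding bad_def using that P t by (intro conjI) simp_all
        with none show False by blast
      qed
      obtain \<gamma> \<phi> where "x = (\<gamma>, \<phi>)" by (metis surj_pair)
      then show "case x of (\<gamma>, \<phi>) \<Rightarrow> \<forall>(\<gamma>', \<phi>')\<in>K\<gamma> \<times> K\<phi>. \<phi> = \<phi>' \<and>
             dirichlet_to_neumann n f \<gamma> \<phi> = dirichlet_to_neumann n f \<gamma>' \<phi>' \<and>
             (\<forall>i<m. dirichlet_to_neumann n f \<gamma> (perturb n \<phi> t (vec_to_fun \<sigma> (lattice_boundary n) (col P i)))
                  = dirichlet_to_neumann n f \<gamma>' (perturb n \<phi>' t (vec_to_fun \<sigma> (lattice_boundary n) (col P i))))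
             \<longrightarrow> \<gamma> = \<gamma>'"
        using x by (auto intro!: key[of _ _ \<phi>])
    qed
  qed
  \<comment> \<open>The choice \<open>t\<^sub>0 = 1 / (k + 1)\<close> forces the step sizes to 0 and
    keeps them at most 1.\<close>
  then have "\<forall>k::nat. \<exists>P t \<gamma> \<phi> \<gamma>'. bad (inverse (real (Suc k))) P t \<gamma> \<phi> \<gamma>'" by simp
  then obtain P t \<gamma> \<phi> \<gamma>' where "\<And>k::nat. bad (inverse (real (Suc k))) (P k) (t k) (\<gamma> k) (\<phi> k) (\<gamma>' k)"
    by metis
  note bad = this[unfolded bad_def]
  have P: "P k \<in> unit_column_matrices m \<epsilon>" and t_pos: "0 < t k" and t_le: "t k \<le> inverse (real (Suc k))"
    and \<gamma>: "\<gamma> k \<in> K\<gamma>" and \<gamma>': "\<gamma>' k \<in> K\<gamma>" and \<phi>: "\<phi> k \<in> K\<phi>" and neq: "\<gamma> k \<noteq> \<gamma>' k" for k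
    using bad[of k] by blast+
  define v where "v k i = vec_to_fun \<sigma> (lattice_boundary n) (col (P k) i)" for k i
  have dn: "dirichlet_to_neumann n f (\<gamma> k) (\<phi> k) = dirichlet_to_neumann n f (\<gamma>' k) (\<phi> k)"
    "i < m \<Longrightarrow> dirichlet_to_neumann n f (\<gamma> k) (perturb n (\<phi> k) (t k) (v k i)) =
      dirichlet_to_neumann n f (\<gamma>' k) (perturb n (\<phi> k) (t k) (v k i))" for k i
    using bad[of k] unfolding v_def by blast+
  have t_le_1: "t k \<le> 1" for k
    using order_trans[OF t_le[of k], of 1] by (simp add: inverse_le_1_iff)
  have t_lim: "t \<longlonglongrightarrow> 0"
    by (rule real_tendsto_sandwich[OF _ _ tendsto_const LIMSEQ_inverse_real_of_nat])
      (use t_pos t_le in \<open>auto intro: always_eventually less_imp_le\<close>)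
  have "(0, 1) \<in> lattice_boundary n" using \<open>1 \<le> n\<close> by (simp add: boundary_iff)
  then have m: "0 < m" using \<open>m = card (lattice_boundary n)\<close> finite_boundary card_gt_0_iff by blast
  obtain a A where ell: "\<And>\<gamma>. \<gamma> \<in> K\<gamma> \<Longrightarrow> uniformly_elliptic n a A \<gamma>" and aA: "0 < a" "a \<le> A"
    using compact_conductivities_elliptic[OF assms(7,8)] by blast
  obtain B where B: "0 \<le> B" "\<And>p \<phi>. p \<in> lattice_boundary n \<Longrightarrow> \<phi> \<in> K\<phi> \<Longrightarrow> \<bar>\<phi> p\<bar> \<le> B"
    using compact_fun_space_bounded[OF finite_boundary assms(9)] by blast
  define R where "R = (\<Sum>p\<in>lattice_interior n. \<bar>f p 0\<bar>)"
  have R: "0 \<le> R" "\<And>p. p \<in> lattice_interior n \<Longrightarrow> \<bar>f p 0\<bar> \<le> R"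
    unfolding R_def by (simp add: sum_nonneg) (rule member_le_sum; simp add: finite_interior)
  \<comment> \<open>\<open>B + 1\<close> bounds both \<open>\<phi>\<close> and
    \<open>\<phi> + t v\<close>, because \<open>t \<le> 1\<close> and the entries of
    \<open>v\<close> are at most 1 in absolute value.\<close>
  define M where "M = B + 1 + green_bound n a A * R"
  have M: "0 \<le> M" using B(1) R(1) green_bound_nonneg[OF aA] by (simp add: M_def)
  have "\<forall>p\<in>lattice_interior n. \<exists>L. C3_bounded (f p) (deriv (f p)) (3 * M) L"
    using C_times_imp_C3_bounded[OF assms(5) assms(4)] by blast
  then obtain L' where L': "\<And>p. p \<in> lattice_interior n \<Longrightarrow> C3_bounded (f p) (deriv (f p)) (3 * M) (L' p)"
    by metis
  define L where "L = (\<Sum>p\<in>lattice_interior n. \<bar>L' p\<bar>)"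
  have L: "0 \<le> L" by (simp add: L_def sum_nonneg)
  have C3: "C3_bounded (f p) (deriv (f p)) (3 * M) L" if p: "p \<in> lattice_interior n" for p
  proof (rule C3_bounded_mono[OF L'[OF p]])
    have "\<bar>L' p\<bar> \<le> L" unfolding L_def by (rule member_le_sum[OF p]) (simp_all add: finite_interior)
    then show "L' p \<le> L" by simp
  qed
  have f: "(f p has_real_derivative deriv (f p) x) (at x)" if "p \<in> lattice_interior n" for p x
    using C3[OF that] unfolding C3_bounded_def by blast
  have sol: "dirichlet_solution n f g \<psi> (the_solution n f g \<psi>)" if "g \<in> K\<gamma>" for g \<psi>
    by (rule the_solution_dirichlet[OF ell[OF that] f assms(6)])
  have sol_bound: "\<bar>the_solution n f g \<psi> p\<bar> \<le> M"
    if "g \<in> K\<gamma>" "\<And>p. p \<in> lattice_boundary n \<Longrightarrow> \<bar>\<psi> p\<bar> \<le> B + 1" "p \<in> lattice_nodes n" for g \<psi> p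
  proof -
    have "0 \<le> B + 1" using B(1) by linarith
    from dirichlet_solution_bound[OF ell[OF that(1)] f assms(6) R this that(2) sol[OF that(1)] that(3)]
    show ?thesis by (simp add: M_def)
  qed
  have sol_lap: "lap g (the_solution n f g \<psi>) p = f p (the_solution n f g \<psi> p)"
    if "g \<in> K\<gamma>" "p \<in> lattice_interior n" for g \<psi> p
    using sol[OF that(1)] that(2) unfolding dirichlet_solution_iff by blast
  have sol_boundary: "the_solution n f g \<psi> p = \<psi> p" if "g \<in> K\<gamma>" "p \<in> lattice_boundary n" for g \<psi> p
    using sol[OF that(1)] that(2) unfolding dirichlet_solution_iff by blast
  define u where "u k = the_solution n f (\<gamma> k) (\<phi> k)" for k
  define u' where "u' k = the_solution n f (\<gamma>' k) (\<phi> k)" for k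
  define U where "U k i = the_solution n f (\<gamma> k) (perturb n (\<phi> k) (t k) (v k i))" for k i
  define U' where "U' k i = the_solution n f (\<gamma>' k) (perturb n (\<phi> k) (t k) (v k i))" for k i
  \<comment> \<open>As a finite sum over the edges, \<open>\<delta>\<close> is
    \<open>o(\<delta>)\<close> once each edge difference is.\<close>
  define \<delta> where "\<delta> k = (\<Sum>e\<in>lattice_edges n. \<bar>\<gamma> k e - \<gamma>' k e\<bar>)" for k
  have v_bound: "\<bar>v k i p\<bar> \<le> 1" if "i < m" "p \<in> lattice_boundary n" for k i p
    unfolding v_def by (rule vec_to_fun_bound[OF assms(3) P that(2,1)])
  have pert: "perturb n (\<phi> k) (t k) (v k i) p = \<phi> k p + t k * v k i p" if "p \<in> lattice_boundary n" for k i p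
    using that by (simp add: perturb_def)
  have pert_bound: "\<bar>perturb n (\<phi> k) (t k) (v k i) p\<bar> \<le> B + 1"
    if "i < m" "p \<in> lattice_boundary n" for k i p
  proof -
    have "\<bar>t k * v k i p\<bar> \<le> 1 * 1"
      unfolding abs_mult using t_pos[of k] t_le_1[of k] v_bound[OF that] by (intro mult_mono) auto
    then show ?thesis unfolding pert[OF that(2)] using B(2)[OF that(2) \<phi>[of k]] by linarith
  qed
  have \<phi>_bound: "\<bar>\<phi> k p\<bar> \<le> B + 1" if "p \<in> lattice_boundary n" for k p
    using B(2)[OF that \<phi>[of k]] by linarith
  have pp: "perturbed_pair n a A M L (t k) (\<delta> k) f (\<lambda>p. deriv (f p)) (\<gamma> k) (\<gamma>' k) (u k) (u' k) (U k i) (U' k i) (v k i)"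
    if i: "i < m" for k i
  proof
    show "uniformly_elliptic n a A (\<gamma> k)" "uniformly_elliptic n a A (\<gamma>' k)"
      by (rule ell[OF \<gamma>] ell[OF \<gamma>'])+
    show "\<bar>\<gamma> k e - \<gamma>' k e\<bar> \<le> \<delta> k" if "e \<in> lattice_edges n" for e
      unfolding \<delta>_def by (rule member_le_sum[OF that]) (simp_all add: finite_edges)
    show "0 \<le> \<delta> k" by (simp add: \<delta>_def sum_nonneg)
    show "C3_bounded (f p) (deriv (f p)) (3 * M) L" "0 \<le> deriv (f p) x" if "p \<in> lattice_interior n" for p x
      by (rule C3[OF that] assms(6)[OF that])+
    show "\<bar>u k p\<bar> \<le> M" "\<bar>u' k p\<bar> \<le> M" "\<bar>U k i p\<bar> \<le> M" "\<bar>U' k i p\<bar> \<le> M" if "p \<in> lattice_nodes n" for p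
      unfolding u_def u'_def U_def U'_def
      by (rule sol_bound[OF \<gamma> _ that] sol_bound[OF \<gamma>' _ that]; rule \<phi>_bound pert_bound[OF i]; assumption)+
    show "lap (\<gamma> k) (u k) p = f p (u k p)" "lap (\<gamma>' k) (u' k) p = f p (u' k p)"
      "lap (\<gamma> k) (U k i) p = f p (U k i p)" "lap (\<gamma>' k) (U' k i) p = f p (U' k i p)"
      if "p \<in> lattice_interior n" for p
      unfolding u_def u'_def U_def U'_def by (rule sol_lap[OF \<gamma> that] sol_lap[OF \<gamma>' that])+
    show "same_cauchy n (\<gamma> k) (\<gamma>' k) (u k) (u' k)" "same_cauchy n (\<gamma> k) (\<gamma>' k) (U k i) (U' k i)"
      unfolding u_def u'_def U_def U'_def
      by (rule dirichlet_to_neumann_same_cauchy[OF sol[OF \<gamma>] sol[OF \<gamma>']]; rule dn(1) dn(2)[OF i])+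
    show "U k i p = u k p + t k * v k i p" if "p \<in> lattice_boundary n" for p
      unfolding u_def U_def sol_boundary[OF \<gamma> that] by (rule pert[OF that])
    show "\<bar>v k i p\<bar> \<le> 1" if "p \<in> lattice_boundary n" for p by (rule v_bound[OF i that])
  qed (rule L M t_pos)+
  have "\<forall>k. \<exists>Q. (\<forall>i<m. \<forall>s<m. \<bar>Q i s\<bar> \<le> fact m / \<epsilon>) \<and>
    (\<forall>r<m. \<forall>s<m. (\<Sum>i<m. Q i s * P k $$ (r, i)) = (if s = r then 1 else 0))"
    using unit_column_dual[OF P assms(10)] by blast
  then obtain Q where Q: "\<And>k i s. i < m \<Longrightarrow> s < m \<Longrightarrow> \<bar>Q k i s\<bar> \<le> fact m / \<epsilon>"
    "\<And>k r s. r < m \<Longrightarrow> s < m \<Longrightarrow> (\<Sum>i<m. Q k i s * P k $$ (r, i)) = (if s = r then 1 else 0)"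
    by metis
  define \<tau> where "\<tau> = inv_into {..<m} \<sigma>"
  have carrier: "P k \<in> carrier_mat m m" for k using P[of k] by (simp add: unit_column_matrices_def)
  have v_eq: "v k i p = P k $$ (\<tau> p, i)" and \<tau>: "\<tau> p < m" if "p \<in> lattice_boundary n" "i < m" for k i p
    unfolding v_def \<tau>_def by (rule vec_to_fun_col[OF assms(3) carrier that])+
  have \<tau>_inj: "\<tau> s = \<tau> p \<longleftrightarrow> s = p" if "s \<in> lattice_boundary n" "p \<in> lattice_boundary n" for s p
    using that assms(3) unfolding \<tau>_def bij_betw_def by (metis inv_into_injective)
  have pair: "conductivity_pair n a A \<gamma> \<gamma>' u u' (\<lambda>k p. deriv (f p) (u k p)) (\<lambda>k p. deriv (f p) (u' k p)) \<delta>"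
  proof (rule perturbed_sequences[OF pp m t_lim])
    show "\<bar>Q k i (\<tau> s)\<bar> \<le> fact m / \<epsilon>" if "i < m" "s \<in> lattice_boundary n" for k i s
      by (rule Q(1)[OF that(1) \<tau>[OF that(2,1)]])
    show "(\<Sum>i<m. Q k i (\<tau> s) * v k i p) = (if s = p then 1 else 0)"
      if "p \<in> lattice_boundary n" "s \<in> lattice_boundary n" for k p s
      using Q(2)[OF \<tau>[OF that(1) m] \<tau>[OF that(2) m], of k] \<tau>_inj[OF that(2,1)] v_eq[OF that(1)] by simp
  qed
  have "(\<lambda>k. \<gamma> k e - \<gamma>' k e) \<in> o(\<delta>)" if "e \<in> lattice_edges n" for e
    by (rule conductivity_pair.contrast_small[OF pair assms(1) that])
  then have "(\<lambda>k. \<Sum>e\<in>lattice_edges n. \<bar>\<gamma> k e - \<gamma>' k e\<bar>) \<in> o(\<delta>)"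
    by (intro big_sum_in_smallo) simp
  then have "\<delta> \<in> o(\<delta>)" unfolding \<delta>_def[abs_def] .
  \<comment> \<open>Only a sequence that is eventually zero is small compared with itself. One such
    \<open>k\<close> suffices: equality on the edges is equality of the extensional
    functions.\<close>
  then have "eventually (\<lambda>k. \<delta> k = 0) sequentially" by (simp add: landau_o.small_refl_iff)
  then obtain k where k: "\<delta> k = 0" by (auto simp: eventually_sequentially)
  have "\<gamma> k e = \<gamma>' k e" if "e \<in> lattice_edges n" for e
    using k that finite_edges unfolding \<delta>_def by (simp add: sum_nonneg_eq_0_iff)
  moreover have "\<gamma> k \<in> lattice_edges n \<rightarrow>\<^sub>E {0<..}" "\<gamma>' k \<in> lattice_edges n \<rightarrow>\<^sub>E {0<..}"
    using \<gamma> \<gamma>' assms(7) unfolding conductivities_def by blast+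
  ultimately have "\<gamma> k = \<gamma>' k" by (metis PiE_ext)
  with neq show False by blast
qed

end
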